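(* Let $0<\theta<1$ be irrational with continued fraction expansion $\theta=[0;a_1,a_2,\dots]$. If there exist constants $C\ge1$, $s\ge1$ such that $a_j\le Cj^s$ for all $j\geq 1$, then the spectral triple $(C_\infty(X^\theta),L^2(X^\theta,\mu),D_{X^\theta})$ has finite Connes metric, and the topology induced by the Connes metric on the state space of $C(X^\theta)$ is the weak-$*$ topology. Here $X^\theta$ is the Sturmian subshift of parameter $\theta$ and $\mu$ is its unique invariant probability measure.
   Context: Sturmian subshifts. For irrational $0<\theta<1$, $X^\theta\subseteq\{0,1\}^{\mathbb{Z}}$ is the set of all sequences $w=(w_n)_{n\in\mathbb{Z}}$ such that, for some real number $x$ and for $I$ either $[0,1-\theta)$ or $(0,1-\theta]$, one has for all $n$: $w_n=0$ if $\{n\theta-x\}\in I$ and $w_n=1$ otherwise, where $\{y\}=y-\lfloor y\rfloor$. With the left shift $\sigma(x)_n=x_{n+1}$, $X^\theta$ is a minimal, uniquely ergodic subshift (well known); its unique invariant probability measure $\mu$ has support $X^\theta$. The notation $[0;a_1,a_2,\dots]$ is the usual simple continued fraction with positive integer partial quotients $a_j$. Spectral triple. Let $X=X^\theta$. For $n\ge1$, $X_n=\{(x_1,\dots,x_n):x\in X\}$. For $w\in X_n$, $U(w)=\{x\in X:(x_{-m},\dots,x_m)=w\}$ if $n=2m+1$, and $U(w)=\{x\in X:(x_{1-m},\dots,x_m)=w\}$ if $n=2m\ge2$; $\xi(w)$ is the characteristic function of $U(w)$. Set $C_{-1}=\{0\}$, $C_0=\mathbb{C}1$, $C_n=\mathrm{span}\{\xi(w):w\in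 X_n\}$ for $n\ge1$, viewed both in $C(X)$ and in $L^2(X,\mu)$; $C_\infty(X)=\bigcup_nC_n$, acting on $L^2(X,\mu)$ by multiplication. $D_X$ is the operator on $L^2(X,\mu)$ with domain $\{\sum_{n\ge0}\xi_n:\xi_n\in C_n\cap C_{n-1}^\perp,\ \sum_n(n\|\xi_n\|)^2<\infty\}$ and $D_X\xi=n\xi$ for $\xi\in C_n\cap C_{n-1}^\perp$, $n\ge0$. For every $f\in C_\infty(X)$, $[D_X,f]$ extends to a bounded operator, whose norm is denoted $\|[D_X,f]\|$. Connes metric. On the state space of $C(X)$, $d(\phi,\psi)=\sup\{|\phi(f)-\psi(f)|: f\in C_\infty(X),\ \|[D_X,f]\|\le1\}\in[0,\infty]$. It is called finite if $d(\phi,\psi)<\infty$ for all states $\phi,\psi$. *)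

theory Defs
  imports "HOL-Analysis.Analysis" "HOL-Probability.Probability"
begin

section \<open>Sturmian subshifts and continued fractions\<close>

text \<open>
  Two-sided sequences over the alphabet $\{0,1\}$ are functions of type \<open>int \<Rightarrow> nat\<close>; the library
  topology on this type is the product of the discrete topologies.
\<close>

definition sturmian :: "real \<Rightarrow> (int \<Rightarrow> nat) set" where
  "sturmian \<theta> = {w. \<exists>x::real. \<exists>I \<in> {{0..<1-\<theta>}, {0<..1-\<theta>}}.
      \<forall>n. w n = (if frac (of_int n * \<theta> - x) \<in> I then 0 else 1)}"

definition shift :: "(int \<Rightarrow> nat) \<Rightarrow> (int \<Rightarrow> nat)" where
  "shift x = (\<lambda>n. x (n + 1))"

definition invariant_prob :: "(int \<Rightarrow> nat) set \<Rightarrow> (int \<Rightarrow> nat) measure \<Rightarrow> bool" where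
  "invariant_prob X \<mu> \<longleftrightarrow> prob_space \<mu> \<and> sets \<mu> = sets (restrict_space borel X) \<and>
     shift \<in> measurable \<mu> \<mu> \<and> distr \<mu> \<mu> shift = \<mu>"

text \<open>\<open>cfrac_list [a\<^sub>1, \<dots>, a\<^sub>n]\<close> is the value of $[0; a_1, \dots, a_n]$.\<close>

fun cfrac_list :: "nat list \<Rightarrow> real" where
  "cfrac_list [] = 0"
| "cfrac_list (a # as) = 1 / (real a + cfrac_list as)"

text \<open>$\theta = [0; a_1, a_2, \dots]$; the value \<open>a 0\<close> is not used.\<close>

definition has_cfrac :: "real \<Rightarrow> (nat \<Rightarrow> nat) \<Rightarrow> bool" where
  "has_cfrac \<theta> a \<longleftrightarrow> (\<forall>j\<ge>1. a j \<ge> 1) \<and> (\<lambda>n. cfrac_list (map a [1..<Suc n])) \<longlonglongrightarrow> \<theta>"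

section \<open>The filtration of locally constant functions\<close>

definition words :: "(int \<Rightarrow> nat) set \<Rightarrow> nat \<Rightarrow> nat list set" where
  "words X n = {map x [1..int n] | x. x \<in> X}"

definition window :: "nat \<Rightarrow> int list" where
  "window n = (let m = int (n div 2) in if odd n then [-m..m] else [1-m..m])"

definition cyl :: "(int \<Rightarrow> nat) set \<Rightarrow> nat list \<Rightarrow> (int \<Rightarrow> nat) set" where
  "cyl X w = {x \<in> X. map x (window (length w)) = w}"

text \<open>
  Functions on \<open>X\<close> are represented by functions on the whole type that vanish outside \<open>X\<close>.
  For \<open>n = 0\<close> the only word is the empty one, its cylinder set is \<open>X\<close>, and \<open>C_fin X 0\<close> consists of
  the constants. For every \<open>n\<close> the sum is finite, since the alphabet is.
\<close>

definition C_fin :: "(int \<Rightarrow> nat) set \<Rightarrow> nat \<Rightarrow> ((int \<Rightarrow> nat) \<Rightarrow> complex) set" where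
  "C_fin X n = {(\<lambda>x. \<Sum>w\<in>words X n. c w * indicator (cyl X w) x) | c. True}"

definition C_inf :: "(int \<Rightarrow> nat) set \<Rightarrow> ((int \<Rightarrow> nat) \<Rightarrow> complex) set" where
  "C_inf X = (\<Union>n. C_fin X n)"

section \<open>The operator and its commutators\<close>

text \<open>
  Elements of $L^2(X,\mu)$ are handled through representatives: square-integrable functions, with
  almost everywhere equality expressed by vanishing of \<open>norm_L2\<close> of the difference.
\<close>

definition sq_integrable :: "'a measure \<Rightarrow> ('a \<Rightarrow> complex) set" where
  "sq_integrable M = {f \<in> borel_measurable M. integrable M (\<lambda>x. (cmod (f x))\<^sup>2)}"

definition inner_L2 :: "'a measure \<Rightarrow> ('a \<Rightarrow> complex) \<Rightarrow> ('a \<Rightarrow> complex) \<Rightarrow> complex" where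
  "inner_L2 M f g = (\<integral>x. f x * cnj (g x) \<partial>M)"

definition norm_L2 :: "'a measure \<Rightarrow> ('a \<Rightarrow> complex) \<Rightarrow> real" where
  "norm_L2 M f = sqrt (\<integral>x. (cmod (f x))\<^sup>2 \<partial>M)"

definition sums_L2 :: "'a measure \<Rightarrow> (nat \<Rightarrow> 'a \<Rightarrow> complex) \<Rightarrow> ('a \<Rightarrow> complex) \<Rightarrow> bool" where
  "sums_L2 M e f \<longleftrightarrow> (\<lambda>N. norm_L2 M (\<lambda>x. f x - (\<Sum>n<N. e n x))) \<longlonglongrightarrow> 0"

text \<open>
  The space $C_n \cap C_{n-1}^\perp$; for \<open>n = 0\<close> the orthogonality condition is void because
  $C_{-1} = \{0\}$.
\<close>

definition eigenspace_D ::
    "(int \<Rightarrow> nat) set \<Rightarrow> (int \<Rightarrow> nat) measure \<Rightarrow> nat \<Rightarrow> ((int \<Rightarrow> nat) \<Rightarrow> complex) set" where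
  "eigenspace_D X \<mu> n =
     {f \<in> C_fin X n. n = 0 \<or> (\<forall>g \<in> C_fin X (n - 1). inner_L2 \<mu> f g = 0)}"

text \<open>
  The unbounded operator $D_X$, given by its graph (again on representatives): the pairs
  $(\sum_n \xi_n, \sum_n n\,\xi_n)$ with $\xi_n \in C_n \cap C_{n-1}^\perp$ and
  $\sum_n (n \|\xi_n\|)^2 < \infty$.
\<close>

definition graph_D ::
    "(int \<Rightarrow> nat) set \<Rightarrow> (int \<Rightarrow> nat) measure
      \<Rightarrow> (((int \<Rightarrow> nat) \<Rightarrow> complex) \<times> ((int \<Rightarrow> nat) \<Rightarrow> complex)) set" where
  "graph_D X \<mu> = {(\<xi>, \<eta>). \<xi> \<in> sq_integrable \<mu> \<and> \<eta> \<in> sq_integrable \<mu> \<and>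
     (\<exists>e. (\<forall>n. e n \<in> eigenspace_D X \<mu> n) \<and>
          summable (\<lambda>n. (real n * norm_L2 \<mu> (e n))\<^sup>2) \<and>
          sums_L2 \<mu> e \<xi> \<and> sums_L2 \<mu> (\<lambda>n x. of_nat n * e n x) \<eta>)}"

text \<open>
  The operator norm of $[D_X, f] = D_X f - f D_X$, that is the supremum of
  $\|D_X(f\xi) - f D_X\xi\|$ over those $\xi$ in the unit ball for which both $\xi$ and $f\xi$ lie
  in the domain of $D_X$. In the set below, $\eta = D_X\xi$ and $\zeta = D_X(f\xi)$.
\<close>

definition commutator_norm ::
    "(int \<Rightarrow> nat) set \<Rightarrow> (int \<Rightarrow> nat) measure \<Rightarrow> ((int \<Rightarrow> nat) \<Rightarrow> complex) \<Rightarrow> ennreal" where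
  "commutator_norm X \<mu> f =
     Sup {ennreal (norm_L2 \<mu> (\<lambda>x. \<zeta> x - f x * \<eta> x)) | \<xi> \<eta> \<zeta>.
       (\<xi>, \<eta>) \<in> graph_D X \<mu> \<and> ((\<lambda>x. f x * \<xi> x), \<zeta>) \<in> graph_D X \<mu> \<and> norm_L2 \<mu> \<xi> \<le> 1}"

section \<open>The state space and its two topologies\<close>

definition C_cont :: "(int \<Rightarrow> nat) set \<Rightarrow> ((int \<Rightarrow> nat) \<Rightarrow> complex) set" where
  "C_cont X = {f. continuous_on X f \<and> (\<forall>x. x \<notin> X \<longrightarrow> f x = 0)}"

text \<open>
  Membership in \<open>extensional\<close> makes a state determined by its values on \<open>C_cont X\<close>; the unit of
  the algebra is \<open>indicator X\<close>.
\<close>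

definition states :: "(int \<Rightarrow> nat) set \<Rightarrow> (((int \<Rightarrow> nat) \<Rightarrow> complex) \<Rightarrow> complex) set" where
  "states X = {\<phi> \<in> extensional (C_cont X).
     (\<forall>f\<in>C_cont X. \<forall>g\<in>C_cont X. \<phi> (\<lambda>x. f x + g x) = \<phi> f + \<phi> g) \<and>
     (\<forall>c. \<forall>f\<in>C_cont X. \<phi> (\<lambda>x. c * f x) = c * \<phi> f) \<and>
     (\<forall>f\<in>C_cont X. (\<forall>x\<in>X. f x \<in> \<real>\<^sub>\<ge>\<^sub>0) \<longrightarrow> \<phi> f \<in> \<real>\<^sub>\<ge>\<^sub>0) \<and>
     \<phi> (indicator X) = 1}"

text \<open>The weak-$*$ topology is the topology of pointwise convergence on \<open>C_cont X\<close>.\<close>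

definition weak_star :: "(int \<Rightarrow> nat) set \<Rightarrow> (((int \<Rightarrow> nat) \<Rightarrow> complex) \<Rightarrow> complex) topology" where
  "weak_star X = subtopology (product_topology (\<lambda>_. euclidean) (C_cont X)) (states X)"

definition connes_dist ::
    "(int \<Rightarrow> nat) set \<Rightarrow> (int \<Rightarrow> nat) measure \<Rightarrow> (((int \<Rightarrow> nat) \<Rightarrow> complex) \<Rightarrow> complex)
      \<Rightarrow> (((int \<Rightarrow> nat) \<Rightarrow> complex) \<Rightarrow> complex) \<Rightarrow> ennreal" where
  "connes_dist X \<mu> \<phi> \<psi> =
     (SUP f \<in> {f \<in> C_inf X. commutator_norm X \<mu> f \<le> 1}. ennreal (cmod (\<phi> f - \<psi> f)))"

text \<open>
  The distance is \<open>ennreal\<close>-valued, so its topology is generated from the open balls directly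
  rather than through \<open>Metric_space\<close>, which needs real-valued distances.
\<close>

definition connes_topology ::
    "(int \<Rightarrow> nat) set \<Rightarrow> (int \<Rightarrow> nat) measure
      \<Rightarrow> (((int \<Rightarrow> nat) \<Rightarrow> complex) \<Rightarrow> complex) topology" where
  "connes_topology X \<mu> = topology_generated_by
     {{\<psi> \<in> states X. connes_dist X \<mu> \<phi> \<psi> < ennreal r} | \<phi> r. \<phi> \<in> states X \<and> 0 < r}"

end

theory Submission
  imports Defs
begin

text \<open>
  Let $P_n$ be the orthogonal projection of $L^2(X,\mu)$ onto $C_n$. Everything rests on a lower bound
  $\mu(U(w)) \ge c\,n^{-\tau}$ for the cylinders of words \<open>w\<close> of length \<open>n\<close>, with an exponent
  $\tau < 2$.

  \<^bold>\<open>From the cylinder bound to the metric.\<close> Applied to the constant function $1$, on which $D$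
  vanishes, the commutator gives $[D,f]1 = Df$, so $\|[D,f]\| \le 1$ implies $\|Df\| \le 1$. The part
  $g_k$ of $f$ in the eigenspaces $2^k \le n < 2^{k+1}$ then has $\|g_k\| \le 2^{-k}$. As $g_k$ is
  constant on cylinders of length below $2^{k+1}$, its values satisfy
  $|g_k(x)|^2\,\mu(U) \le \|g_k\|^2$ for the cylinder $U$ of \<open>x\<close>, whence
  $|g_k(x)| \le \mathrm{const}\cdot 2^{k(\tau/2-1)}$. These bounds form a geometric series: all
  admissible functions are approximated by their projections to $C_{2^k-1}$ with one common error
  $\varepsilon_k \to 0$ (\<open>admissible_tail\<close>). Two states therefore differ on admissible functions by at
  most $4\varepsilon_k$ plus a multiple of the sum of their differences on the finitely many cylinders of
  one length (\<open>state_difference_bound\<close>). This gives finiteness of the metric and weak-$*$ open balls.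
  Conversely, $[D,f]$ is bounded for every locally constant \<open>f\<close> (\<open>commutator_norm_le\<close>), and
  locally constant functions are dense in $C(X)$ because \<open>X\<close> is compact (\<open>C_inf_dense\<close>); so the
  Connes topology makes every evaluation $\phi \mapsto \phi(f)$ continuous
  (\<open>connes_evaluation\<close>). Both directions together are \<open>connes_metric_criterion\<close>.

  \<^bold>\<open>The cylinder bound for Sturmian subshifts.\<close> If every sequence of \<open>X\<close> enters a cylinder
  within \<open>N\<close> shifts, invariance of $\mu$ bounds the measure of the cylinder below by $1/(N+1)$
  (\<open>measure_lower_bound_of_recurrence\<close>). A word of length
  \<open>n\<close> fixes the parameter of the sequence up to an interval whose end points differ by
  $k\theta + P$ with integers $|k| \le n$ and \<open>P\<close>, and the return time to an interval of length
  $\delta$ is controlled by a rational approximation $p/q$ of $\theta$ with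
  $|q\theta - p| < \delta$ (\<open>sturmian_recurrence\<close>). Under a Diophantine bound
  $|j\theta - p| \ge c\,j^{-\beta}$ the interval has length at least $c\,n^{-\beta}$, and the return time is
  $O(\delta^{-\beta}) = O(n^{\beta^2})$; thus $\tau = \beta^2$. Since the denominators of the convergents of
  $\theta$ grow exponentially while the partial quotients grow polynomially, every $\beta > 1$ is
  possible. The choice $\beta = 5/4$ gives $\tau = 25/16 < 2$ (\<open>diophantine_bound\<close>).
\<close>

section \<open>Continued fractions and a Diophantine bound\<close>

lemma cfrac_list_bounds:
  assumes "\<forall>x\<in>set xs. x \<ge> 1"
  shows "0 \<le> cfrac_list xs \<and> cfrac_list xs \<le> 1"
  using assms
proof (induction xs)
  case (Cons x xs)
  then have "real x + cfrac_list xs \<ge> 1" by (simp add: add_increasing2)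
  then show ?case by simp
qed simp

lemma has_cfrac_bounds:
  assumes "has_cfrac \<theta> a" "\<theta> \<notin> \<rat>"
  shows "0 < \<theta>" "\<theta> < 1"
proof -
  let ?c = "\<lambda>n. cfrac_list (map a [1..<Suc n])"
  have b: "0 \<le> ?c n \<and> ?c n \<le> 1" for n
    using assms(1) by (intro cfrac_list_bounds) (auto simp: has_cfrac_def)
  have l: "?c \<longlonglongrightarrow> \<theta>" using assms(1) by (simp add: has_cfrac_def)
  have "0 \<le> \<theta>" using b by (intro LIMSEQ_le_const[OF l]) auto
  moreover have "\<theta> \<le> 1" using b by (intro LIMSEQ_le_const2[OF l]) auto
  moreover have "\<theta> \<noteq> 0" "\<theta> \<noteq> 1" using assms(2) by auto
  ultimately show "0 < \<theta>" "\<theta> < 1" by auto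
qed

text \<open>
  The Gauss map shifts the partial quotients: this is the recursion
  $[0; a_1, \ldots, a_{n+1}] = 1/(a_1 + [0; a_2, \ldots, a_{n+1}])$ in the limit.
\<close>

lemma has_cfrac_tail:
  assumes "has_cfrac \<theta> a" "\<theta> \<notin> \<rat>"
  shows "has_cfrac (1 / \<theta> - real (a 1)) (\<lambda>j. a (Suc j))" "1 / \<theta> - real (a 1) \<notin> \<rat>"
proof -
  let ?c = "\<lambda>n. cfrac_list (map a [1..<Suc n])"
  let ?d = "\<lambda>n. cfrac_list (map (\<lambda>j. a (Suc j)) [1..<Suc n])"
  have nz: "\<theta> \<noteq> 0" using assms(2) by auto
  have l: "?c \<longlonglongrightarrow> \<theta>" using assms(1) by (simp add: has_cfrac_def)
  have e: "?c (Suc n) = 1 / (real (a 1) + ?d n)" for n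
  proof -
    have "[1..<Suc (Suc n)] = 1 # map Suc [1..<Suc n]"
      by (subst map_Suc_upt, rule upt_conv_Cons) simp
    then show ?thesis by (simp only: list.map cfrac_list.simps map_map comp_def)
  qed
  have "(\<lambda>n. 1 / ?c (Suc n) - real (a 1)) \<longlonglongrightarrow> 1 / \<theta> - real (a 1)"
    by (rule tendsto_diff[OF tendsto_divide[OF tendsto_const LIMSEQ_Suc[OF l] nz] tendsto_const])
  then have "?d \<longlonglongrightarrow> 1 / \<theta> - real (a 1)" unfolding e by simp
  then show "has_cfrac (1 / \<theta> - real (a 1)) (\<lambda>j. a (Suc j))"
    using assms(1) by (auto simp: has_cfrac_def)
  show "1 / \<theta> - real (a 1) \<notin> \<rat>"
  proof
    assume "1 / \<theta> - real (a 1) \<in> \<rat>"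
    then have "inverse (1 / \<theta> - real (a 1) + real (a 1)) \<in> \<rat>"
      by (intro Rats_inverse Rats_add) auto
    then show False using assms(2) by simp
  qed
qed

text \<open>
  Denominator and numerator of the convergent $p_k/q_k = [0; a_1, \ldots, a_k]$, with
  $q_0 = 1$ and $p_0 = 0$.
\<close>

fun cf_den :: "(nat \<Rightarrow> nat) \<Rightarrow> nat \<Rightarrow> int" where
  "cf_den a 0 = 1"
| "cf_den a (Suc 0) = int (a 1)"
| "cf_den a (Suc (Suc k)) = int (a (Suc (Suc k))) * cf_den a (Suc k) + cf_den a k"

fun cf_num :: "(nat \<Rightarrow> nat) \<Rightarrow> nat \<Rightarrow> int" where
  "cf_num a 0 = 0"
| "cf_num a (Suc 0) = 1"
| "cf_num a (Suc (Suc k)) = int (a (Suc (Suc k))) * cf_num a (Suc k) + cf_num a k"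

text \<open>
  The iterates of the Gauss map at $\theta = [0; a_1, a_2, \ldots]$, that is
  $[0; a_{k+1}, a_{k+2}, \ldots]$.
\<close>

primrec cf_tail :: "real \<Rightarrow> (nat \<Rightarrow> nat) \<Rightarrow> nat \<Rightarrow> real" where
  "cf_tail \<theta> a 0 = \<theta>"
| "cf_tail \<theta> a (Suc k) = 1 / cf_tail \<theta> a k - real (a (Suc k))"

text \<open>
  This product is the approximation error $|q_k\theta - p_k|$; see \<open>cf_err_eq\<close>. In this form its
  positivity and monotonicity are immediate.
\<close>

definition cf_err :: "real \<Rightarrow> (nat \<Rightarrow> nat) \<Rightarrow> nat \<Rightarrow> real" where
  "cf_err \<theta> a k = (\<Prod>i\<le>k. cf_tail \<theta> a i)"

lemma cf_tail_has_cfrac: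
  assumes "has_cfrac \<theta> a" "\<theta> \<notin> \<rat>"
  shows "has_cfrac (cf_tail \<theta> a k) (\<lambda>j. a (j + k)) \<and> cf_tail \<theta> a k \<notin> \<rat>"
proof (induction k)
  case (Suc k)
  then have "has_cfrac (cf_tail \<theta> a (Suc k)) (\<lambda>j. a (Suc j + k))" "cf_tail \<theta> a (Suc k) \<notin> \<rat>"
    using has_cfrac_tail[of "cf_tail \<theta> a k" "\<lambda>j. a (j + k)"] by simp_all
  then show ?case by simp
qed (use assms in simp)

lemma cf_tail_bounds:
  assumes "has_cfrac \<theta> a" "\<theta> \<notin> \<rat>"
  shows "0 < cf_tail \<theta> a k" "cf_tail \<theta> a k < 1"
  using has_cfrac_bounds cf_tail_has_cfrac[OF assms] by blast+

lemma cf_err_rec: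
  assumes "has_cfrac \<theta> a" "\<theta> \<notin> \<rat>"
  shows "cf_err \<theta> a (Suc (Suc k)) = cf_err \<theta> a k - real (a (Suc (Suc k))) * cf_err \<theta> a (Suc k)"
  using cf_tail_bounds(1)[OF assms, of "Suc k"]
  by (simp add: cf_err_def field_simps del: cf_tail.simps(2) add: cf_tail.simps(2)[of _ _ "Suc k"])

lemma cf_err_pos:
  assumes "has_cfrac \<theta> a" "\<theta> \<notin> \<rat>"
  shows "0 < cf_err \<theta> a k" "cf_err \<theta> a (Suc k) < cf_err \<theta> a k"
proof -
  show p: "0 < cf_err \<theta> a k"
    unfolding cf_err_def using cf_tail_bounds(1)[OF assms] by (intro prod_pos) auto
  show "cf_err \<theta> a (Suc k) < cf_err \<theta> a k"
    using p cf_tail_bounds(2)[OF assms, of "Suc k"] by (simp add: cf_err_def del: cf_tail.simps)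
qed

lemma cf_err_eq:
  assumes "has_cfrac \<theta> a" "\<theta> \<notin> \<rat>"
  shows "of_int (cf_den a k) * \<theta> - of_int (cf_num a k) = (-1) ^ k * cf_err \<theta> a k"
proof (induction k rule: induct_nat_012)
  case 1
  have "\<theta> \<noteq> 0" using assms(2) by auto
  then show ?case by (simp add: cf_err_def field_simps)
next
  case (ge2 n)
  let ?b = "real (a (Suc (Suc n)))"
  have "of_int (cf_den a (Suc (Suc n))) * \<theta> - of_int (cf_num a (Suc (Suc n)))
      = ?b * (of_int (cf_den a (Suc n)) * \<theta> - of_int (cf_num a (Suc n)))
        + (of_int (cf_den a n) * \<theta> - of_int (cf_num a n))"
    by (simp add: algebra_simps)
  also have "\<dots> = ?b * ((-1) ^ Suc n * cf_err \<theta> a (Suc n)) + (-1) ^ n * cf_err \<theta> a n"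
    unfolding ge2 ..
  finally show ?case by (simp add: cf_err_rec[OF assms] algebra_simps)
qed (simp add: cf_err_def)

lemma cf_det: "cf_den a k * cf_num a (Suc k) - cf_den a (Suc k) * cf_num a k = (-1) ^ k"
proof (induction k)
  case (Suc k)
  then show ?case by (simp add: algebra_simps)
qed simp

lemma cf_den_err:
  assumes "has_cfrac \<theta> a" "\<theta> \<notin> \<rat>"
  shows "of_int (cf_den a (Suc k)) * cf_err \<theta> a k + of_int (cf_den a k) * cf_err \<theta> a (Suc k) = 1"
proof (induction k)
  case 0
  have "\<theta> \<noteq> 0" using assms(2) by auto
  then show ?case by (simp add: cf_err_def field_simps)
next
  case (Suc k)
  then show ?case by (simp add: cf_err_rec[OF assms] algebra_simps)
qed

lemma cf_den_pos:
  assumes "\<forall>j\<ge>1. a j \<ge> 1"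
  shows "cf_den a k \<ge> 1"
proof (induction k rule: induct_nat_012)
  case (ge2 n)
  then show ?case by (simp add: add_increasing)
qed (use assms in auto)

lemma cf_den_mono:
  assumes "\<forall>j\<ge>1. a j \<ge> 1"
  shows "cf_den a k \<le> cf_den a (Suc k)"
proof (cases k)
  case 0
  then show ?thesis using assms by simp
next
  case (Suc m)
  have "1 * cf_den a (Suc m) \<le> int (a (Suc (Suc m))) * cf_den a (Suc m)"
    using assms cf_den_pos[OF assms, of "Suc m"] by (intro mult_right_mono) auto
  then show ?thesis using cf_den_pos[OF assms, of m] Suc by simp
qed

lemma cf_den_growth:
  assumes "\<forall>j\<ge>1. a j \<ge> 1"
  shows "sqrt 2 ^ k \<le> 2 * of_int (cf_den a k)"
proof (induction k rule: induct_nat_012)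
  case 1
  have "sqrt 2 \<le> 2" by (simp add: real_le_lsqrt sqrt_le_D)
  also have "(2::real) \<le> 2 * real (a 1)" using assms by simp
  finally show ?case by simp
next
  case (ge2 n)
  have "1 * cf_den a (Suc n) \<le> int (a (Suc (Suc n))) * cf_den a (Suc n)"
    using assms cf_den_pos[OF assms, of "Suc n"] by (intro mult_right_mono) auto
  then have "cf_den a (Suc (Suc n)) \<ge> 2 * cf_den a n" using cf_den_mono[OF assms, of n] by simp
  then have "real_of_int (cf_den a (Suc (Suc n))) \<ge> 2 * of_int (cf_den a n)" by linarith
  moreover have "sqrt 2 ^ Suc (Suc n) = 2 * sqrt 2 ^ n" by simp
  ultimately show ?case using ge2 by linarith
qed simp

text \<open>
  Best approximation property of convergents. By \<open>cf_det\<close> the vectors $(q_k, p_k)$ and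
  $(q_{k+1}, p_{k+1})$ form a basis of the integer lattice. Writing $(j, p)$ in this basis,
  $0 < j < q_{k+1}$ forces the coefficient of the first vector to be nonzero and the two coefficients not to
  have equal sign. Since the errors of consecutive convergents have opposite signs, the two contributions
  to $j\theta - p$ do not cancel.
\<close>

lemma best_approximation:
  assumes cf: "has_cfrac \<theta> a" "\<theta> \<notin> \<rat>" and j: "0 < j" "j < cf_den a (Suc k)"
  shows "cf_err \<theta> a k \<le> \<bar>of_int j * \<theta> - of_int p\<bar>"
proof -
  define u where "u = (-1) ^ k * (j * cf_num a (Suc k) - p * cf_den a (Suc k))"
  define v where "v = (-1) ^ k * (p * cf_den a k - j * cf_num a k)"
  have s: "(-1) ^ k * ((-1) ^ k * x) = (x::int)" for x by (simp flip: mult.assoc power_add)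
  have pos: "cf_den a i \<ge> 1" for i using cf(1) by (intro cf_den_pos) (simp add: has_cfrac_def)
  have ju: "j = u * cf_den a k + v * cf_den a (Suc k)"
  proof -
    have "u * cf_den a k + v * cf_den a (Suc k)
        = (-1) ^ k * (j * (cf_den a k * cf_num a (Suc k) - cf_den a (Suc k) * cf_num a k))"
      by (simp add: u_def v_def algebra_simps)
    then show ?thesis unfolding cf_det using s[of j] by (simp add: mult.commute mult.left_commute)
  qed
  have pu: "p = u * cf_num a k + v * cf_num a (Suc k)"
  proof -
    have "u * cf_num a k + v * cf_num a (Suc k)
        = (-1) ^ k * (p * (cf_den a k * cf_num a (Suc k) - cf_den a (Suc k) * cf_num a k))"
      by (simp add: u_def v_def algebra_simps)
    then show ?thesis unfolding cf_det using s[of p] by (simp add: mult.commute mult.left_commute)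
  qed
  let ?e = "cf_err \<theta> a"
  have "of_int j * \<theta> - of_int p = of_int u * (of_int (cf_den a k) * \<theta> - of_int (cf_num a k))
      + of_int v * (of_int (cf_den a (Suc k)) * \<theta> - of_int (cf_num a (Suc k)))"
    unfolding ju[THEN arg_cong[of _ _ real_of_int]] pu[THEN arg_cong[of _ _ real_of_int]]
    by (simp add: algebra_simps)
  also have "\<dots> = (-1) ^ k * (of_int u * ?e k - of_int v * ?e (Suc k))"
    unfolding cf_err_eq[OF cf] by (simp add: algebra_simps)
  finally have eq: "\<bar>of_int j * \<theta> - of_int p\<bar> = \<bar>of_int u * ?e k - of_int v * ?e (Suc k)\<bar>"
    by (simp add: abs_mult)
  have e: "0 < ?e k" "0 < ?e (Suc k)" using cf_err_pos(1)[OF cf] by auto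
  consider "u = 0" | "u > 0" | "u < 0" by linarith
  then show ?thesis
  proof cases
    case 1
    then have "j = v * cf_den a (Suc k)" using ju by simp
    then show ?thesis using j zdvd_not_zless[of j "cf_den a (Suc k)"] by simp
  next
    case 2
    have "v \<le> 0"
    proof (rule ccontr)
      assume "\<not> v \<le> 0"
      then have "1 * cf_den a (Suc k) \<le> v * cf_den a (Suc k)" "0 \<le> u * cf_den a k"
        using pos[of "Suc k"] pos[of k] 2 by (auto intro!: mult_right_mono)
      then show False using ju j by linarith
    qed
    then have "real_of_int v * ?e (Suc k) \<le> 0" using e by (simp add: mult_le_0_iff)
    moreover have "1 * ?e k \<le> of_int u * ?e k" using e 2 by (intro mult_right_mono) auto
    ultimately show ?thesis unfolding eq by linarith
  next
    case 3
    have "v \<ge> 0"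
    proof (rule ccontr)
      assume "\<not> v \<ge> 0"
      then have "v * cf_den a (Suc k) \<le> 0" "u * cf_den a k \<le> 0"
        using pos[of "Suc k"] pos[of k] 3 by (auto simp: mult_le_0_iff)
      then show False using ju j by linarith
    qed
    then have "real_of_int v * ?e (Suc k) \<ge> 0" using e by simp
    moreover have "of_int u * ?e k \<le> (-1) * ?e k"
      using e 3 by (intro mult_right_mono) linarith+
    ultimately show ?thesis unfolding eq by linarith
  qed
qed

text \<open>
  Explicit constant from $\ln y \le y - 1$ at $y = \frac{\ln b}{s}(k+1)$.
\<close>

lemma powr_le_exponential:
  fixes s b :: real assumes "s > 0" "b > 1"
  shows "\<exists>K>0. \<forall>k::nat. real (Suc k) powr s \<le> K * b powr real k"
proof -
  define e where "e = ln b / s"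
  have e: "e > 0" "s * e = ln b" using assms by (auto simp: e_def)
  have "real (Suc k) powr s \<le> exp (s * (e - 1 - ln e)) * b powr real k" for k
  proof -
    have "ln (e * real (Suc k)) \<le> e * real (Suc k) - 1"
      using e by (intro ln_le_minus_one) simp
    then have "s * ln (real (Suc k)) \<le> s * (e * real (Suc k) - 1 - ln e)"
      using e assms by (intro mult_left_mono) (auto simp: ln_mult)
    also have "\<dots> = s * (e - 1 - ln e) + real k * ln b"
      unfolding e(2)[symmetric] by (simp add: algebra_simps)
    finally show ?thesis using assms by (simp add: powr_def flip: exp_add)
  qed
  then show ?thesis by (intro exI[of _ "exp (s * (e - 1 - ln e))"]) auto
qed

text \<open>
  For $q_k \le j < q_{k+1}$ best approximation gives
  $|j\theta - p| \ge |q_k\theta - p_k| \ge 1/(2 q_{k+1})$, and $q_{k+1} \le 2 a_{k+1} q_k$ is at most a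
  constant times $q_k^{5/4}$, because $a_{k+1}$ is polynomial in \<open>k\<close> and $q_k$ exponential.
\<close>

lemma diophantine_bound:
  assumes cf: "has_cfrac \<theta> a" "\<theta> \<notin> \<rat>"
    and a: "C \<ge> 1" "s \<ge> 1" "\<forall>j\<ge>1. real (a j) \<le> C * real j powr s"
  shows "\<exists>c>0. \<forall>j p :: int. 0 < j \<longrightarrow> c \<le> \<bar>of_int j * \<theta> - of_int p\<bar> * of_int j powr (5/4)"
proof -
  have a1: "\<forall>j\<ge>1. a j \<ge> 1" using cf(1) by (simp add: has_cfrac_def)
  note pos = cf_den_pos[OF a1]
  obtain K where K: "K > 0" "\<And>k::nat. real (Suc k) powr s \<le> K * (2 powr (1/8)) powr real k"
    using powr_le_exponential[of s "2 powr (1/8)"] a(2) by auto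
  let ?q = "\<lambda>k. real_of_int (cf_den a k)"
  have q1: "1 \<le> ?q k" for k using pos[of k] by simp
  \<comment> \<open>the exponent $1/8$ above is chosen so that $2^{k/8} = (2^{k/2})^{1/4}$ is of order at most $q_k^{1/4}$\<close>
  have step: "?q (Suc k) \<le> 4 * C * K * ?q k powr (5/4)" for k
  proof -
    have "?q (Suc k) \<le> 2 * real (a (Suc k)) * ?q k"
    proof (cases k)
      case (Suc m)
      have "1 * ?q k \<le> real (a (Suc k)) * ?q k"
        using a1 q1[of k] by (intro mult_right_mono) auto
      moreover have "?q m \<le> ?q k" using cf_den_mono[OF a1, of m] Suc by simp
      ultimately have "?q m \<le> real (a (Suc k)) * ?q k" by linarith
      then show ?thesis using Suc by (simp add: mult.commute)
    qed simp
    also have "\<dots> \<le> 2 * (C * (K * (2 powr (1/8)) powr real k)) * ?q k"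
    proof -
      have "real (a (Suc k)) \<le> C * real (Suc k) powr s" using a(3)[rule_format, of "Suc k"] by (simp del: of_nat_Suc)
      also have "\<dots> \<le> C * (K * (2 powr (1/8)) powr real k)"
        using K(2)[of k] a(1) by (intro mult_left_mono) auto
      finally show ?thesis using q1[of k] by (intro mult_right_mono) auto
    qed
    also have "(2 powr (1/8)) powr real k \<le> 2 * ?q k powr (1/4)"
    proof -
      have "(2 powr (1/8)) powr real k = (sqrt 2 ^ k) powr (1/4)"
        by (simp add: powr_half_sqrt[symmetric] powr_powr mult.commute flip: powr_realpow)
      also have "\<dots> \<le> (2 * ?q k) powr (1/4)"
        using cf_den_growth[OF a1, of k] by (intro powr_mono2) auto
      also have "\<dots> = 2 powr (1/4) * ?q k powr (1/4)" using q1[of k] by (simp add: powr_mult)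
      also have "(2::real) powr (1/4) \<le> 2 powr 1" by (intro powr_mono) auto
      finally show ?thesis using q1[of k] by (simp add: mult_right_mono)
    qed
    finally have "?q (Suc k) \<le> 2 * (C * (K * (2 * ?q k powr (1/4)))) * ?q k"
      using a(1) K(1) q1[of k] by (simp add: mult_left_mono mult_right_mono)
    also have "\<dots> = 4 * C * K * (?q k powr (1/4) * ?q k powr 1)" using q1[of k] by simp
    also have "?q k powr (1/4) * ?q k powr 1 = ?q k powr (5/4)"
      by (simp only: powr_add[symmetric]) simp
    finally show ?thesis .
  qed
  have "1 / (8 * C * K) \<le> \<bar>of_int j * \<theta> - of_int p\<bar> * of_int j powr (5/4)" if j: "0 < j" for j p
  proof -
    define i where "i = (LEAST i. j < cf_den a i)"
    have ex: "\<exists>i. j < cf_den a i"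
    proof -
      obtain i where "2 * real_of_int j < sqrt 2 ^ i"
        using real_arch_pow[of "sqrt 2" "2 * real_of_int j"] by auto
      then have "real_of_int j < ?q i" using cf_den_growth[OF a1, of i] by linarith
      then show ?thesis by auto
    qed
    then have ji: "j < cf_den a i" unfolding i_def by (rule LeastI_ex)
    then have "i \<noteq> 0" using j by (intro notI) simp
    then obtain k where k: "i = Suc k" by (cases i) auto
    have kj: "cf_den a k \<le> j"
      using not_less_Least[of k "\<lambda>i. j < cf_den a i"] k by (auto simp: i_def)
    let ?e = "cf_err \<theta> a"
    have "?q k * ?e (Suc k) \<le> ?q (Suc k) * ?e k"
      using cf_den_mono[OF a1, of k] cf_err_pos[OF cf, of k] cf_err_pos[OF cf, of "Suc k"] q1[of "Suc k"]
      by (intro mult_mono) auto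
    then have "1 \<le> 2 * ?q (Suc k) * ?e k" using cf_den_err[OF cf, of k] by linarith
    also have "\<dots> \<le> 2 * (4 * C * K * ?q k powr (5/4)) * ?e k"
      using step[of k] cf_err_pos[OF cf, of k] by (intro mult_right_mono mult_left_mono) auto
    also have "?q k powr (5/4) \<le> of_int j powr (5/4)"
      using kj q1[of k] by (intro powr_mono2) auto
    also have "?e k \<le> \<bar>of_int j * \<theta> - of_int p\<bar>"
      using best_approximation[OF cf j] ji k by auto
    finally have "1 \<le> 2 * (4 * C * K * of_int j powr (5/4)) * \<bar>of_int j * \<theta> - of_int p\<bar>"
      using a(1) K(1) cf_err_pos[OF cf, of k] by (simp add: mult_left_mono)
    then show ?thesis using a(1) K(1) by (simp add: field_simps)
  qed
  then show ?thesis using a(1) K(1) by (intro exI[of _ "1 / (8 * C * K)"]) auto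
qed

section \<open>Return times of a rotation to an interval\<close>

text \<open>
  The first \<open>q\<close> points of the orbit come close to all multiples of $1/q$ modulo 1, so one of them lies
  at most $2/q$ below the interval. From there on every \<open>q\<close>-th point advances by
  $\eta = q\theta - p$, which is smaller than the interval; at most $2/(q\eta) + 1$ such steps are needed.
  Combining the two scales keeps the time of order $q + 1/\eta$, whereas steps of length $\eta$ alone would
  need a time of order $q/\eta$.
\<close>

lemma orbit_hits_interval_pos:
  fixes \<theta> A B :: real and p q :: int
  assumes q: "0 < q" and cop: "coprime p q"
    and h: "0 < of_int q * \<theta> - of_int p" "of_int q * \<theta> - of_int p \<le> 1 / of_int q"
    and AB: "of_int q * \<theta> - of_int p < B - A"
  shows "\<exists>i P :: int. 0 \<le> i \<and> of_int i \<le> 2 * of_int q + 2 / (of_int q * \<theta> - of_int p) \<and>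
            A < of_int i * \<theta> + of_int P \<and> of_int i * \<theta> + of_int P < B"
proof -
  define \<eta> where "\<eta> = of_int q * \<theta> - of_int p"
  have \<eta>: "0 < \<eta>" "\<eta> \<le> 1 / of_int q" "\<eta> < B - A" using h AB by (auto simp: \<eta>_def)
  have qr: "(0::real) < of_int q" using q by simp
  \<comment> \<open>$r/q$ lies between $2/q$ and $1/q$ below $A$, so that a deviation of at most $1/q$ upwards stays below $A$\<close>
  define r where "r = \<lceil>of_int q * A\<rceil> - 2"
  have r: "of_int r < of_int q * A - 1" "of_int q * A - 2 \<le> of_int r"
    unfolding r_def by linarith+
  \<comment> \<open>as \<open>p\<close> is invertible modulo \<open>q\<close>, some $ip/q$ with $0 \le i < q$ equals $r/q$ modulo 1\<close>
  obtain u v where uv: "u * p + v * q = 1"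
    using cop bezout_int[of p q] by auto
  define i where "i = (r * u) mod q"
  have i: "0 \<le> i" "i < q" using q by (auto simp: i_def)
  have "i * p mod q = r mod q"
  proof -
    have "i * p mod q = r * (u * p) mod q" by (simp add: i_def mod_mult_left_eq mult.assoc)
    also have "r * (u * p) = r + (- r * v) * q" 
    proof -
      have "r * (u * p) = r * (u * p + v * q) + (- r * v) * q" by (simp add: algebra_simps)
      then show ?thesis using uv by simp
    qed
    finally show ?thesis by (simp only: mod_mult_self1)
  qed
  then obtain P where P: "i * p + q * P = r"
    by (metis mod_eqE mult.commute)
  define z where "z = of_int i * \<theta> + of_int P"
  have "of_int q * z = of_int (i * p + q * P) + of_int i * \<eta>"
    by (simp add: z_def \<eta>_def algebra_simps)
  then have qz: "of_int q * z = of_int r + of_int i * \<eta>" using P by simp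
  have "of_int i * \<eta> \<le> of_int q * (1 / of_int q)"
    using i \<eta> qr by (intro mult_mono) auto
  then have b: "0 \<le> of_int i * \<eta>" "of_int i * \<eta> \<le> 1" using i \<eta> qr by auto
  have zA: "z < A"
  proof -
    have "of_int q * z < of_int q * A" using qz b r by linarith
    then show ?thesis using qr by simp
  qed
  have Az: "A - z \<le> 2 / of_int q"
  proof -
    have "of_int q * (A - z) \<le> 2" using qz b r by (simp add: algebra_simps)
    then show ?thesis using qr by (simp add: field_simps)
  qed
  \<comment> \<open>the number of steps of length $\eta$ that lead from $z$ past $A$; the last one cannot jump over $B$\<close>
  define t where "t = \<lfloor>(A - z) / \<eta>\<rfloor> + 1"
  have t: "(A - z) / \<eta> < of_int t" "of_int t \<le> (A - z) / \<eta> + 1" unfolding t_def by linarith+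
  have t0: "0 \<le> t" using zA \<eta> by (simp add: t_def)
  have t1: "A < z + of_int t * \<eta>" "z + of_int t * \<eta> \<le> A + \<eta>"
    using t \<eta> by (simp_all add: field_simps)
  have "of_int t * of_int q \<le> ((A - z) / \<eta> + 1) * of_int q"
    using t qr by (intro mult_right_mono) auto
  also have "\<dots> = (A - z) * of_int q / \<eta> + of_int q" using \<eta> by (simp add: field_simps)
  also have "(A - z) * of_int q / \<eta> \<le> 2 / \<eta>"
    using Az qr \<eta> by (intro divide_right_mono) (auto simp: field_simps)
  finally have tq: "of_int t * of_int q \<le> 2 / \<eta> + of_int q" by simp
  show ?thesis
  proof (intro exI conjI)
    show "0 \<le> i + t * q" using i t0 q by simp
    have "real_of_int i \<le> of_int q" using i by simp
    then show "of_int (i + t * q) \<le> 2 * of_int q + 2 / (of_int q * \<theta> - of_int p)"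
      using tq unfolding \<eta>_def by simp
    have e: "of_int (i + t * q) * \<theta> + of_int (P - t * p) = z + of_int t * \<eta>"
      by (simp add: z_def \<eta>_def algebra_simps)
    show "A < of_int (i + t * q) * \<theta> + of_int (P - t * p)" unfolding e by (rule t1)
    show "of_int (i + t * q) * \<theta> + of_int (P - t * p) < B" unfolding e using t1 \<eta> by linarith
  qed
qed

lemma orbit_hits_interval:
  fixes \<theta> A B :: real and p q :: int
  assumes q: "0 < q" and cop: "coprime p q"
    and h: "of_int q * \<theta> \<noteq> of_int p" "\<bar>of_int q * \<theta> - of_int p\<bar> \<le> 1 / of_int q"
    and AB: "\<bar>of_int q * \<theta> - of_int p\<bar> < B - A"
  shows "\<exists>i P :: int. 0 \<le> i \<and> of_int i \<le> 2 * of_int q + 2 / \<bar>of_int q * \<theta> - of_int p\<bar> \<and>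
            A < of_int i * \<theta> + of_int P \<and> of_int i * \<theta> + of_int P < B"
proof (cases "0 < of_int q * \<theta> - of_int p")
  case True
  then show ?thesis using orbit_hits_interval_pos[OF q cop True] h AB by auto
next
  case False
  let ?d = "of_int q * (- \<theta>) - of_int (- p)"
  have d: "0 < ?d" "?d = \<bar>of_int q * \<theta> - of_int p\<bar>" using False h by auto
  obtain i P where "0 \<le> i" "of_int i \<le> 2 * of_int q + 2 / ?d"
      "- B < of_int i * (- \<theta>) + of_int P" "of_int i * (- \<theta>) + of_int P < - A"
    using orbit_hits_interval_pos[OF q, of "- p" "- \<theta>" "- A" "- B"] cop d h AB by fastforce
  then show ?thesis unfolding d by (intro exI[of _ i] exI[of _ "- P"]) auto
qed

text \<open>
  Dirichlet's theorem provides \<open>q\<close> of size at most about $1/\delta$ with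
  $|q\theta - p| < \delta$, and the Diophantine bound keeps $1/|q\theta - p|$ below a multiple of
  $\delta^{-\beta}$.
\<close>

lemma orbit_hits_interval_of_length:
  fixes \<theta> \<beta> c :: real
  assumes c: "c > 0" "\<And>j p :: int. 0 < j \<Longrightarrow> c \<le> \<bar>of_int j * \<theta> - of_int p\<bar> * of_int j powr \<beta>"
    and b: "\<beta> \<ge> 1"
  shows "\<exists>K>0. \<forall>\<delta> A B :: real. 0 < \<delta> \<and> \<delta> \<le> 1 \<and> \<delta> \<le> B - A \<longrightarrow>
    (\<exists>i P :: int. 0 \<le> i \<and> of_int i \<le> K * (1 / \<delta>) powr \<beta> \<and>
            A < of_int i * \<theta> + of_int P \<and> of_int i * \<theta> + of_int P < B)"
proof -
  define K where "K = (2 + 2 / c) * 2 powr \<beta>"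
  have "\<exists>i P :: int. 0 \<le> i \<and> of_int i \<le> K * (1 / \<delta>) powr \<beta> \<and>
            A < of_int i * \<theta> + of_int P \<and> of_int i * \<theta> + of_int P < B"
    if d: "0 < \<delta>" "\<delta> \<le> 1" "\<delta> \<le> B - A" for \<delta> A B :: real
  proof -
    define N where "N = nat \<lceil>1 / \<delta>\<rceil>"
    have d1: "1 \<le> 1 / \<delta>" using d by simp
    have N: "1 / \<delta> \<le> real N" "real N \<le> 2 * (1 / \<delta>)" "0 < N"
      using d1 unfolding N_def by linarith+
    obtain p q where pq: "coprime p q" "0 < q" "q \<le> int N" "\<bar>of_int q * \<theta> - of_int p\<bar> < 1 / N"
      using Dirichlet_approx_coprime[OF N(3)] by metis
    let ?e = "\<bar>of_int q * \<theta> - of_int p\<bar>"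
    have qN: "1 \<le> real_of_int q" "real_of_int q \<le> real N" using pq by linarith+
    have c1: "c \<le> ?e * of_int q powr \<beta>" using c(2)[OF pq(2)] by blast
    then have e0: "0 < ?e" using c(1) by (cases "?e = 0") auto
    have "1 / N \<le> 1 / of_int q" using qN N by (intro divide_left_mono) auto
    then have e1: "?e \<le> 1 / of_int q" using pq by simp
    have "1 / N \<le> \<delta>" using N d by (simp add: field_simps)
    then have e2: "?e < B - A" using pq d by simp
    obtain i P where iP: "0 \<le> i" "of_int i \<le> 2 * of_int q + 2 / ?e"
       "A < of_int i * \<theta> + of_int P" "of_int i * \<theta> + of_int P < B"
      using orbit_hits_interval[OF pq(2,1) _ e1 e2] e0 by auto
    have "1 / ?e \<le> of_int q powr \<beta> / c" using c1 c(1) e0 by (simp add: field_simps)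
    also have "\<dots> \<le> real N powr \<beta> / c"
      using qN b c(1) by (intro divide_right_mono powr_mono2) auto
    finally have "1 / ?e \<le> real N powr \<beta> / c" .
    moreover have "of_int q \<le> real N powr \<beta>"
      using qN powr_mono[OF b, of "real N"] N by simp
    ultimately have "of_int i \<le> 2 * real N powr \<beta> + 2 * (real N powr \<beta> / c)"
      using iP(2) by simp
    also have "\<dots> = (2 + 2 / c) * real N powr \<beta>" by (simp add: field_simps)
    also have "\<dots> \<le> (2 + 2 / c) * (2 * (1 / \<delta>)) powr \<beta>"
      using N b c(1) by (intro mult_left_mono powr_mono2) auto
    also have "\<dots> = K * (1 / \<delta>) powr \<beta>" using d by (subst powr_mult) (auto simp: K_def)
    finally show ?thesis using iP by blast
  qed
  then show ?thesis using c(1) by (intro exI[of _ K]) (auto simp: K_def add_pos_nonneg)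
qed

section \<open>Sturmian sequences: recurrence\<close>

lemma sturmian_shift:
  assumes "w \<in> sturmian \<theta>"
  shows "(\<lambda>n. w (n + k)) \<in> sturmian \<theta>"
proof -
  obtain x I where I: "I \<in> {{0..<1-\<theta>}, {0<..1-\<theta>}}"
     and w: "\<And>n. w n = (if frac (of_int n * \<theta> - x) \<in> I then 0 else 1)"
    using assms unfolding sturmian_def by blast
  have "w (n + k) = (if frac (of_int n * \<theta> - (x - of_int k * \<theta>)) \<in> I then 0 else 1)" for n
    unfolding w by (simp add: algebra_simps)
  then show ?thesis using I unfolding sturmian_def by blast
qed

text \<open>
  The letter \<open>v\<close> is coded by the arc between \<open>band_lo \<theta> v\<close> and
  \<open>band_hi \<theta> v\<close>; which of the two end points belongs to it depends on the choice of the half-open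
  interval in the definition of a Sturmian sequence.
\<close>

definition band_lo :: "real \<Rightarrow> nat \<Rightarrow> real" where
  "band_lo \<theta> v = (if v = 0 then 0 else 1 - \<theta>)"

definition band_hi :: "real \<Rightarrow> nat \<Rightarrow> real" where
  "band_hi \<theta> v = (if v = 0 then 1 - \<theta> else 1)"

text \<open>
  A description common to both half-open codings: \<open>g m\<close> represents the rotated point modulo 1,
  in $[0,1)$ or in $(0,1]$ according to the coding, and lies in the closed arc of its letter. The last
  property records that either all points stay away from the upper ends of their arcs, or all stay away from
  the lower ends. It makes the set of translations preserving a window a nondegenerate interval.
\<close>

lemma sturmian_bands:
  assumes th: "0 < \<theta>" "\<theta> < 1" and y: "y \<in> sturmian \<theta>"
  obtains x g where "\<And>m. y m \<in> {0, 1}" "\<And>m. g m - (of_int m * \<theta> - x) \<in> \<int>"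
    "\<And>m. band_lo \<theta> (y m) \<le> g m" "\<And>m. g m \<le> band_hi \<theta> (y m)"
    "\<And>m m'. 0 < (band_hi \<theta> (y m) - g m) + (g m' - band_lo \<theta> (y m'))"
proof -
  obtain x I where I: "I = {0..<1-\<theta>} \<or> I = {0<..1-\<theta>}"
     and w: "\<And>n. y n = (if frac (of_int n * \<theta> - x) \<in> I then 0 else 1)"
    using y unfolding sturmian_def by blast
  have y01: "y m \<in> {0, 1}" for m unfolding w by auto
  let ?f = "\<lambda>m::int. frac (of_int m * \<theta> - x)"
  have f: "0 \<le> ?f m" "?f m < 1" for m by (auto simp: frac_lt_1)
  have fi: "?f m - (of_int m * \<theta> - x) \<in> \<int>" for m by (simp add: frac_def)
  from I show ?thesis
  proof
    assume I: "I = {0..<1-\<theta>}"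
    have b: "band_lo \<theta> (y m) \<le> ?f m \<and> ?f m < band_hi \<theta> (y m)" for m
      unfolding w I band_lo_def band_hi_def using f[of m] by auto
    show ?thesis
      by (rule that[of ?f x]) (use y01 fi b in \<open>auto simp: less_imp_le intro!: add_pos_nonneg\<close>)
  next
    assume I: "I = {0<..1-\<theta>}"
    define g where "g m = (if ?f m = 0 then 1 else ?f m)" for m
    have b: "band_lo \<theta> (y m) < g m \<and> g m \<le> band_hi \<theta> (y m)" for m
    proof -
      define F where "F = ?f m"
      have "0 \<le> F" "F < 1" using f[of m] by (auto simp: F_def)
      then show ?thesis
        unfolding w I band_lo_def band_hi_def g_def F_def[symmetric] using th by auto
    qed
    have gi: "g m - (of_int m * \<theta> - x) \<in> \<int>" for m
    proof (cases "?f m = 0")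
      case True
      then have "1 - (of_int m * \<theta> - x) \<in> \<int>" using fi[of m] by (simp add: Ints_diff)
      then show ?thesis using True unfolding g_def by simp
    qed (use fi[of m] in \<open>simp add: g_def\<close>)
    show ?thesis
      by (rule that[of g x]) (use y01 gi b in \<open>auto simp: less_imp_le intro!: add_nonneg_pos\<close>)
  qed
qed

text \<open>
  In the interior of an arc both codings give the same letter.
\<close>

lemma sturmian_value_in_band:
  assumes th: "0 < \<theta>" "\<theta> < 1" and z: "z \<in> sturmian \<theta>"
  obtains x where "\<And>m r v. v \<in> {0, 1} \<Longrightarrow> r - (of_int m * \<theta> - x) \<in> \<int> \<Longrightarrow>
     band_lo \<theta> v < r \<Longrightarrow> r < band_hi \<theta> v \<Longrightarrow> z m = v"
proof -
  obtain x I where I: "I = {0..<1-\<theta>} \<or> I = {0<..1-\<theta>}"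
     and w: "\<And>n. z n = (if frac (of_int n * \<theta> - x) \<in> I then 0 else 1)"
    using z unfolding sturmian_def by blast
  show ?thesis
  proof (rule that)
    fix m :: int and r and v :: nat
    assume v: "v \<in> {0, 1}" and r: "r - (of_int m * \<theta> - x) \<in> \<int>" "band_lo \<theta> v < r" "r < band_hi \<theta> v"
    have "- (r - (of_int m * \<theta> - x)) \<in> \<int>" using r(1) by (rule Ints_minus)
    moreover have "0 < r" "r < 1" using r(2,3) v th by (auto simp: band_lo_def band_hi_def)
    ultimately have "frac (of_int m * \<theta> - x) = r" by (subst frac_unique_iff) auto
    then show "z m = v" unfolding w using I r(2,3) v th by (auto simp: band_lo_def band_hi_def)
  qed
qed

text \<open>
  Moving the parameter of \<open>y\<close> within an open interval $(A, B)$ does not change the letters in the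
  window. Its length is $k\theta + P$ with $|k| \le n + 1$, hence at least of order $n^{-\beta}$, and the
  rotation orbit that describes the shifts of \<open>z\<close> meets it within $O(n^{\beta\cdot\beta})$ steps.
\<close>

lemma sturmian_recurrence:
  fixes \<theta> \<beta> c :: real
  assumes th: "0 < \<theta>" "\<theta> < 1"
    and c: "c > 0" "\<And>j p :: int. 0 < j \<Longrightarrow> c \<le> \<bar>of_int j * \<theta> - of_int p\<bar> * of_int j powr \<beta>"
    and b: "\<beta> \<ge> 1"
  shows "\<exists>K>0. \<forall>n a. \<forall>y\<in>sturmian \<theta>. \<forall>z\<in>sturmian \<theta>. \<exists>i::nat. real i \<le> K * real (Suc n) powr (\<beta> * \<beta>) \<and>
      (\<forall>m\<in>{a..a + int n}. z (m + int i) = y m)"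
proof -
  obtain K where "K > 0" and "\<forall>\<delta> A B :: real. 0 < \<delta> \<and> \<delta> \<le> 1 \<and> \<delta> \<le> B - A \<longrightarrow>
    (\<exists>i P :: int. 0 \<le> i \<and> of_int i \<le> K * (1 / \<delta>) powr \<beta> \<and>
            A < of_int i * \<theta> + of_int P \<and> of_int i * \<theta> + of_int P < B)"
    using orbit_hits_interval_of_length[OF c b] by blast
  then have K: "K > 0" "\<And>\<delta> A B :: real. 0 < \<delta> \<Longrightarrow> \<delta> \<le> 1 \<Longrightarrow> \<delta> \<le> B - A \<Longrightarrow>
    (\<exists>i P :: int. 0 \<le> i \<and> of_int i \<le> K * (1 / \<delta>) powr \<beta> \<and>
            A < of_int i * \<theta> + of_int P \<and> of_int i * \<theta> + of_int P < B)"
    by auto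
  define K' where "K' = K * (1 + 1 / c) powr \<beta>"
  have "\<exists>i::nat. real i \<le> K' * real (Suc n) powr (\<beta> * \<beta>) \<and>
      (\<forall>m\<in>{a..a + int n}. z (m + int i) = y m)"
    if y: "y \<in> sturmian \<theta>" and z: "z \<in> sturmian \<theta>" for n a y z
  proof -
    obtain x g where yg: "\<And>m. y m \<in> {0, 1}" "\<And>m. g m - (of_int m * \<theta> - x) \<in> \<int>"
      "\<And>m. band_lo \<theta> (y m) \<le> g m" "\<And>m. g m \<le> band_hi \<theta> (y m)"
      "\<And>m m'. 0 < (band_hi \<theta> (y m) - g m) + (g m' - band_lo \<theta> (y m'))"
      by (rule sturmian_bands[OF th y]) (rule that, assumption+)
    obtain x' where zv: "\<And>m r v. v \<in> {0, 1} \<Longrightarrow> r - (of_int m * \<theta> - x') \<in> \<int> \<Longrightarrow>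
       band_lo \<theta> v < r \<Longrightarrow> r < band_hi \<theta> v \<Longrightarrow> z m = v"
      by (rule sturmian_value_in_band[OF th z]) (rule that, assumption+)
    let ?W = "{a..a + int n}"
    \<comment> \<open>a translation by $t$ keeps every point of the window inside its arc as long as $A < t < B$\<close>
    define A where "A = Max ((\<lambda>m. band_lo \<theta> (y m) - g m) ` ?W)"
    define B where "B = Min ((\<lambda>m. band_hi \<theta> (y m) - g m) ` ?W)"
    have A: "band_lo \<theta> (y m) - g m \<le> A" if "m \<in> ?W" for m
      unfolding A_def using that by (intro Max_ge) auto
    have B: "B \<le> band_hi \<theta> (y m) - g m" if "m \<in> ?W" for m
      unfolding B_def using that by (intro Min_le) auto
    have "A \<in> (\<lambda>m. band_lo \<theta> (y m) - g m) ` ?W" unfolding A_def by (intro Max_in) auto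
    then obtain m' where m': "m' \<in> ?W" "A = band_lo \<theta> (y m') - g m'" by blast
    have "B \<in> (\<lambda>m. band_hi \<theta> (y m) - g m) ` ?W" unfolding B_def by (intro Min_in) auto
    then obtain m where m: "m \<in> ?W" "B = band_hi \<theta> (y m) - g m" by blast
    have BA: "0 < B - A" using yg(5)[of m m'] m m' by simp
    let ?N = "real (Suc n)"
    define \<delta> where "\<delta> = min 1 (c / ?N powr \<beta>)"
    have \<delta>0: "0 < \<delta>" "\<delta> \<le> 1" using c(1) by (auto simp: \<delta>_def)
    have "\<delta> \<le> B - A"
    proof -
      have "(g m' - (of_int m' * \<theta> - x)) - (g m - (of_int m * \<theta> - x)) \<in> \<int>"
        by (rule Ints_diff[OF yg(2) yg(2)])
      then obtain e where e: "g m' - g m = of_int (m' - m) * \<theta> + of_int e"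
        by (auto elim!: Ints_cases simp: algebra_simps)
      have "\<exists>k P :: int. \<bar>k\<bar> \<le> int n + 1 \<and> B - A = of_int k * \<theta> + of_int P"
      proof -
        have "B - A = of_int (m' - m) * \<theta> + of_int e + band_hi \<theta> (y m) - band_lo \<theta> (y m')"
          using m(2) m'(2) e by linarith
        moreover have "band_hi \<theta> (y m) - band_lo \<theta> (y m') \<in> {1 - \<theta>, 0, 1, \<theta>}"
          by (auto simp: band_hi_def band_lo_def)
        ultimately have "B - A = of_int (m' - m - 1) * \<theta> + of_int (e + 1) \<or>
           B - A = of_int (m' - m) * \<theta> + of_int e \<or>
           B - A = of_int (m' - m) * \<theta> + of_int (e + 1) \<or>
           B - A = of_int (m' - m + 1) * \<theta> + of_int e"
          by (auto simp: algebra_simps)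
        moreover have "\<bar>m' - m - 1\<bar> \<le> int n + 1" "\<bar>m' - m\<bar> \<le> int n + 1" "\<bar>m' - m + 1\<bar> \<le> int n + 1"
          using m(1) m'(1) by auto
        ultimately show ?thesis by blast
      qed
      then obtain k P :: int where k: "\<bar>k\<bar> \<le> int n + 1" "B - A = of_int k * \<theta> + of_int P" by blast
      show ?thesis
      proof (cases "k = 0")
        case True
        then have "1 \<le> B - A" using k(2) BA by simp
        then show ?thesis using \<delta>0 by linarith
      next
        case False
        define j where "j = \<bar>k\<bar>"
        have j: "0 < j" "real_of_int j \<le> ?N" using False k(1) by (auto simp: j_def)
        have "c \<le> \<bar>of_int j * \<theta> - of_int (- sgn k * P)\<bar> * of_int j powr \<beta>" using c(2)[OF j(1)] .
        also have "\<bar>of_int j * \<theta> - of_int (- sgn k * P)\<bar> = \<bar>B - A\<bar>"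
          unfolding k(2) j_def using False by (cases "k > 0") auto
        also have "\<bar>B - A\<bar> * of_int j powr \<beta> \<le> (B - A) * ?N powr \<beta>"
          using BA j b by (intro mult_mono powr_mono2) auto
        finally have "c / ?N powr \<beta> \<le> B - A" by (simp add: field_simps)
        then show ?thesis by (simp add: \<delta>_def)
      qed
    qed
    then obtain i P :: int where i: "0 \<le> i" "of_int i \<le> K * (1 / \<delta>) powr \<beta>"
      "A - (x - x') < of_int i * \<theta> + of_int P" "of_int i * \<theta> + of_int P < B - (x - x')"
      using K(2)[OF \<delta>0, of "B - (x - x')" "A - (x - x')"] by auto
    have "1 / \<delta> \<le> (1 + 1 / c) * ?N powr \<beta>"
    proof -
      have "1 \<le> ?N powr \<beta>" using b by (simp add: ge_one_powr_ge_zero)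
      then show ?thesis using c(1) unfolding \<delta>_def min_def by (auto simp: field_simps add_increasing)
    qed
    then have "(1 / \<delta>) powr \<beta> \<le> ((1 + 1 / c) * ?N powr \<beta>) powr \<beta>"
      using \<delta>0 b by (intro powr_mono2) auto
    also have "\<dots> = (1 + 1 / c) powr \<beta> * ?N powr (\<beta> * \<beta>)"
      using c(1) by (subst powr_mult) (auto simp: powr_powr)
    finally have "K * (1 / \<delta>) powr \<beta> \<le> K * ((1 + 1 / c) powr \<beta> * ?N powr (\<beta> * \<beta>))"
      using K(1) by (intro mult_left_mono) auto
    then have "real (nat i) \<le> K' * ?N powr (\<beta> * \<beta>)" using i by (simp add: K'_def mult.assoc)
    moreover have "z (l + int (nat i)) = y l" if l: "l \<in> ?W" for l
    proof (rule zv)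
      let ?r = "g l + (of_int i * \<theta> + of_int P + (x - x'))"
      show "y l \<in> {0, 1}" by (rule yg)
      have ni: "int (nat i) = i" using i(1) by simp
      have "?r - (of_int (l + i) * \<theta> - x') = (g l - (of_int l * \<theta> - x)) + of_int P"
        by (simp add: algebra_simps)
      then show "?r - (of_int (l + int (nat i)) * \<theta> - x') \<in> \<int>"
        unfolding ni using yg(2)[of l] by (metis Ints_add Ints_of_int)
      show "band_lo \<theta> (y l) < ?r" using A[OF l] i(3) by linarith
      show "?r < band_hi \<theta> (y l)" using B[OF l] i(4) by linarith
    qed
    ultimately show ?thesis by blast
  qed
  moreover have "0 < 1 + 1 / c" using c(1) by (simp add: add_pos_pos)
  then have "K' > 0" using K(1) unfolding K'_def by simp
  ultimately show ?thesis by (intro exI[of _ K']) auto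
qed

section \<open>Sturmian sequences: compactness\<close>

lemma tendsto_fun_pointwise:
  fixes f :: "'a \<Rightarrow> 'i \<Rightarrow> 'b::topological_space"
  assumes "\<And>i. ((\<lambda>n. f n i) \<longlongrightarrow> l i) F"
  shows "(f \<longlongrightarrow> l) F"
proof -
  have "limitin (product_topology (\<lambda>_. euclidean) UNIV) f l F"
    unfolding limitin_componentwise using assms by (simp add: extensional_UNIV)
  then show ?thesis by (simp add: euclidean_product_topology)
qed

lemma tendsto_coordinate:
  fixes f :: "'a \<Rightarrow> 'i \<Rightarrow> 'b::topological_space"
  assumes "(f \<longlongrightarrow> l) F"
  shows "((\<lambda>n. f n i) \<longlongrightarrow> l i) F"
  using continuous_on_tendsto_compose[OF continuous_on_product_coordinates[of i] assms] by simp

lemma eventually_eq_coordinate: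
  fixes f :: "'a \<Rightarrow> 'i \<Rightarrow> nat"
  assumes "(f \<longlongrightarrow> l) F"
  shows "eventually (\<lambda>n. f n i = l i) F"
  using tendsto_coordinate[OF assms, of i] by (simp add: tendsto_discrete)

text \<open>
  The sequence of parameter \<open>x\<close> for the interval $[0, 1-\theta)$. It is the limit of codings with
  parameters tending to \<open>x\<close> from the left, as \<open>coding_right\<close> is the limit from the right.
\<close>

definition coding_left :: "real \<Rightarrow> real \<Rightarrow> int \<Rightarrow> nat" where
  "coding_left \<theta> x n = (if frac (of_int n * \<theta> - x) \<in> {0..<1-\<theta>} then 0 else 1)"

definition coding_right :: "real \<Rightarrow> real \<Rightarrow> int \<Rightarrow> nat" where
  "coding_right \<theta> x n = (if frac (of_int n * \<theta> - x) \<in> {0<..1-\<theta>} then 0 else 1)"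

lemma sturmian_eq_codings: "sturmian \<theta> = range (coding_left \<theta>) \<union> range (coding_right \<theta>)"
  unfolding sturmian_def coding_left_def coding_right_def image_def by (auto simp: fun_eq_iff)

lemma coding_frac: "coding_left \<theta> (frac x) = coding_left \<theta> x" "coding_right \<theta> (frac x) = coding_right \<theta> x"
  by (auto simp: fun_eq_iff coding_left_def coding_right_def frac_diff_simp)

lemma frac_add_small: "0 \<le> frac u + t \<Longrightarrow> frac u + t < 1 \<Longrightarrow> frac (u + t) = frac u + t" for u t :: real
  by (subst frac_unique_iff) (auto simp: frac_def)

text \<open>
  Decreasing the parameter moves the point on the circle up, away from the included lower end points of
  the arcs of \<open>coding_left\<close>, so the letter is unchanged for a short while.
\<close>

lemma coding_stable_below:
  assumes th: "0 < \<theta>" "\<theta> < 1"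
  shows "\<exists>e>0. \<forall>x'. x - e < x' \<and> x' < x \<longrightarrow>
    coding_left \<theta> x' m = coding_left \<theta> x m \<and> coding_right \<theta> x' m = coding_left \<theta> x m"
proof -
  let ?u = "of_int m * \<theta> - x"
  define e where "e = (if frac ?u < 1 - \<theta> then 1 - \<theta> - frac ?u else 1 - frac ?u)"
  have u: "0 \<le> frac ?u" "frac ?u < 1" by (auto simp: frac_lt_1)
  have e: "e > 0" "frac ?u + e \<le> 1" using u th by (auto simp: e_def)
  have "coding_left \<theta> x' m = coding_left \<theta> x m \<and> coding_right \<theta> x' m = coding_left \<theta> x m"
    if x': "x - e < x'" "x' < x" for x'
  proof -
    have f: "frac (of_int m * \<theta> - x') = frac ?u + (x - x')"
      using frac_add_small[of ?u "x - x'"] u e x' by simp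
    show ?thesis unfolding coding_left_def coding_right_def f
      using u x' th by (auto simp: e_def simp del: frac_ge_0 split: if_splits)
  qed
  then show ?thesis using e by blast
qed

text \<open>
  The mirror image: the point moves down, away from the included upper end points of the arcs of
  \<open>coding_right\<close>. The point $0$ counts as $1$ here and carries the letter 1.
\<close>

lemma coding_stable_above:
  assumes th: "0 < \<theta>" "\<theta> < 1"
  shows "\<exists>e>0. \<forall>x'. x < x' \<and> x' < x + e \<longrightarrow>
    coding_left \<theta> x' m = coding_right \<theta> x m \<and> coding_right \<theta> x' m = coding_right \<theta> x m"
proof -
  let ?u = "of_int m * \<theta> - x"
  have u: "0 \<le> frac ?u" "frac ?u < 1" by (auto simp: frac_lt_1)
  define e where "e = (if frac ?u = 0 then \<theta> else if frac ?u \<le> 1 - \<theta> then frac ?u else frac ?u - (1 - \<theta>))"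
  have e: "e > 0"
  proof (cases "frac ?u = 0")
    case False
    then have "0 < frac ?u" using u(1) by linarith
    then show ?thesis unfolding e_def using False by auto
  qed (use th in \<open>simp add: e_def\<close>)
  have "coding_left \<theta> x' m = coding_right \<theta> x m \<and> coding_right \<theta> x' m = coding_right \<theta> x m"
    if x': "x < x'" "x' < x + e" for x'
  proof (cases "frac ?u = 0")
    case True
    have "frac (of_int m * \<theta> - x') = 1 + (x - x')"
    proof (subst frac_unique_iff, intro conjI)
      have "?u - 1 \<in> \<int>" using True by simp
      then show "of_int m * \<theta> - x' - (1 + (x - x')) \<in> \<int>" by (simp add: algebra_simps)
    qed (use x' th True in \<open>auto simp: e_def\<close>)
    then show ?thesis unfolding coding_left_def coding_right_def
      using True x' th by (auto simp: e_def simp del: frac_eq_0_iff frac_gt_0_iff)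
  next
    case False
    then have f: "frac (of_int m * \<theta> - x') = frac ?u + (x - x')"
      using frac_add_small[of ?u "x - x'"] u x' th by (auto simp: e_def simp del: frac_eq_0_iff frac_gt_0_iff split: if_splits)
    show ?thesis unfolding coding_left_def coding_right_def f
      using u False x' th by (auto simp: e_def simp del: frac_ge_0 frac_eq_0_iff frac_gt_0_iff split: if_splits)
  qed
  then show ?thesis using e by blast
qed

text \<open>
  Along a convergent subsequence of parameters, one-sided stability identifies the pointwise limit of the
  sequences as one of the two codings of the limit parameter.
\<close>

lemma compact_sturmian:
  assumes th: "0 < \<theta>" "\<theta> < 1"
  shows "compact (sturmian \<theta>)"
  unfolding seq_compact_eq_compact[symmetric] seq_compact_def
proof (intro allI impI)
  fix ys assume ys: "\<forall>n::nat. ys n \<in> sturmian \<theta>"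
  have "\<exists>x. x \<in> {0..1} \<and> (ys n = coding_left \<theta> x \<or> ys n = coding_right \<theta> x)" for n
  proof -
    obtain x where "ys n = coding_left \<theta> x \<or> ys n = coding_right \<theta> x"
      using ys sturmian_eq_codings by blast
    then show ?thesis
      by (intro exI[of _ "frac x"]) (auto simp: coding_frac frac_lt_1 less_imp_le)
  qed
  then obtain xs where xs: "\<And>n. xs n \<in> {0..1}" "\<And>n. ys n = coding_left \<theta> (xs n) \<or> ys n = coding_right \<theta> (xs n)"
    by metis
  obtain x r where r: "strict_mono (r::nat\<Rightarrow>nat)" "(xs \<circ> r) \<longlonglongrightarrow> x"
    using compact_imp_seq_compact[OF compact_Icc, of "0::real" 1] xs(1) unfolding seq_compact_def by metis
  have near: "eventually (\<lambda>k. \<bar>xs (r k) - x\<bar> < e) sequentially" if "e > 0" for e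
    using tendstoD[OF r(2) that] by (simp add: dist_real_def)
  have conv: "\<exists>l\<in>sturmian \<theta>. \<exists>r. strict_mono r \<and> (ys \<circ> r) \<longlonglongrightarrow> l"
    if l: "l \<in> sturmian \<theta>" and fr: "\<exists>\<^sub>F k in sequentially. P k"
      and ev: "\<And>m. eventually (\<lambda>k. P k \<longrightarrow> ys (r k) m = l m) sequentially" for l P
  proof -
    have "infinite {k. P k}" using fr by (simp add: cofinite_eq_sequentially flip: frequently_cofinite)
    then obtain s where s: "strict_mono (s::nat\<Rightarrow>nat)" "\<And>k. P (s k)"
      using infinite_enumerate by blast
    have "(ys \<circ> (r \<circ> s)) \<longlonglongrightarrow> l"
    proof (rule tendsto_fun_pointwise)
      fix m
      have "eventually (\<lambda>k. P (s k) \<longrightarrow> ys (r (s k)) m = l m) sequentially"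
        using eventually_subseq[OF s(1) ev] .
      then have "eventually (\<lambda>k. (ys \<circ> (r \<circ> s)) k m = l m) sequentially"
        by eventually_elim (use s(2) in auto)
      then show "(\<lambda>k. (ys \<circ> (r \<circ> s)) k m) \<longlonglongrightarrow> l m" by (rule tendsto_eventually)
    qed
    then show ?thesis using l strict_mono_o[OF r(1) s(1)] by blast
  qed
  \<comment> \<open>infinitely often the parameters are on one fixed side of \<open>x\<close>, or equal to \<open>x\<close> with one fixed coding\<close>
  have "\<exists>\<^sub>F k in sequentially. (xs (r k) < x \<or> x < xs (r k)) \<or>
      (xs (r k) = x \<and> ys (r k) = coding_left \<theta> x \<or> xs (r k) = x \<and> ys (r k) = coding_right \<theta> x)"
    using xs(2) by (intro eventually_frequently always_eventually) (auto, metis linorder_less_linear)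
  then consider "\<exists>\<^sub>F k in sequentially. xs (r k) < x" | "\<exists>\<^sub>F k in sequentially. x < xs (r k)"
    | "\<exists>\<^sub>F k in sequentially. xs (r k) = x \<and> ys (r k) = coding_left \<theta> x"
    | "\<exists>\<^sub>F k in sequentially. xs (r k) = x \<and> ys (r k) = coding_right \<theta> x"
    unfolding frequently_disj_iff by blast
  then show "\<exists>l\<in>sturmian \<theta>. \<exists>r. strict_mono r \<and> (ys \<circ> r) \<longlonglongrightarrow> l"
  proof cases
    case 1
    show ?thesis
    proof (rule conv[OF _ 1])
      fix m
      obtain e where e: "e > 0" "\<And>x'. x - e < x' \<Longrightarrow> x' < x \<Longrightarrow>
        coding_left \<theta> x' m = coding_left \<theta> x m \<and> coding_right \<theta> x' m = coding_left \<theta> x m"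
        using coding_stable_below[OF th] by metis
      show "\<forall>\<^sub>F k in sequentially. xs (r k) < x \<longrightarrow> ys (r k) m = coding_left \<theta> x m"
        using near[OF e(1)] by eventually_elim (use e(2) xs(2) in \<open>smt (verit)\<close>)
    qed (auto simp: sturmian_eq_codings)
  next
    case 2
    show ?thesis
    proof (rule conv[OF _ 2])
      fix m
      obtain e where e: "e > 0" "\<And>x'. x < x' \<Longrightarrow> x' < x + e \<Longrightarrow>
        coding_left \<theta> x' m = coding_right \<theta> x m \<and> coding_right \<theta> x' m = coding_right \<theta> x m"
        using coding_stable_above[OF th] by metis
      show "\<forall>\<^sub>F k in sequentially. x < xs (r k) \<longrightarrow> ys (r k) m = coding_right \<theta> x m"
        using near[OF e(1)] by eventually_elim (use e(2) xs(2) in \<open>smt (verit)\<close>)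
    qed (auto simp: sturmian_eq_codings)
  next
    case 3
    show ?thesis by (rule conv[of "coding_left \<theta> x", OF _ 3]) (auto simp: sturmian_eq_codings)
  next
    case 4
    show ?thesis by (rule conv[of "coding_right \<theta> x", OF _ 4]) (auto simp: sturmian_eq_codings)
  qed
qed

section \<open>Square-integrable functions\<close>

lemma sq_integrableD:
  assumes "f \<in> sq_integrable M"
  shows "f \<in> borel_measurable M" "integrable M (\<lambda>x. (cmod (f x))\<^sup>2)"
  using assms by (auto simp: sq_integrable_def)

lemma norm_L2_nonneg: "0 \<le> norm_L2 M f"
  by (simp add: norm_L2_def)

lemma norm_L2_power2: "(norm_L2 M f)\<^sup>2 = (\<integral>x. (cmod (f x))\<^sup>2 \<partial>M)"
  by (simp add: norm_L2_def)

lemma norm_L2_zero: "norm_L2 M (\<lambda>x. 0) = 0"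
  by (simp add: norm_L2_def)

lemma norm_L2_scale: "norm_L2 M (\<lambda>x. c * f x) = cmod c * norm_L2 M f"
  by (simp add: norm_L2_def norm_mult power_mult_distrib real_sqrt_mult)

text \<open>
  Integrated with the norms of \<open>u\<close> and \<open>v\<close> as weights, this pointwise inequality becomes
  Minkowski's inequality for $L^2$.
\<close>

lemma power2_sum_le_weighted:
  fixes u v a b :: real
  assumes "a > 0" "b > 0"
  shows "(u + v)\<^sup>2 \<le> (a + b) * (u\<^sup>2 / a + v\<^sup>2 / b)"
proof -
  have "(a + b) * (u\<^sup>2 / a + v\<^sup>2 / b) - (u + v)\<^sup>2 = (u * b - v * a)\<^sup>2 / (a * b)"
    using assms by (simp add: field_simps power2_eq_square)
  also have "\<dots> \<ge> 0" using assms by simp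
  finally show ?thesis by simp
qed

lemma sq_integrable_add:
  assumes f: "f \<in> sq_integrable M" and g: "g \<in> sq_integrable M"
  shows "(\<lambda>x. f x + g x) \<in> sq_integrable M"
proof -
  note [measurable] = sq_integrableD(1)[OF f] sq_integrableD(1)[OF g]
  have "integrable M (\<lambda>x. (cmod (f x + g x))\<^sup>2)"
  proof (rule Bochner_Integration.integrable_bound)
    show "integrable M (\<lambda>x. 2 * ((cmod (f x))\<^sup>2 + (cmod (g x))\<^sup>2))"
      using sq_integrableD(2)[OF f] sq_integrableD(2)[OF g] by auto
    have "(cmod (f x + g x))\<^sup>2 \<le> 2 * ((cmod (f x))\<^sup>2 + (cmod (g x))\<^sup>2)" for x
    proof -
      have "(cmod (f x + g x))\<^sup>2 \<le> (cmod (f x) + cmod (g x))\<^sup>2"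
        by (intro power_mono norm_triangle_ineq) auto
      also have "\<dots> \<le> 2 * ((cmod (f x))\<^sup>2 + (cmod (g x))\<^sup>2)"
        using power2_sum_le_weighted[of 1 1 "cmod (f x)" "cmod (g x)"] by simp
      finally show ?thesis .
    qed
    then show "AE x in M. norm ((cmod (f x + g x))\<^sup>2) \<le> norm (2 * ((cmod (f x))\<^sup>2 + (cmod (g x))\<^sup>2))"
      by (auto intro!: AE_I2)
  qed measurable
  then show ?thesis by (simp add: sq_integrable_def)
qed

lemma sq_integrable_mult:
  assumes f: "f \<in> sq_integrable M" and g: "g \<in> borel_measurable M" "\<And>x. cmod (g x) \<le> B"
  shows "(\<lambda>x. g x * f x) \<in> sq_integrable M"
proof -
  note [measurable] = sq_integrableD(1)[OF f] g(1)
  have "integrable M (\<lambda>x. (cmod (g x * f x))\<^sup>2)"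
  proof (rule Bochner_Integration.integrable_bound)
    show "integrable M (\<lambda>x. B\<^sup>2 * (cmod (f x))\<^sup>2)"
      using sq_integrableD(2)[OF f] by auto
    show "AE x in M. norm ((cmod (g x * f x))\<^sup>2) \<le> norm (B\<^sup>2 * (cmod (f x))\<^sup>2)"
      using g(2) by (auto intro!: AE_I2 mult_right_mono power_mono simp: norm_mult power_mult_distrib)
  qed measurable
  then show ?thesis by (simp add: sq_integrable_def)
qed

lemma sq_integrable_uminus: "f \<in> sq_integrable M \<Longrightarrow> (\<lambda>x. - f x) \<in> sq_integrable M"
  by (simp add: sq_integrable_def)

lemma sq_integrable_diff:
  "f \<in> sq_integrable M \<Longrightarrow> g \<in> sq_integrable M \<Longrightarrow> (\<lambda>x. f x - g x) \<in> sq_integrable M"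
  using sq_integrable_add[OF _ sq_integrable_uminus, of f M g] by simp

lemma norm_L2_mult_le:
  assumes f: "f \<in> sq_integrable M" and g: "g \<in> borel_measurable M" "\<And>x. cmod (g x) \<le> B" and "0 \<le> B"
  shows "norm_L2 M (\<lambda>x. g x * f x) \<le> B * norm_L2 M f"
proof -
  have "(\<integral>x. (cmod (g x * f x))\<^sup>2 \<partial>M) \<le> (\<integral>x. B\<^sup>2 * (cmod (f x))\<^sup>2 \<partial>M)"
    using sq_integrableD(2)[OF sq_integrable_mult[OF f g]] sq_integrableD(2)[OF f] g(2)
    by (intro integral_mono) (auto intro!: mult_right_mono power_mono simp: norm_mult power_mult_distrib)
  then have "norm_L2 M (\<lambda>x. g x * f x) \<le> sqrt (B\<^sup>2 * (\<integral>x. (cmod (f x))\<^sup>2 \<partial>M))"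
    unfolding norm_L2_def by simp
  then show ?thesis using \<open>0 \<le> B\<close> by (simp add: norm_L2_def real_sqrt_mult)
qed

text \<open>
  The weights are the two norms, enlarged by \<open>e / 2\<close> to keep them positive.
\<close>

lemma norm_L2_triangle:
  assumes f: "f \<in> sq_integrable M" and g: "g \<in> sq_integrable M"
  shows "norm_L2 M (\<lambda>x. f x + g x) \<le> norm_L2 M f + norm_L2 M g"
proof (rule field_le_epsilon)
  fix e :: real assume e: "e > 0"
  define a where "a = norm_L2 M f + e / 2"
  define b where "b = norm_L2 M g + e / 2"
  have ab: "a > 0" "b > 0" using e norm_L2_nonneg[of M f] norm_L2_nonneg[of M g] by (auto simp: a_def b_def)
  have le: "(cmod (f x + g x))\<^sup>2 \<le> (a + b) * ((cmod (f x))\<^sup>2 / a + (cmod (g x))\<^sup>2 / b)" for x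
  proof -
    have "(cmod (f x + g x))\<^sup>2 \<le> (cmod (f x) + cmod (g x))\<^sup>2"
      by (intro power_mono norm_triangle_ineq) auto
    also have "\<dots> \<le> (a + b) * ((cmod (f x))\<^sup>2 / a + (cmod (g x))\<^sup>2 / b)"
      by (rule power2_sum_le_weighted[OF ab])
    finally show ?thesis .
  qed
  have "(norm_L2 M (\<lambda>x. f x + g x))\<^sup>2 \<le> (\<integral>x. (a + b) * ((cmod (f x))\<^sup>2 / a + (cmod (g x))\<^sup>2 / b) \<partial>M)"
    unfolding norm_L2_power2
    using sq_integrableD(2)[OF sq_integrable_add[OF f g]] sq_integrableD(2)[OF f] sq_integrableD(2)[OF g]
    by (intro integral_mono le) auto
  also have "\<dots> = (a + b) * ((norm_L2 M f)\<^sup>2 / a + (norm_L2 M g)\<^sup>2 / b)"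
    unfolding norm_L2_power2 using sq_integrableD(2)[OF f] sq_integrableD(2)[OF g] by simp
  also have "\<dots> \<le> (a + b) * (a + b)"
  proof (intro mult_left_mono add_mono)
    have "(norm_L2 M f)\<^sup>2 \<le> a\<^sup>2" using e norm_L2_nonneg[of M f] by (intro power_mono) (auto simp: a_def)
    then show "(norm_L2 M f)\<^sup>2 / a \<le> a" using ab by (simp add: field_simps power2_eq_square)
    have "(norm_L2 M g)\<^sup>2 \<le> b\<^sup>2" using e norm_L2_nonneg[of M g] by (intro power_mono) (auto simp: b_def)
    then show "(norm_L2 M g)\<^sup>2 / b \<le> b" using ab by (simp add: field_simps power2_eq_square)
  qed (use ab in auto)
  finally have "(norm_L2 M (\<lambda>x. f x + g x))\<^sup>2 \<le> (a + b)\<^sup>2" by (simp add: power2_eq_square)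
  then have "norm_L2 M (\<lambda>x. f x + g x) \<le> a + b" by (rule power2_le_imp_le) (use ab in simp)
  then show "norm_L2 M (\<lambda>x. f x + g x) \<le> norm_L2 M f + norm_L2 M g + e" by (simp add: a_def b_def)
qed

lemma norm_L2_triangle_diff:
  assumes f: "f \<in> sq_integrable M" and g: "g \<in> sq_integrable M"
  shows "norm_L2 M (\<lambda>x. f x - g x) \<le> norm_L2 M f + norm_L2 M g"
  using norm_L2_triangle[OF f sq_integrable_uminus[OF g]] by (simp add: norm_L2_def)

lemma sq_integrable_sum:
  assumes "finite I" "\<And>i. i \<in> I \<Longrightarrow> f i \<in> sq_integrable M"
  shows "(\<lambda>x. \<Sum>i\<in>I. f i x) \<in> sq_integrable M"
  using assms
proof (induction rule: finite_induct)
  case (insert i I)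
  then show ?case using sq_integrable_add[of "f i" M "\<lambda>x. \<Sum>i\<in>I. f i x"] by simp
qed (simp add: sq_integrable_def)

lemma norm_L2_sum:
  assumes "finite I" "\<And>i. i \<in> I \<Longrightarrow> f i \<in> sq_integrable M"
  shows "norm_L2 M (\<lambda>x. \<Sum>i\<in>I. f i x) \<le> (\<Sum>i\<in>I. norm_L2 M (f i))"
  using assms
proof (induction rule: finite_induct)
  case (insert i I)
  then show ?case
    using norm_L2_triangle[of "f i" M "\<lambda>x. \<Sum>i\<in>I. f i x"] sq_integrable_sum[of I f M] by simp
qed (simp add: norm_L2_zero)

section \<open>Windows, cells and the spaces $C_n$\<close>

lemma length_window [simp]: "length (window n) = n"
  by (cases "odd n") (auto simp: window_def Let_def elim!: oddE evenE)

lemma window_eq_interval: "\<exists>a. window n = [a..a + int n - 1]"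
proof (cases "odd n")
  case True
  then obtain k where "n = 2 * k + 1" by (elim oddE)
  then have "window n = [- int k..- int k + int n - 1]" by (simp add: window_def Let_def)
  then show ?thesis by blast
next
  case False
  then obtain k where "n = 2 * k" by (auto elim: evenE)
  then have "window n = [1 - int k..1 - int k + int n - 1]" by (simp add: window_def Let_def)
  then show ?thesis by blast
qed

lemma set_window: "set (window n) = {(if odd n then - int (n div 2) else 1 - int (n div 2))..int (n div 2)}"
  by (simp add: window_def Let_def)

lemma window_mono: "m \<le> n \<Longrightarrow> set (window m) \<subseteq> set (window n)"
proof (induction rule: dec_induct)
  case (step k)
  have "set (window k) \<subseteq> set (window (Suc k))"
    unfolding set_window by (cases "odd k") (auto elim!: oddE evenE)
  then show ?case using step by blast
qed simp

lemma in_window_eventually: "i \<in> set (window (2 * nat \<bar>i\<bar> + 1))"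
  unfolding set_window by auto

text \<open>
  Agreement on the window of length \<open>n\<close>; its classes are the cylinder sets, and $C_n$ consists of
  the functions that are constant on them.
\<close>

definition agree :: "nat \<Rightarrow> (int \<Rightarrow> nat) \<Rightarrow> (int \<Rightarrow> nat) \<Rightarrow> bool" where
  "agree n x y \<longleftrightarrow> (\<forall>i\<in>set (window n). x i = y i)"

lemma agree_iff: "agree n x y \<longleftrightarrow> map x (window n) = map y (window n)"
  by (auto simp: agree_def)

lemma agree_mono: "m \<le> n \<Longrightarrow> agree n x y \<Longrightarrow> agree m x y"
  using window_mono[of m n] by (auto simp: agree_def)

lemma agree_refl: "agree n x x" by (simp add: agree_def)
lemma agree_sym: "agree n x y \<Longrightarrow> agree n y x" by (auto simp: agree_def)
lemma agree_trans: "agree n x y \<Longrightarrow> agree n y z \<Longrightarrow> agree n x z" by (auto simp: agree_def)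

lemma words_eq_window:
  assumes "\<And>w k. w \<in> X \<Longrightarrow> (\<lambda>n. w (n + k)) \<in> X"
  shows "words X n = (\<lambda>x. map x (window n)) ` X"
proof -
  obtain a where a: "window n = [a..a + int n - 1]" using window_eq_interval by blast
  have e: "map x (window n) = map (\<lambda>j. x (j + (a - 1))) [1..int n]" for x :: "int \<Rightarrow> nat"
    unfolding a by (rule nth_equalityI) (simp_all add: nth_upto add.commute)
  have e': "map x [1..int n] = map (\<lambda>j. x (j + (1 - a))) (window n)" for x :: "int \<Rightarrow> nat"
    unfolding a by (rule nth_equalityI) (simp_all add: nth_upto add.commute)
  show ?thesis
  proof (intro equalityI subsetI)
    fix w assume "w \<in> words X n"
    then obtain x where "x \<in> X" "w = map x [1..int n]" by (auto simp: words_def)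
    then show "w \<in> (\<lambda>x. map x (window n)) ` X" using e'[of x] assms by blast
  next
    fix w assume "w \<in> (\<lambda>x. map x (window n)) ` X"
    then obtain x where "x \<in> X" "w = map x (window n)" by blast
    then show "w \<in> words X n" using e[of x] assms unfolding words_def by blast
  qed
qed

definition cell :: "(int \<Rightarrow> nat) set \<Rightarrow> nat \<Rightarrow> (int \<Rightarrow> nat) \<Rightarrow> (int \<Rightarrow> nat) set" where
  "cell X n x = {y \<in> X. agree n x y}"

lemma cyl_window: "cyl X (map x (window n)) = cell X n x"
  by (auto simp: cyl_def cell_def agree_iff)

lemma cell_eq: "agree n x y \<Longrightarrow> cell X n x = cell X n y"
  unfolding cell_def by (metis agree_sym agree_trans)

lemma in_cell: "x \<in> X \<Longrightarrow> x \<in> cell X n x" for n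
  by (simp add: cell_def agree_refl)

lemma open_agree: "open {y. agree n x y}"
proof -
  have "open {y::int \<Rightarrow> nat. \<forall>i\<in>set (window n). y i \<in> {x i}}"
    by (rule product_topology_basis'[of "set (window n)" "\<lambda>i. {x i}" "\<lambda>i. i"])
      (auto intro: Topological_Spaces.open_discrete)
  also have "{y. \<forall>i\<in>set (window n). y i \<in> {x i}} = {y. agree n x y}"
    by (auto simp: agree_def)
  finally show ?thesis .
qed

lemma cell_in_sets:
  assumes "sets \<mu> = sets (restrict_space borel X)"
  shows "cell X n x \<in> sets \<mu>"
proof -
  have "cell X n x = X \<inter> {y. agree n x y}" by (auto simp: cell_def)
  then show ?thesis unfolding assms using borel_open[OF open_agree] by (auto simp: sets_restrict_space)
qed

text \<open>
  Positivity of the cylinders makes the $L^2$ norm determine the elements of $C_n$ as functions, not only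
  almost everywhere.
\<close>

locale measured_subshift = prob_space \<mu>
  for X :: "(int \<Rightarrow> nat) set" and \<mu> :: "(int \<Rightarrow> nat) measure" +
  assumes translate: "\<And>w k. w \<in> X \<Longrightarrow> (\<lambda>n. w (n + k)) \<in> X"
    and finite_words: "finite (words X n)"
    and sets_mu: "sets \<mu> = sets (restrict_space borel X)"
    and cell_pos: "x \<in> X \<Longrightarrow> 0 < measure \<mu> (cell X n x)"
begin

lemma space_mu: "space \<mu> = X"
  using sets_eq_imp_space_eq[OF sets_mu] by (simp add: space_restrict_space)

lemma words_window: "words X n = (\<lambda>x. map x (window n)) ` X"
  using words_eq_window translate by blast

lemma word_sum_value:
  "(\<Sum>w\<in>words X n. c w * indicator (cyl X w) x) = (if x \<in> X then c (map x (window n)) else (0::complex))"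
proof (cases "x \<in> X")
  case True
  have "(\<Sum>w\<in>words X n. c w * indicator (cyl X w) x)
      = (\<Sum>w\<in>words X n. if w = map x (window n) then c w else 0)"
  proof (intro sum.cong refl)
    fix w assume "w \<in> words X n"
    then have "length w = n" by (auto simp: words_window)
    then show "c w * indicator (cyl X w) x = (if w = map x (window n) then c w else 0)"
      using True by (auto simp: cyl_def)
  qed
  moreover have "map x (window n) \<in> words X n" unfolding words_window using True by (rule imageI)
  ultimately show ?thesis using True finite_words by simp
qed (simp add: cyl_def)

text \<open>
  Closure of $C_n$ under the operations used below is read off from this description.
\<close>

lemma C_fin_iff:
  "f \<in> C_fin X n \<longleftrightarrow> (\<forall>x. x \<notin> X \<longrightarrow> f x = 0) \<and> (\<forall>x\<in>X. \<forall>y\<in>X. agree n x y \<longrightarrow> f x = f y)"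
proof -
  show ?thesis
  proof
    assume "f \<in> C_fin X n"
    then obtain c where "f = (\<lambda>x. \<Sum>w\<in>words X n. c w * indicator (cyl X w) x)"
      by (auto simp: C_fin_def)
    then show "(\<forall>x. x \<notin> X \<longrightarrow> f x = 0) \<and> (\<forall>x\<in>X. \<forall>y\<in>X. agree n x y \<longrightarrow> f x = f y)"
      by (simp add: word_sum_value agree_iff del: map_eq_conv)
  next
    assume f: "(\<forall>x. x \<notin> X \<longrightarrow> f x = 0) \<and> (\<forall>x\<in>X. \<forall>y\<in>X. agree n x y \<longrightarrow> f x = f y)"
    define c where "c w = f (SOME x. x \<in> X \<and> map x (window n) = w)" for w
    have "f x = (\<Sum>w\<in>words X n. c w * indicator (cyl X w) x)" for x
    proof (cases "x \<in> X")
      case True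
      then have ex: "\<exists>y. y \<in> X \<and> map y (window n) = map x (window n)" by blast
      define y where "y = (SOME y. y \<in> X \<and> map y (window n) = map x (window n))"
      have "y \<in> X \<and> map y (window n) = map x (window n)"
        unfolding y_def by (rule someI_ex[OF ex])
      then have "f y = f x" using f True unfolding agree_iff by blast
      then show ?thesis using True unfolding word_sum_value c_def y_def by simp
    qed (use f in \<open>auto simp: word_sum_value\<close>)
    then show "f \<in> C_fin X n" by (auto simp: C_fin_def)
  qed
qed

lemma C_fin_outside: "f \<in> C_fin X n \<Longrightarrow> x \<notin> X \<Longrightarrow> f x = 0"
  unfolding C_fin_iff by blast

lemma C_fin_agree: "f \<in> C_fin X n \<Longrightarrow> x \<in> X \<Longrightarrow> y \<in> X \<Longrightarrow> agree n x y \<Longrightarrow> f x = f y"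
  unfolding C_fin_iff by blast

lemma C_fin_mono: "m \<le> n \<Longrightarrow> f \<in> C_fin X m \<Longrightarrow> f \<in> C_fin X n"
  unfolding C_fin_iff using agree_mono by blast

lemma C_fin_zero: "(\<lambda>x. 0) \<in> C_fin X n"
  by (simp add: C_fin_iff)

lemma C_fin_indicator: "indicator X \<in> C_fin X n"
  by (simp add: C_fin_iff)

lemma C_fin_indicator_cell: "x \<in> X \<Longrightarrow> indicator (cell X n x) \<in> C_fin X n"
  unfolding C_fin_iff cell_def by (auto simp: indicator_def intro: agree_trans agree_sym)

lemma C_fin_combine:
  assumes "f \<in> C_fin X n" "g \<in> C_fin X n" "h 0 0 = 0"
  shows "(\<lambda>x. h (f x) (g x)) \<in> C_fin X n"
  unfolding C_fin_iff
proof (intro conjI ballI allI impI)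
  fix x assume "x \<notin> X"
  then show "h (f x) (g x) = 0" using assms C_fin_outside by metis
next
  fix x y assume "x \<in> X" "y \<in> X" "agree n x y"
  then show "h (f x) (g x) = h (f y) (g y)"
    using C_fin_agree[OF assms(1)] C_fin_agree[OF assms(2)] by metis
qed

lemma C_fin_diff: "f \<in> C_fin X n \<Longrightarrow> g \<in> C_fin X n \<Longrightarrow> (\<lambda>x. f x - g x) \<in> C_fin X n"
  by (rule C_fin_combine) auto

lemma C_fin_mult: "f \<in> C_fin X n \<Longrightarrow> g \<in> C_fin X n \<Longrightarrow> (\<lambda>x. f x * g x) \<in> C_fin X n"
  by (rule C_fin_combine) auto

lemma C_fin_cnj_mult: "f \<in> C_fin X n \<Longrightarrow> g \<in> C_fin X n \<Longrightarrow> (\<lambda>x. cnj (f x) * g x) \<in> C_fin X n"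
  by (rule C_fin_combine) auto

lemma C_fin_scale: "f \<in> C_fin X n \<Longrightarrow> (\<lambda>x. c * f x) \<in> C_fin X n"
  using C_fin_combine[of f n f "\<lambda>u v. c * u"] by simp

lemma C_fin_sum:
  assumes "\<And>i. i \<in> I \<Longrightarrow> f i \<in> C_fin X n"
  shows "(\<lambda>x. \<Sum>i\<in>I. f i x) \<in> C_fin X n"
proof -
  have o: "f i x = 0" if "i \<in> I" "x \<notin> X" for i x using C_fin_outside[OF assms] that by blast
  have a: "f i x = f i y" if "i \<in> I" "x \<in> X" "y \<in> X" "agree n x y" for i x y
    using C_fin_agree[OF assms] that by blast
  show ?thesis unfolding C_fin_iff using o a by (auto intro!: sum.neutral sum.cong)
qed

lemma C_fin_range: "f \<in> C_fin X n \<Longrightarrow> finite (range f)"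
proof -
  assume f: "f \<in> C_fin X n"
  obtain c where "f = (\<lambda>x. \<Sum>w\<in>words X n. c w * indicator (cyl X w) x)"
    using f by (auto simp: C_fin_def)
  then have v: "f x = (if x \<in> X then c (map x (window n)) else 0)" for x
    by (simp add: word_sum_value)
  then have "range f \<subseteq> insert 0 (c ` words X n)"
    unfolding words_window by auto
  then show "finite (range f)" using finite_words finite_subset by blast
qed

lemma C_fin_bounded:
  assumes "f \<in> C_fin X n"
  obtains B where "B \<ge> 0" "\<And>x. cmod (f x) \<le> B"
proof (rule that)
  have fin: "finite (cmod ` range f)" using C_fin_range[OF assms] by simp
  show "cmod (f x) \<le> Max (cmod ` range f)" for x using fin by (intro Max_ge) auto
  then show "0 \<le> Max (cmod ` range f)" using norm_ge_zero order_trans by blast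
qed

lemma cell_measurable [measurable]: "cell X n x \<in> sets \<mu>"
  by (rule cell_in_sets[OF sets_mu])

lemma C_fin_measurable:
  assumes "f \<in> C_fin X n"
  shows "f \<in> borel_measurable \<mu>"
proof -
  obtain c where c: "f = (\<lambda>x. \<Sum>w\<in>words X n. c w * indicator (cyl X w) x)"
    using assms by (auto simp: C_fin_def)
  have "cyl X w \<in> sets \<mu>" if "w \<in> words X n" for w
    using that by (auto simp: words_window cyl_window)
  then show ?thesis unfolding c
    by (intro borel_measurable_sum borel_measurable_times borel_measurable_const borel_measurable_indicator)
qed

lemma C_fin_integrable:
  assumes "f \<in> C_fin X n"
  shows "integrable \<mu> f"
proof -
  obtain B where "\<And>x. cmod (f x) \<le> B" using C_fin_bounded[OF assms] by blast
  then show ?thesis by (intro integrable_const_bound[of _ B] C_fin_measurable[OF assms]) auto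
qed

lemma C_fin_inner_integrable:
  assumes "f \<in> C_fin X n" "g \<in> C_fin X m"
  shows "integrable \<mu> (\<lambda>x. f x * cnj (g x))"
proof -
  have "(\<lambda>x. f x * cnj (g x)) \<in> C_fin X (max n m)"
    by (rule C_fin_combine) (use C_fin_mono[OF _ assms(1)] C_fin_mono[OF _ assms(2)] in auto)
  then show ?thesis by (rule C_fin_integrable)
qed

lemma C_fin_sq_integrable:
  assumes "f \<in> C_fin X n"
  shows "f \<in> sq_integrable \<mu>"
proof -
  obtain B where B: "\<And>x. cmod (f x) \<le> B" using C_fin_bounded[OF assms] by blast
  note [measurable] = C_fin_measurable[OF assms]
  have "integrable \<mu> (\<lambda>x. (cmod (f x))\<^sup>2)"
    by (intro integrable_const_bound[of _ "B\<^sup>2"] AE_I2) (use B in \<open>auto intro!: power_mono\<close>)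
  then show ?thesis by (simp add: sq_integrable_def)
qed

section \<open>Projections onto $C_n$ and the eigenspaces of $D$\<close>

lemma inner_self: "inner_L2 \<mu> f f = complex_of_real ((norm_L2 \<mu> f)\<^sup>2)"
  unfolding inner_L2_def norm_L2_power2 by (simp add: complex_norm_square[symmetric] flip: integral_complex_of_real)

lemma inner_commute: "inner_L2 \<mu> f g = cnj (inner_L2 \<mu> g f)"
  unfolding inner_L2_def using Bochner_Integration.integral_cnj[of \<mu> "\<lambda>x. g x * cnj (f x)"] by (simp add: mult.commute)

lemma inner_diff_left:
  assumes "f \<in> C_fin X n" "g \<in> C_fin X m" "h \<in> C_fin X l"
  shows "inner_L2 \<mu> (\<lambda>x. f x - g x) h = inner_L2 \<mu> f h - inner_L2 \<mu> g h"
  unfolding inner_L2_def using C_fin_inner_integrable assms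
  by (simp add: left_diff_distrib Bochner_Integration.integral_diff)

lemma pythagoras:
  assumes I: "finite I" and f: "\<And>i. i \<in> I \<Longrightarrow> f i \<in> C_fin X (d i)"
    and o: "\<And>i j. i \<in> I \<Longrightarrow> j \<in> I \<Longrightarrow> i \<noteq> j \<Longrightarrow> inner_L2 \<mu> (f i) (f j) = 0"
  shows "(norm_L2 \<mu> (\<lambda>x. \<Sum>i\<in>I. f i x))\<^sup>2 = (\<Sum>i\<in>I. (norm_L2 \<mu> (f i))\<^sup>2)"
proof -
  have "inner_L2 \<mu> (\<lambda>x. \<Sum>i\<in>I. f i x) (\<lambda>x. \<Sum>i\<in>I. f i x)
      = (\<Sum>i\<in>I. \<Sum>j\<in>I. inner_L2 \<mu> (f i) (f j))"
  proof -
    have "inner_L2 \<mu> (\<lambda>x. \<Sum>i\<in>I. f i x) (\<lambda>x. \<Sum>i\<in>I. f i x)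
        = (\<integral>x. (\<Sum>i\<in>I. \<Sum>j\<in>I. f i x * cnj (f j x)) \<partial>\<mu>)"
      by (simp add: inner_L2_def sum_product)
    also have "\<dots> = (\<Sum>i\<in>I. (\<integral>x. (\<Sum>j\<in>I. f i x * cnj (f j x)) \<partial>\<mu>))"
      by (intro Bochner_Integration.integral_sum Bochner_Integration.integrable_sum C_fin_inner_integrable[OF f f])
    also have "\<dots> = (\<Sum>i\<in>I. \<Sum>j\<in>I. inner_L2 \<mu> (f i) (f j))"
      unfolding inner_L2_def
      by (intro sum.cong refl Bochner_Integration.integral_sum C_fin_inner_integrable[OF f f])
    finally show ?thesis .
  qed
  also have "\<dots> = (\<Sum>i\<in>I. \<Sum>j\<in>I. if i = j then inner_L2 \<mu> (f i) (f i) else 0)"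
    using o by (intro sum.cong refl) auto
  also have "\<dots> = (\<Sum>i\<in>I. inner_L2 \<mu> (f i) (f i))" using I by simp
  finally show ?thesis unfolding inner_self by (metis of_real_eq_iff of_real_sum)
qed

lemma integral_cell: "(\<integral>y. indicator (cell X n x) y \<partial>\<mu>) = complex_of_real (measure \<mu> (cell X n x))"
proof -
  have "(\<integral>y. indicator (cell X n x) y \<partial>\<mu>) = (\<integral>y. complex_of_real (indicator (cell X n x) y) \<partial>\<mu>)"
    by (intro Bochner_Integration.integral_cong) (auto simp: indicator_def)
  then show ?thesis
    using sets.sets_into_space[OF cell_measurable[of n x]] by (simp add: Int_absorb2)
qed

text \<open>
  A function in $C_n$ is constant on the cell of \<open>x\<close>, so its values are controlled by its
  $L^2$ norm as soon as the measure of the cell is bounded below.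
\<close>

lemma pointwise_bound:
  assumes f: "f \<in> C_fin X n" and x: "x \<in> X"
  shows "(cmod (f x))\<^sup>2 * measure \<mu> (cell X n x) \<le> (norm_L2 \<mu> f)\<^sup>2"
proof -
  have "(cmod (f x))\<^sup>2 * measure \<mu> (cell X n x) = (\<integral>y. (cmod (f x))\<^sup>2 * indicator (cell X n x) y \<partial>\<mu>)"
    using sets.sets_into_space[OF cell_measurable] by (simp add: Int_absorb2)
  also have "\<dots> \<le> (\<integral>y. (cmod (f y))\<^sup>2 \<partial>\<mu>)"
  proof (rule integral_mono)
    show "integrable \<mu> (\<lambda>y. (cmod (f x))\<^sup>2 * indicator (cell X n x) y)"
      by (simp add: integrable_real_indicator emeasure_eq_measure)
    show "integrable \<mu> (\<lambda>y. (cmod (f y))\<^sup>2)"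
      by (rule sq_integrableD(2)[OF C_fin_sq_integrable[OF f]])
    show "(cmod (f x))\<^sup>2 * indicator (cell X n x) y \<le> (cmod (f y))\<^sup>2" for y
      using C_fin_agree[OF f x, of y] by (auto simp: cell_def indicator_def)
  qed
  finally show ?thesis by (simp add: norm_L2_power2)
qed

text \<open>
  The average over the cell of \<open>x\<close>: for \<open>f\<close> locally constant this is the orthogonal projection
  of \<open>f\<close> onto $C_n$.
\<close>

definition cond_exp :: "nat \<Rightarrow> ((int \<Rightarrow> nat) \<Rightarrow> complex) \<Rightarrow> (int \<Rightarrow> nat) \<Rightarrow> complex" where
  "cond_exp n f x = (if x \<in> X then (\<integral>y. f y * indicator (cell X n x) y \<partial>\<mu>) / measure \<mu> (cell X n x) else 0)"

lemma cond_exp_in: "cond_exp n f \<in> C_fin X n"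
  unfolding C_fin_iff cond_exp_def using cell_eq by auto

lemma indicator_X_sum:
  assumes "x \<in> X"
  shows "(\<Sum>w\<in>words X n. indicator (cyl X w) x) = (1::complex)"
  using word_sum_value[of "\<lambda>_. 1" x n] assms by simp

lemma cond_exp_orthogonal:
  assumes f: "f \<in> C_fin X M" and g: "g \<in> C_fin X n"
  shows "inner_L2 \<mu> (\<lambda>x. f x - cond_exp n f x) g = 0"
proof -
  let ?h = "\<lambda>x. f x - cond_exp n f x"
  have h: "?h \<in> C_fin X (max M n)"
    using C_fin_diff C_fin_mono[OF _ f] C_fin_mono[OF _ cond_exp_in] by simp
  have zero: "(\<integral>x. ?h x * cnj (g x) * indicator (cyl X w) x \<partial>\<mu>) = 0" if "w \<in> words X n" for w
  proof -
    from that obtain u where u: "u \<in> X" "w = map u (window n)" by (auto simp: words_window)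
    let ?I = "indicator (cell X n u) :: _ \<Rightarrow> complex"
    have If: "integrable \<mu> (\<lambda>x. f x * ?I x)"
    proof (rule C_fin_integrable)
      show "(\<lambda>x. f x * ?I x) \<in> C_fin X (max M n)"
        by (intro C_fin_mult C_fin_mono[OF _ f] C_fin_mono[OF _ C_fin_indicator_cell[OF u(1)]]) auto
    qed
    have II: "integrable \<mu> ?I" by (rule C_fin_integrable[OF C_fin_indicator_cell[OF u(1)]])
    have "(\<integral>x. ?h x * cnj (g x) * indicator (cyl X w) x \<partial>\<mu>)
        = (\<integral>x. (f x * ?I x - cond_exp n f u * ?I x) * cnj (g u) \<partial>\<mu>)"
    proof (rule Bochner_Integration.integral_cong[OF refl])
      fix x
      show "?h x * cnj (g x) * indicator (cyl X w) x = (f x * ?I x - cond_exp n f u * ?I x) * cnj (g u)"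
        unfolding u(2) cyl_window
        using C_fin_agree[OF g u(1), of x] C_fin_agree[OF cond_exp_in u(1), of x]
        by (auto simp: cell_def indicator_def)
    qed
    also have "\<dots> = ((\<integral>x. f x * ?I x \<partial>\<mu>) - cond_exp n f u * (\<integral>x. ?I x \<partial>\<mu>)) * cnj (g u)"
      using If II by simp
    also have "(\<integral>x. ?I x \<partial>\<mu>) = measure \<mu> (cell X n u)"
      by (rule integral_cell)
    also have "cond_exp n f u * measure \<mu> (cell X n u) = (\<integral>x. f x * ?I x \<partial>\<mu>)"
      using cell_pos[OF u(1), of n] u(1) by (simp add: cond_exp_def)
    finally show ?thesis by simp
  qed
  have "inner_L2 \<mu> ?h g = (\<integral>x. (\<Sum>w\<in>words X n. ?h x * cnj (g x) * indicator (cyl X w) x) \<partial>\<mu>)"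
    unfolding inner_L2_def
  proof (rule Bochner_Integration.integral_cong[OF refl])
    fix x assume "x \<in> space \<mu>"
    then show "?h x * cnj (g x) = (\<Sum>w\<in>words X n. ?h x * cnj (g x) * indicator (cyl X w) x)"
      using indicator_X_sum[of x n] by (simp add: space_mu flip: sum_distrib_left)
  qed
  also have "\<dots> = (\<Sum>w\<in>words X n. (\<integral>x. ?h x * cnj (g x) * indicator (cyl X w) x \<partial>\<mu>))"
  proof (rule Bochner_Integration.integral_sum)
    fix w assume "w \<in> words X n"
    then have "cyl X w \<in> sets \<mu>" by (auto simp: words_window cyl_window)
    then have "integrable \<mu> (\<lambda>x. indicator (cyl X w) x *\<^sub>R (?h x * cnj (g x)))"
      by (intro integrable_mult_indicator C_fin_inner_integrable[OF h g])
    also have "(\<lambda>x. indicator (cyl X w) x *\<^sub>R (?h x * cnj (g x)))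
        = (\<lambda>x. ?h x * cnj (g x) * indicator (cyl X w) x)"
      by (auto simp: indicator_def fun_eq_iff)
    finally show "integrable \<mu> (\<lambda>x. ?h x * cnj (g x) * indicator (cyl X w) x)" .
  qed
  also have "\<dots> = 0" using zero by simp
  finally show ?thesis .
qed

lemma cond_exp_id:
  assumes f: "f \<in> C_fin X n"
  shows "cond_exp n f = f"
proof
  fix x
  show "cond_exp n f x = f x"
  proof (cases "x \<in> X")
    case True
    have "(\<integral>y. f y * indicator (cell X n x) y \<partial>\<mu>) = (\<integral>y. f x * indicator (cell X n x) y \<partial>\<mu>)"
      using C_fin_agree[OF f True]
      by (intro Bochner_Integration.integral_cong) (auto simp: cell_def indicator_def)
    also have "\<dots> = f x * measure \<mu> (cell X n x)"
      by (simp add: integral_cell)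
    finally show ?thesis using cell_pos[OF True, of n] True by (simp add: cond_exp_def)
  qed (simp add: cond_exp_def C_fin_outside[OF f])
qed

text \<open>
  The component of \<open>f\<close> in the eigenspace of $D$ for the eigenvalue \<open>n\<close>.
\<close>

definition component :: "((int \<Rightarrow> nat) \<Rightarrow> complex) \<Rightarrow> nat \<Rightarrow> (int \<Rightarrow> nat) \<Rightarrow> complex" where
  "component f n = (if n = 0 then cond_exp 0 f else (\<lambda>x. cond_exp n f x - cond_exp (n - 1) f x))"

lemma component_sum: "(\<Sum>n\<le>m. component f n x) = cond_exp m f x"
  by (induction m) (auto simp: component_def)

lemma component_sum_block:
  assumes "0 < a" "a \<le> b"
  shows "(\<Sum>n\<in>{a..<b}. component f n x) = cond_exp (b - 1) f x - cond_exp (a - 1) f x"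
  using assms(2)
proof (induction b rule: dec_induct)
  case (step n)
  then show ?case using assms(1) by (simp add: component_def)
qed simp

lemma component_eigen:
  assumes f: "f \<in> C_fin X M"
  shows "component f n \<in> eigenspace_D X \<mu> n"
proof (cases n)
  case 0
  then show ?thesis by (simp add: eigenspace_D_def component_def cond_exp_in)
next
  case (Suc m)
  have c: "component f n = (\<lambda>x. (f x - cond_exp m f x) - (f x - cond_exp n f x))"
    using Suc by (auto simp: component_def)
  have "component f n \<in> C_fin X n"
    using C_fin_diff[OF cond_exp_in C_fin_mono[OF _ cond_exp_in], of m n f f] Suc
    by (simp add: component_def)
  moreover have "inner_L2 \<mu> (component f n) g = 0" if g: "g \<in> C_fin X m" for g
  proof -
    have d: "(\<lambda>x. f x - cond_exp k f x) \<in> C_fin X (max M k)" for k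
      using C_fin_diff C_fin_mono[OF _ f] C_fin_mono[OF _ cond_exp_in] by simp
    show ?thesis unfolding c
      using inner_diff_left[OF d d g] cond_exp_orthogonal[OF f g]
        cond_exp_orthogonal[OF f C_fin_mono[OF _ g, of n]] Suc by simp
  qed
  ultimately show ?thesis using Suc by (simp add: eigenspace_D_def)
qed

lemma component_zero:
  assumes f: "f \<in> C_fin X M" and "M < n"
  shows "component f n = (\<lambda>x. 0)"
  using cond_exp_id[OF C_fin_mono[OF _ f]] assms(2) by (auto simp: component_def)

lemma eigen_in: "e \<in> eigenspace_D X \<mu> n \<Longrightarrow> e \<in> C_fin X n"
  by (simp add: eigenspace_D_def)

lemma eigen_orthogonal:
  assumes "e \<in> eigenspace_D X \<mu> n" "e' \<in> C_fin X m" "m < n"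
  shows "inner_L2 \<mu> e e' = 0" "inner_L2 \<mu> e' e = 0"
proof -
  show "inner_L2 \<mu> e e' = 0"
    using assms C_fin_mono[of m "n - 1" e'] by (auto simp: eigenspace_D_def)
  then show "inner_L2 \<mu> e' e = 0" using inner_commute[of e' e] by simp
qed

lemma eigen_orthogonal_eigen:
  assumes "e \<in> eigenspace_D X \<mu> n" "e' \<in> eigenspace_D X \<mu> m" "m \<noteq> n"
  shows "inner_L2 \<mu> e e' = 0"
  using eigen_orthogonal assms eigen_in by (metis nat_neq_iff)

lemma eigen_scale: "e \<in> eigenspace_D X \<mu> n \<Longrightarrow> (\<lambda>x. c * e x) \<in> eigenspace_D X \<mu> n"
  unfolding eigenspace_D_def by (auto intro: C_fin_scale simp: inner_L2_def mult.assoc)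

lemma eigen_diff:
  "e \<in> eigenspace_D X \<mu> n \<Longrightarrow> e' \<in> eigenspace_D X \<mu> n \<Longrightarrow> (\<lambda>x. e x - e' x) \<in> eigenspace_D X \<mu> n"
  unfolding eigenspace_D_def using C_fin_diff by (auto simp: inner_diff_left)

text \<open>
  Multiplication by \<open>g\<close> preserves both $C_n$ and $C_{n-1}$, and so does its adjoint, multiplication by
  the conjugate of \<open>g\<close>; hence \<open>g\<close> commutes with $D$ on the eigenspaces beyond its own level.
\<close>

lemma eigen_mult:
  assumes g: "g \<in> C_fin X m" and e: "e \<in> eigenspace_D X \<mu> n" and mn: "m < n"
  shows "(\<lambda>x. g x * e x) \<in> eigenspace_D X \<mu> n"
proof -
  have "inner_L2 \<mu> (\<lambda>x. g x * e x) k = 0" if k: "k \<in> C_fin X (n - 1)" for k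
  proof -
    have "(\<lambda>x. cnj (g x) * k x) \<in> C_fin X (n - 1)"
      using C_fin_cnj_mult[OF C_fin_mono[OF _ g] k] mn by simp
    then have "inner_L2 \<mu> e (\<lambda>x. cnj (g x) * k x) = 0"
      using e mn by (auto simp: eigenspace_D_def)
    then show ?thesis by (simp add: inner_L2_def mult_ac)
  qed
  then show ?thesis
    using C_fin_mult[OF C_fin_mono[OF _ g] eigen_in[OF e]] mn by (auto simp: eigenspace_D_def)
qed

lemma eigen_pythagoras:
  assumes "finite I" "\<And>i. i \<in> I \<Longrightarrow> e i \<in> eigenspace_D X \<mu> i"
  shows "(norm_L2 \<mu> (\<lambda>x. \<Sum>i\<in>I. e i x))\<^sup>2 = (\<Sum>i\<in>I. (norm_L2 \<mu> (e i))\<^sup>2)"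
  by (rule pythagoras[OF assms(1), of e "\<lambda>i. i"])
    (use eigen_in[OF assms(2)] eigen_orthogonal_eigen[OF assms(2) assms(2)] in auto)

section \<open>Bounds for the commutator\<close>

lemma graph_D_finite:
  assumes e: "\<And>n. e n \<in> eigenspace_D X \<mu> n" and z: "\<And>n. M < n \<Longrightarrow> e n = (\<lambda>x. 0)"
  shows "((\<lambda>x. \<Sum>n\<le>M. e n x), (\<lambda>x. \<Sum>n\<le>M. of_nat n * e n x)) \<in> graph_D X \<mu>"
proof -
  have s: "sums_L2 \<mu> h (\<lambda>x. \<Sum>n\<le>M. h n x)" if h: "\<And>n x. M < n \<Longrightarrow> h n x = 0" for h :: "nat \<Rightarrow> _ \<Rightarrow> complex"
  proof -
    have "norm_L2 \<mu> (\<lambda>x. (\<Sum>n\<le>M. h n x) - (\<Sum>n<N. h n x)) = 0" if N: "N > M" for N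
    proof -
      have "(\<Sum>n<N. h n x) = (\<Sum>n\<le>M. h n x)" for x
        using N h by (intro sum.mono_neutral_right) auto
      then show ?thesis by (simp add: norm_L2_zero)
    qed
    then show ?thesis unfolding sums_L2_def
      by (intro tendsto_eventually) (auto intro: eventually_mono[OF eventually_gt_at_top[of M]])
  qed
  have sq: "(\<lambda>x. \<Sum>n\<le>M. e n x) \<in> sq_integrable \<mu>" "(\<lambda>x. \<Sum>n\<le>M. of_nat n * e n x) \<in> sq_integrable \<mu>"
    using C_fin_sq_integrable[OF eigen_in[OF e]] C_fin_sq_integrable[OF eigen_in[OF eigen_scale[OF e]]]
    by (auto intro!: sq_integrable_sum)
  have sm: "summable (\<lambda>n. (real n * norm_L2 \<mu> (e n))\<^sup>2)"
    by (rule summable_finite[of "{..M}"]) (auto simp: z norm_L2_zero not_le)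
  have "sums_L2 \<mu> e (\<lambda>x. \<Sum>n\<le>M. e n x)" "sums_L2 \<mu> (\<lambda>n x. of_nat n * e n x) (\<lambda>x. \<Sum>n\<le>M. of_nat n * e n x)"
    using s[of e] s[of "\<lambda>n x. of_nat n * e n x"] z by auto
  then show ?thesis unfolding graph_D_def using sq sm e by blast
qed

text \<open>
  The commutator maps the constant $1$ to $Df$, and the sum below is $\|Df\|^2$.
\<close>

lemma components_bounded_by_commutator:
  assumes f: "f \<in> C_fin X M" and c: "commutator_norm X \<mu> f \<le> 1"
  shows "(\<Sum>n\<le>M. (real n)\<^sup>2 * (norm_L2 \<mu> (component f n))\<^sup>2) \<le> 1"
proof -
  let ?e = "component f"
  \<comment> \<open>the expansion of the constant $1$, which lies in the kernel of $D$\<close>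
  define v where "v n = (if n = 0 then indicator X else (\<lambda>x. 0 :: complex))" for n :: nat
  have v: "v n \<in> eigenspace_D X \<mu> n" for n
    by (auto simp: v_def eigenspace_D_def C_fin_indicator C_fin_zero inner_L2_def)
  have "((\<lambda>x. \<Sum>n\<le>0. v n x), (\<lambda>x. \<Sum>n\<le>0. of_nat n * v n x)) \<in> graph_D X \<mu>"
    using v by (rule graph_D_finite) (simp add: v_def)
  then have one: "(indicator X, (\<lambda>x. 0)) \<in> graph_D X \<mu>" by (simp add: v_def)
  have fX: "(\<lambda>x. f x * indicator X x) = f"
  proof
    fix x
    show "f x * indicator X x = f x" using C_fin_outside[OF f, of x] by (cases "x \<in> X") auto
  qed
  have "(\<lambda>x. \<Sum>n\<le>M. ?e n x) = f" by (simp add: component_sum cond_exp_id[OF f])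
  then have g: "((\<lambda>x. f x * indicator X x), (\<lambda>x. \<Sum>n\<le>M. of_nat n * ?e n x)) \<in> graph_D X \<mu>"
    unfolding fX using graph_D_finite[of ?e M, OF component_eigen[OF f] component_zero[OF f]] by simp
  have n1: "norm_L2 \<mu> (indicator X) \<le> 1"
  proof -
    have "(\<integral>x. (cmod (indicator X x))\<^sup>2 \<partial>\<mu>) = (\<integral>x. 1 \<partial>\<mu>)"
      by (intro Bochner_Integration.integral_cong) (auto simp: space_mu)
    then show ?thesis by (simp add: norm_L2_def prob_space)
  qed
  have "ennreal (norm_L2 \<mu> (\<lambda>x. (\<Sum>n\<le>M. of_nat n * ?e n x) - f x * 0)) \<le> commutator_norm X \<mu> f"
    unfolding commutator_norm_def
    by (rule Sup_upper, rule CollectI, rule exI[of _ "indicator X"], rule exI[of _ "\<lambda>x. 0"],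
        rule exI[of _ "\<lambda>x. \<Sum>n\<le>M. of_nat n * ?e n x"], intro conjI refl one g n1)
  from order_trans[OF this c] have "norm_L2 \<mu> (\<lambda>x. \<Sum>n\<le>M. of_nat n * ?e n x) \<le> 1"
    by simp
  then have "(norm_L2 \<mu> (\<lambda>x. \<Sum>n\<le>M. of_nat n * ?e n x))\<^sup>2 \<le> 1"
    by (intro power_le_one norm_L2_nonneg)
  then show ?thesis
    by (subst (asm) eigen_pythagoras) (auto simp: norm_L2_scale power_mult_distrib intro!: eigen_scale component_eigen[OF f])
qed

text \<open>
  The components between $2^k$ and $2^{k+1}$ together have norm at most $2^{-k}$ and belong to
  $C_{2^{k+1}-1}$, whose cells have measure at least $c\,2^{-(k+1)\tau}$.
\<close>

lemma dyadic_block_bound: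
  assumes c: "c > 0" "\<And>n x. x \<in> X \<Longrightarrow> c / real (Suc n) powr \<tau> \<le> measure \<mu> (cell X n x)"
    and f: "f \<in> C_fin X M" "commutator_norm X \<mu> f \<le> 1" and x: "x \<in> X"
  shows "cmod (cond_exp (2 ^ Suc k - 1) f x - cond_exp (2 ^ k - 1) f x)
    \<le> 2 powr (\<tau> / 2) / sqrt c * (2 powr (\<tau> / 2 - 1)) ^ k"
proof -
  define I where "I = {2 ^ k..<2 ^ Suc k :: nat}"
  define g where "g = (\<lambda>x. \<Sum>n\<in>I. component f n x)"
  note e = component_eigen[OF f(1)]
  have g_eq: "g x = cond_exp (2 ^ Suc k - 1) f x - cond_exp (2 ^ k - 1) f x"
    unfolding g_def I_def by (rule component_sum_block) auto
  have gC: "g \<in> C_fin X (2 ^ Suc k - 1)"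
    unfolding g_def by (rule C_fin_sum, rule C_fin_mono[OF _ eigen_in[OF e]]) (auto simp: I_def)
  have "(norm_L2 \<mu> g)\<^sup>2 * (2 ^ k)\<^sup>2 \<le> 1"
  proof -
    have "(norm_L2 \<mu> g)\<^sup>2 * (2 ^ k)\<^sup>2 = (\<Sum>n\<in>I. (2 ^ k)\<^sup>2 * (norm_L2 \<mu> (component f n))\<^sup>2)"
      unfolding g_def by (subst eigen_pythagoras) (auto simp: I_def e sum_distrib_left mult.commute)
    also have "\<dots> \<le> (\<Sum>n\<in>I. (real n)\<^sup>2 * (norm_L2 \<mu> (component f n))\<^sup>2)"
    proof (rule sum_mono)
      fix n assume "n \<in> I"
      then have "real (2 ^ k) \<le> real n" unfolding I_def by (simp only: of_nat_le_iff) simp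
      then show "(2 ^ k)\<^sup>2 * (norm_L2 \<mu> (component f n))\<^sup>2 \<le> (real n)\<^sup>2 * (norm_L2 \<mu> (component f n))\<^sup>2"
        by (intro mult_right_mono power_mono) auto
    qed
    also have "\<dots> \<le> (\<Sum>n\<le>max M (2 ^ Suc k). (real n)\<^sup>2 * (norm_L2 \<mu> (component f n))\<^sup>2)"
      by (rule sum_mono2) (auto simp: I_def)
    also have "\<dots> \<le> 1"
      using components_bounded_by_commutator[OF C_fin_mono[OF _ f(1)] f(2)] by simp
    finally show ?thesis .
  qed
  moreover have "(cmod (g x))\<^sup>2 * (c / (2 ^ Suc k) powr \<tau>) \<le> (norm_L2 \<mu> g)\<^sup>2"
  proof -
    have "c / (2 ^ Suc k) powr \<tau> \<le> measure \<mu> (cell X (2 ^ Suc k - 1) x)"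
      using c(2)[OF x, of "2 ^ Suc k - 1"] by (simp add: of_nat_diff)
    then have "(cmod (g x))\<^sup>2 * (c / (2 ^ Suc k) powr \<tau>) \<le> (cmod (g x))\<^sup>2 * measure \<mu> (cell X (2 ^ Suc k - 1) x)"
      by (intro mult_left_mono) auto
    also have "\<dots> \<le> (norm_L2 \<mu> g)\<^sup>2" by (rule pointwise_bound[OF gC x])
    finally show ?thesis .
  qed
  then have "(cmod (g x))\<^sup>2 * (c / (2 ^ Suc k) powr \<tau>) * (2 ^ k)\<^sup>2 \<le> (norm_L2 \<mu> g)\<^sup>2 * (2 ^ k)\<^sup>2"
    by (rule mult_right_mono) simp
  ultimately have "(cmod (g x))\<^sup>2 * (c / (2 ^ Suc k) powr \<tau>) * (2 ^ k)\<^sup>2 \<le> 1"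
    by (rule order_trans[rotated])
  then have "(cmod (g x))\<^sup>2 \<le> (2 ^ Suc k) powr \<tau> / (c * (2 ^ k)\<^sup>2)"
    using c(1) by (simp add: field_simps)
  also have "\<dots> = (2 powr (\<tau> / 2) / sqrt c * (2 powr (\<tau> / 2 - 1)) ^ k)\<^sup>2"
  proof -
    have p: "(2::real) ^ n = 2 powr real n" for n by (simp add: powr_realpow)
    have "(2 ^ Suc k) powr \<tau> / (2 ^ k)\<^sup>2 = 2 powr (real (Suc k) * \<tau> - 2 * real k)"
      unfolding p power2_eq_square by (simp add: powr_powr powr_diff powr_add[symmetric])
    moreover have "(2 powr (\<tau> / 2) * (2 powr (\<tau> / 2 - 1)) ^ k)\<^sup>2 = 2 powr (real (Suc k) * \<tau> - 2 * real k)"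
      unfolding power2_eq_square
      by (simp add: powr_powr powr_add[symmetric] powr_realpow[symmetric] algebra_simps)
    moreover have "(2 powr (\<tau> / 2) / sqrt c * (2 powr (\<tau> / 2 - 1)) ^ k)\<^sup>2
        = (2 powr (\<tau> / 2) * (2 powr (\<tau> / 2 - 1)) ^ k)\<^sup>2 / c"
      using c(1) by (simp add: power_divide)
    ultimately show ?thesis using c(1) by (simp add: field_simps)
  qed
  finally have "cmod (g x) \<le> 2 powr (\<tau> / 2) / sqrt c * (2 powr (\<tau> / 2 - 1)) ^ k"
    by (rule power2_le_imp_le) (use c(1) in auto)
  then show ?thesis unfolding g_eq .
qed

text \<open>
  Summing the block bounds as a geometric series; the ratio $2^{\tau/2-1}$ is less than 1 exactly because
  $\tau < 2$. The error bound $\varepsilon_0$ compares \<open>f\<close> with its mean, since $C_0$ consists of the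
  constants.
\<close>

lemma admissible_tail:
  assumes c: "c > 0" "\<tau> < 2" "\<And>n x. x \<in> X \<Longrightarrow> c / real (Suc n) powr \<tau> \<le> measure \<mu> (cell X n x)"
  obtains \<epsilon> :: "nat \<Rightarrow> real" where "\<epsilon> \<longlonglongrightarrow> 0" "\<And>k. 0 \<le> \<epsilon> k"
    "\<And>f k x. f \<in> C_inf X \<Longrightarrow> commutator_norm X \<mu> f \<le> 1 \<Longrightarrow> x \<in> X \<Longrightarrow>
      cmod (f x - cond_exp (2 ^ k - 1) f x) \<le> \<epsilon> k"
proof -
  define D where "D = 2 powr (\<tau> / 2) / sqrt c"
  define \<rho> where "\<rho> = 2 powr (\<tau> / 2 - 1)"
  have "(2::real) powr (\<tau> / 2 - 1) < 2 powr 0" using c(2) by (intro powr_less_mono) auto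
  then have \<rho>: "0 < \<rho>" "\<rho> < 1" by (auto simp: \<rho>_def)
  have D: "D \<ge> 0" using c(1) by (simp add: D_def)
  show ?thesis
  proof (rule that)
    have "(\<lambda>k. D * \<rho> ^ k / (1 - \<rho>)) \<longlonglongrightarrow> D * 0 / (1 - \<rho>)"
      using \<rho> by (intro tendsto_intros LIMSEQ_realpow_zero) auto
    then show "(\<lambda>k. D * \<rho> ^ k / (1 - \<rho>)) \<longlonglongrightarrow> 0" by simp
    show "0 \<le> D * \<rho> ^ k / (1 - \<rho>)" for k using D \<rho> by simp
    fix f k x assume f: "f \<in> C_inf X" "commutator_norm X \<mu> f \<le> 1" and x: "x \<in> X"
    from f(1) obtain M where fM: "f \<in> C_fin X M" by (auto simp: C_inf_def)
    let ?P = "\<lambda>k. cond_exp (2 ^ k - 1) f x"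
    have "cmod (?P (k + i) - ?P k) \<le> D * \<rho> ^ k * ((1 - \<rho> ^ i) / (1 - \<rho>))" for i
    proof (induction i)
      case (Suc i)
      have "cmod (?P (k + Suc i) - ?P k) = cmod ((?P (Suc (k + i)) - ?P (k + i)) + (?P (k + i) - ?P k))"
        by simp
      also have "\<dots> \<le> cmod (?P (Suc (k + i)) - ?P (k + i)) + cmod (?P (k + i) - ?P k)"
        by (rule norm_triangle_ineq)
      also have "cmod (?P (Suc (k + i)) - ?P (k + i)) \<le> D * \<rho> ^ (k + i)"
        unfolding D_def \<rho>_def by (rule dyadic_block_bound[OF c(1,3) fM f(2) x])
      also note Suc
      also have "D * \<rho> ^ (k + i) + D * \<rho> ^ k * ((1 - \<rho> ^ i) / (1 - \<rho>)) = D * \<rho> ^ k * ((1 - \<rho> ^ Suc i) / (1 - \<rho>))"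
        using \<rho> by (simp add: field_simps power_add)
      finally show ?case by simp
    qed simp
    from this[of M] have "cmod (?P (k + M) - ?P k) \<le> D * \<rho> ^ k * ((1 - \<rho> ^ M) / (1 - \<rho>))" .
    also have "\<dots> \<le> D * \<rho> ^ k * (1 / (1 - \<rho>))"
      using D \<rho> by (intro mult_left_mono divide_right_mono) auto
    also have "?P (k + M) = f x"
    proof -
      have "M < 2 ^ M" by (rule less_exp)
      also have "(2::nat) ^ M \<le> 2 ^ (k + M)" by (intro power_increasing) auto
      finally show ?thesis using cond_exp_id[OF C_fin_mono[OF _ fM]] by simp
    qed
    finally show "cmod (f x - ?P k) \<le> D * \<rho> ^ k / (1 - \<rho>)" by simp
  qed
qed

lemma weighted_sum_bound:
  assumes "\<And>n. e n \<in> eigenspace_D X \<mu> n"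
  shows "norm_L2 \<mu> (\<lambda>x. \<Sum>n\<le>m. of_nat n * e n x) \<le> real m * norm_L2 \<mu> (\<lambda>x. \<Sum>n\<le>m. e n x)"
proof (rule power2_le_imp_le)
  have "(norm_L2 \<mu> (\<lambda>x. \<Sum>n\<le>m. of_nat n * e n x))\<^sup>2 = (\<Sum>n\<le>m. (real n)\<^sup>2 * (norm_L2 \<mu> (e n))\<^sup>2)"
    by (subst eigen_pythagoras) (auto simp: norm_L2_scale power_mult_distrib intro!: eigen_scale assms)
  also have "\<dots> \<le> (\<Sum>n\<le>m. (real m)\<^sup>2 * (norm_L2 \<mu> (e n))\<^sup>2)"
    by (intro sum_mono mult_right_mono power_mono) auto
  also have "\<dots> = (real m * norm_L2 \<mu> (\<lambda>x. \<Sum>n\<le>m. e n x))\<^sup>2"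
    by (subst power_mult_distrib, subst eigen_pythagoras) (auto simp: assms sum_distrib_left)
  finally show "(norm_L2 \<mu> (\<lambda>x. \<Sum>n\<le>m. of_nat n * e n x))\<^sup>2 \<le> (real m * norm_L2 \<mu> (\<lambda>x. \<Sum>n\<le>m. e n x))\<^sup>2" .
qed (simp add: norm_L2_nonneg)

text \<open>
  The terms of index at most \<open>m\<close> are kept together in \<open>l\<close>, because multiplication by an element
  of $C_m$ mixes the eigenspaces up to level \<open>m\<close>.
\<close>

lemma low_and_eigen_pythagoras:
  assumes l: "l \<in> C_fin X m" and h: "\<And>n. m < n \<Longrightarrow> h n \<in> eigenspace_D X \<mu> n" and "m < M"
  shows "(norm_L2 \<mu> (\<lambda>x. l x + (\<Sum>n\<in>{m<..<M}. h n x)))\<^sup>2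
    = (norm_L2 \<mu> l)\<^sup>2 + (\<Sum>n\<in>{m<..<M}. (norm_L2 \<mu> (h n))\<^sup>2)"
proof -
  define F where "F n = (if n = m then l else h n)" for n
  have I: "{m..<M} = insert m {m<..<M}" using \<open>m < M\<close> by auto
  have s: "(\<Sum>n\<in>{m..<M}. G (F n)) = G l + (\<Sum>n\<in>{m<..<M}. G (h n))" for G :: "_ \<Rightarrow> 'z::comm_monoid_add"
  proof -
    have "(\<Sum>n\<in>{m<..<M}. G (F n)) = (\<Sum>n\<in>{m<..<M}. G (h n))"
      by (rule sum.cong) (auto simp: F_def)
    then show ?thesis unfolding I by (simp add: F_def)
  qed
  have FC: "F n \<in> C_fin X n" if "n \<in> {m..<M}" for n
    using that l h eigen_in by (auto simp: F_def)
  have FE: "F n \<in> eigenspace_D X \<mu> n" if "m < n" for n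
    using that h by (auto simp: F_def)
  have "(norm_L2 \<mu> (\<lambda>x. \<Sum>n\<in>{m..<M}. F n x))\<^sup>2 = (\<Sum>n\<in>{m..<M}. (norm_L2 \<mu> (F n))\<^sup>2)"
  proof (rule pythagoras)
    fix i j assume ij: "i \<in> {m..<M}" "j \<in> {m..<M}" "i \<noteq> j"
    then consider "i < j" | "j < i" by linarith
    then show "inner_L2 \<mu> (F i) (F j) = 0"
    proof cases
      case 1
      then show ?thesis using eigen_orthogonal(2)[OF FE FC] ij by auto
    next
      case 2
      then show ?thesis using eigen_orthogonal(1)[OF FE FC] ij by auto
    qed
  qed (auto intro: FC)
  then show ?thesis using s[of "\<lambda>G. G _"] s[of "\<lambda>G. (norm_L2 \<mu> G)\<^sup>2"] by simp
qed

lemma graph_D_E: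
  assumes "(\<xi>, \<eta>) \<in> graph_D X \<mu>"
  obtains e where "\<xi> \<in> sq_integrable \<mu>" "\<eta> \<in> sq_integrable \<mu>" "\<And>n. e n \<in> eigenspace_D X \<mu> n"
    "(\<lambda>N. norm_L2 \<mu> (\<lambda>x. \<xi> x - (\<Sum>n<N. e n x))) \<longlonglongrightarrow> 0"
    "(\<lambda>N. norm_L2 \<mu> (\<lambda>x. \<eta> x - (\<Sum>n<N. of_nat n * e n x))) \<longlonglongrightarrow> 0"
  using assms unfolding graph_D_def sums_L2_def by auto

text \<open>
  Multiplication by \<open>g\<close> maps $C_m$ to itself and commutes with $D$ on the orthogonal complement of
  $C_m$, so the commutator only sees the projection of $\xi$ to $C_m$. There $D$ has norm at most \<open>m\<close>,
  and both $D g$ and $g D$ have norm at most $m G$. As elements of the domain of $D$ are given by expansions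
  converging in $L^2$, it first has to be shown that the expansion of $g \xi$ is determined up to null
  functions.
\<close>

lemma commutator_norm_le:
  assumes g: "g \<in> C_fin X m" "\<And>x. cmod (g x) \<le> G"
  shows "commutator_norm X \<mu> g \<le> ennreal (2 * real m * G)"
  unfolding commutator_norm_def
proof (rule Sup_least, clarify)
  fix \<xi> \<eta> \<zeta>
  assume gr: "(\<xi>, \<eta>) \<in> graph_D X \<mu>" "(\<lambda>x. g x * \<xi> x, \<zeta>) \<in> graph_D X \<mu>" and \<xi>1: "norm_L2 \<mu> \<xi> \<le> 1"
  have G: "0 \<le> G" using g(2) norm_ge_zero order_trans by blast
  note gm = C_fin_measurable[OF g(1)]
  let ?N = "norm_L2 \<mu>"
  obtain e where e: "\<xi> \<in> sq_integrable \<mu>" "\<eta> \<in> sq_integrable \<mu>" "\<And>n. e n \<in> eigenspace_D X \<mu> n"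
    "(\<lambda>M. ?N (\<lambda>x. \<xi> x - (\<Sum>n<M. e n x))) \<longlonglongrightarrow> 0"
    "(\<lambda>M. ?N (\<lambda>x. \<eta> x - (\<Sum>n<M. of_nat n * e n x))) \<longlonglongrightarrow> 0"
    by (rule graph_D_E[OF gr(1)]) (rule that, assumption+)
  obtain e' where e': "(\<lambda>x. g x * \<xi> x) \<in> sq_integrable \<mu>" "\<zeta> \<in> sq_integrable \<mu>" "\<And>n. e' n \<in> eigenspace_D X \<mu> n"
    "(\<lambda>M. ?N (\<lambda>x. g x * \<xi> x - (\<Sum>n<M. e' n x))) \<longlonglongrightarrow> 0"
    "(\<lambda>M. ?N (\<lambda>x. \<zeta> x - (\<Sum>n<M. of_nat n * e' n x))) \<longlonglongrightarrow> 0"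
    by (rule graph_D_E[OF gr(2)]) (rule that, assumption+)
  define h where "h n x = e' n x - g x * e n x" for n x
  define h0 where "h0 x = (\<Sum>n\<le>m. h n x)" for x
  have hE: "h n \<in> eigenspace_D X \<mu> n" if "m < n" for n
    using eigen_diff[OF e'(3) eigen_mult[OF g(1) e(3) that]] by (simp add: h_def[abs_def])
  have hC: "h n \<in> C_fin X m" if "n \<le> m" for n
    unfolding h_def[abs_def]
    using C_fin_diff[OF C_fin_mono[OF that eigen_in[OF e'(3)]] C_fin_mult[OF g(1) C_fin_mono[OF that eigen_in[OF e(3)]]]] .
  have h0C: "h0 \<in> C_fin X m" unfolding h0_def[abs_def] by (rule C_fin_sum) (use hC in auto)
  have eC: "(\<lambda>x. \<Sum>n\<in>I. e n x) \<in> sq_integrable \<mu>" "(\<lambda>x. \<Sum>n\<in>I. of_nat n * e n x) \<in> sq_integrable \<mu>"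
    if "finite I" for I
    using that C_fin_sq_integrable[OF eigen_in[OF e(3)]] C_fin_sq_integrable[OF eigen_in[OF eigen_scale[OF e(3)]]]
    by (auto intro!: sq_integrable_sum)
  have eC': "(\<lambda>x. \<Sum>n\<in>I. e' n x) \<in> sq_integrable \<mu>" "(\<lambda>x. \<Sum>n\<in>I. of_nat n * e' n x) \<in> sq_integrable \<mu>"
    if "finite I" for I
    using that C_fin_sq_integrable[OF eigen_in[OF e'(3)]] C_fin_sq_integrable[OF eigen_in[OF eigen_scale[OF e'(3)]]]
    by (auto intro!: sq_integrable_sum)
  have split: "(\<Sum>n<M. k n) = (\<Sum>n\<le>m. k n) + (\<Sum>n\<in>{m<..<M}. k n)" if "m < M" for M and k :: "nat \<Rightarrow> complex"
  proof -
    have "{..<M} = {..m} \<union> {m<..<M}" using that by auto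
    then show ?thesis by (simp add: sum.union_disjoint disjoint_iff)
  qed
  \<comment> \<open>beyond level \<open>m\<close> the components of $g\xi$ are those of $\xi$ multiplied by \<open>g\<close>, up to null functions\<close>
  define r where "r M = ?N (\<lambda>x. g x * \<xi> x - (\<Sum>n<M. e' n x)) + G * ?N (\<lambda>x. \<xi> x - (\<Sum>n<M. e n x))" for M
  have r0: "r \<longlonglongrightarrow> 0"
    unfolding r_def[abs_def] using tendsto_add[OF e'(4) tendsto_mult_left[OF e(4), of G]] by simp
  have H: "(?N h0)\<^sup>2 + (\<Sum>n\<in>{m<..<M}. (?N (h n))\<^sup>2) \<le> (r M)\<^sup>2" if M: "m < M" for M
  proof -
    have eq: "(\<lambda>x. h0 x + (\<Sum>n\<in>{m<..<M}. h n x))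
        = (\<lambda>x. g x * (\<xi> x - (\<Sum>n<M. e n x)) - (g x * \<xi> x - (\<Sum>n<M. e' n x)))"
      unfolding h0_def split[OF M, symmetric] h_def
      by (simp add: sum_subtractf sum_distrib_left algebra_simps)
    have sq: "(\<lambda>x. \<xi> x - (\<Sum>n<M. e n x)) \<in> sq_integrable \<mu>"
      by (rule sq_integrable_diff[OF e(1) eC(1)]) simp
    have "?N (\<lambda>x. h0 x + (\<Sum>n\<in>{m<..<M}. h n x))
        \<le> ?N (\<lambda>x. g x * (\<xi> x - (\<Sum>n<M. e n x))) + ?N (\<lambda>x. g x * \<xi> x - (\<Sum>n<M. e' n x))"
      unfolding eq
      by (rule norm_L2_triangle_diff[OF sq_integrable_mult[OF sq gm g(2)] sq_integrable_diff[OF e'(1) eC'(1)]]) simp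
    also have "\<dots> \<le> r M"
      using norm_L2_mult_le[OF sq gm g(2) G] by (simp add: r_def)
    finally have "(?N (\<lambda>x. h0 x + (\<Sum>n\<in>{m<..<M}. h n x)))\<^sup>2 \<le> (r M)\<^sup>2"
      using norm_L2_nonneg by (intro power_mono) auto
    then show ?thesis using low_and_eigen_pythagoras[OF h0C hE M] by simp
  qed
  have r2: "(\<lambda>M. (r M)\<^sup>2) \<longlonglongrightarrow> 0" using tendsto_power[OF r0, of 2] by simp
  have zero: "u = 0" if "\<And>M. N0 < M \<Longrightarrow> u\<^sup>2 \<le> (r M)\<^sup>2" for u :: real and N0 :: nat
  proof -
    have "u\<^sup>2 \<le> 0"
      by (rule LIMSEQ_le_const[OF r2]) (use that in \<open>auto intro!: exI[of _ "Suc N0"]\<close>)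
    then show ?thesis by simp
  qed
  have h0z: "?N h0 = 0"
  proof (rule zero)
    fix M assume "m < M"
    from H[OF this] show "(?N h0)\<^sup>2 \<le> (r M)\<^sup>2"
      using sum_nonneg[of "{m<..<M}" "\<lambda>n. (?N (h n))\<^sup>2"] by simp
  qed
  have hz: "?N (h n) = 0" if n: "m < n" for n
  proof (rule zero)
    fix M assume M: "n < M"
    have "(?N (h n))\<^sup>2 \<le> (\<Sum>n\<in>{m<..<M}. (?N (h n))\<^sup>2)"
      using n M by (intro member_le_sum) auto
    then show "(?N (h n))\<^sup>2 \<le> (r M)\<^sup>2" using H[OF less_trans[OF n M]] zero_le_power2[of "?N h0"] by linarith
  qed
  \<comment> \<open>hence only the components up to \<open>m\<close> contribute to the commutator\<close>
  define S where "S x = (\<Sum>n\<le>m. e n x)" for x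
  define T0 where "T0 x = (\<Sum>n\<le>m. of_nat n * h n x)" for x
  have S1: "?N S \<le> 1"
  proof -
    have "?N S \<le> ?N \<xi> + ?N (\<lambda>x. \<xi> x - (\<Sum>n<M. e n x))" if M: "m < M" for M
    proof -
      have "(?N S)\<^sup>2 \<le> (\<Sum>n<M. (?N (e n))\<^sup>2)"
        unfolding S_def[abs_def] using M
        by (subst eigen_pythagoras) (auto intro!: sum_mono2 e(3))
      also have "\<dots> = (?N (\<lambda>x. \<Sum>n<M. e n x))\<^sup>2"
        by (subst eigen_pythagoras) (auto intro: e(3))
      finally have "?N S \<le> ?N (\<lambda>x. \<Sum>n<M. e n x)"
        using norm_L2_nonneg by (rule power2_le_imp_le)
      also have "\<dots> = ?N (\<lambda>x. \<xi> x - (\<xi> x - (\<Sum>n<M. e n x)))" by simp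
      also have "\<dots> \<le> ?N \<xi> + ?N (\<lambda>x. \<xi> x - (\<Sum>n<M. e n x))"
        by (rule norm_L2_triangle_diff[OF e(1) sq_integrable_diff[OF e(1) eC(1)]]) simp
      finally show ?thesis .
    qed
    then have "?N S \<le> ?N \<xi> + 0"
      by (intro LIMSEQ_le_const[OF tendsto_add[OF tendsto_const e(4)]]) (auto intro!: exI[of _ "Suc m"])
    then show ?thesis using \<xi>1 by simp
  qed
  have Ssq: "S \<in> sq_integrable \<mu>" unfolding S_def[abs_def] by (rule eC(1)) simp
  have gS: "?N (\<lambda>x. g x * S x) \<le> G"
    using norm_L2_mult_le[OF Ssq gm g(2) G] S1 G mult_left_mono[OF S1 G] by simp
  have T0: "?N T0 \<le> 2 * real m * G"
  proof -
    have "T0 = (\<lambda>x. (\<Sum>n\<le>m. of_nat n * e' n x) - g x * (\<Sum>n\<le>m. of_nat n * e n x))"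
      by (simp add: fun_eq_iff T0_def h_def sum_subtractf sum_distrib_left algebra_simps)
    then have "?N T0 \<le> ?N (\<lambda>x. \<Sum>n\<le>m. of_nat n * e' n x) + ?N (\<lambda>x. g x * (\<Sum>n\<le>m. of_nat n * e n x))"
      using norm_L2_triangle_diff[OF eC'(2) sq_integrable_mult[OF eC(2) gm g(2)]] by simp
    also have "?N (\<lambda>x. g x * (\<Sum>n\<le>m. of_nat n * e n x)) \<le> G * ?N (\<lambda>x. \<Sum>n\<le>m. of_nat n * e n x)"
      by (rule norm_L2_mult_le[OF eC(2) gm g(2) G]) simp
    also have "?N (\<lambda>x. \<Sum>n\<le>m. of_nat n * e n x) \<le> real m * ?N S"
      unfolding S_def[abs_def] by (rule weighted_sum_bound[OF e(3)])
    also have "real m * ?N S \<le> real m" using S1 by (simp add: mult_left_le)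
    also have "?N (\<lambda>x. \<Sum>n\<le>m. of_nat n * e' n x) \<le> real m * ?N (\<lambda>x. \<Sum>n\<le>m. e' n x)"
      by (rule weighted_sum_bound[OF e'(3)])
    also have "?N (\<lambda>x. \<Sum>n\<le>m. e' n x) \<le> G"
    proof -
      have "(\<lambda>x. \<Sum>n\<le>m. e' n x) = (\<lambda>x. h0 x + g x * S x)"
        by (simp add: fun_eq_iff h0_def S_def h_def sum_subtractf sum_distrib_left)
      then show ?thesis
        using norm_L2_triangle[OF C_fin_sq_integrable[OF h0C] sq_integrable_mult[OF Ssq gm g(2)]] h0z gS by simp
    qed
    finally have "?N T0 \<le> real m * G + G * real m" using G by (simp add: mult_left_mono)
    then show ?thesis by (simp add: mult_ac)
  qed
  define q where "q M = ?N (\<lambda>x. \<zeta> x - (\<Sum>n<M. of_nat n * e' n x)) + G * ?N (\<lambda>x. \<eta> x - (\<Sum>n<M. of_nat n * e n x))" for M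
  have q0: "q \<longlonglongrightarrow> 0"
    unfolding q_def[abs_def] using tendsto_add[OF e'(5) tendsto_mult_left[OF e(5), of G]] by simp
  have "?N (\<lambda>x. \<zeta> x - g x * \<eta> x) \<le> q M + 2 * real m * G" if M: "m < M" for M
  proof -
    let ?A = "\<lambda>x. \<zeta> x - (\<Sum>n<M. of_nat n * e' n x)"
    let ?B = "\<lambda>x. \<eta> x - (\<Sum>n<M. of_nat n * e n x)"
    let ?R = "\<lambda>x. \<Sum>n\<in>{m<..<M}. of_nat n * h n x"
    have A: "?A \<in> sq_integrable \<mu>" by (rule sq_integrable_diff[OF e'(2) eC'(2)]) simp
    have B: "?B \<in> sq_integrable \<mu>" by (rule sq_integrable_diff[OF e(2) eC(2)]) simp
    note gB = sq_integrable_mult[OF B gm g(2)]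
    have hs: "(\<lambda>x. of_nat n * h n x) \<in> sq_integrable \<mu>" for n
    proof (cases "m < n")
      case True
      then show ?thesis using C_fin_sq_integrable[OF eigen_in[OF eigen_scale[OF hE]]] by blast
    next
      case False
      then show ?thesis using C_fin_sq_integrable[OF C_fin_scale[OF hC]] by simp
    qed
    have Rs: "?R \<in> sq_integrable \<mu>" by (rule sq_integrable_sum) (auto intro: hs)
    have Ts: "T0 \<in> sq_integrable \<mu>" unfolding T0_def[abs_def] by (rule sq_integrable_sum) (auto intro: hs)
    have R0: "?N ?R \<le> 0"
    proof -
      have "?N ?R \<le> (\<Sum>n\<in>{m<..<M}. ?N (\<lambda>x. of_nat n * h n x))" by (rule norm_L2_sum) (auto intro: hs)
      also have "\<dots> = 0" by (intro sum.neutral) (auto simp: norm_L2_scale hz)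
      finally show ?thesis .
    qed
    have "(\<lambda>x. \<zeta> x - g x * \<eta> x) = (\<lambda>x. (?A x - g x * ?B x) + (T0 x + ?R x))"
      unfolding T0_def split[OF M, symmetric] h_def
      by (simp add: fun_eq_iff sum_subtractf sum_distrib_left algebra_simps)
    then have "?N (\<lambda>x. \<zeta> x - g x * \<eta> x) \<le> ?N (\<lambda>x. ?A x - g x * ?B x) + ?N (\<lambda>x. T0 x + ?R x)"
      using norm_L2_triangle[OF sq_integrable_diff[OF A gB] sq_integrable_add[OF Ts Rs]] by simp
    also have "?N (\<lambda>x. ?A x - g x * ?B x) \<le> ?N ?A + ?N (\<lambda>x. g x * ?B x)"
      by (rule norm_L2_triangle_diff[OF A gB])
    also have "?N (\<lambda>x. g x * ?B x) \<le> G * ?N ?B"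
      by (rule norm_L2_mult_le[OF B gm g(2) G])
    also have "?N (\<lambda>x. T0 x + ?R x) \<le> ?N T0 + ?N ?R"
      by (rule norm_L2_triangle[OF Ts Rs])
    finally show ?thesis using R0 T0 by (simp add: q_def)
  qed
  then have "?N (\<lambda>x. \<zeta> x - g x * \<eta> x) \<le> 0 + 2 * real m * G"
    by (intro LIMSEQ_le_const[OF tendsto_add[OF q0 tendsto_const]]) (auto intro!: exI[of _ "Suc m"])
  then show "ennreal (?N (\<lambda>x. \<zeta> x - g x * \<eta> x)) \<le> ennreal (2 * real m * G)"
    by (simp add: ennreal_leI)
qed

end

section \<open>Continuous functions and states on a compact subshift\<close>

locale compact_measured_subshift = measured_subshift +
  assumes compact: "compact X"
begin

lemma X_nonempty: "X \<noteq> {}"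
  using not_empty by (simp add: space_mu)

lemma C_fin_cont: "f \<in> C_fin X n \<Longrightarrow> f \<in> C_cont X"
proof -
  assume f: "f \<in> C_fin X n"
  have "continuous_on X f"
    unfolding continuous_on_topological
  proof (intro ballI allI impI)
    fix x B assume x: "x \<in> X" and "open B" and fx: "f x \<in> B"
    have "f y \<in> B" if "y \<in> X" "agree n x y" for y
      using C_fin_agree[OF f x that] fx by simp
    then show "\<exists>A. open A \<and> x \<in> A \<and> (\<forall>y\<in>X. y \<in> A \<longrightarrow> f y \<in> B)"
      using open_agree[of n x] agree_refl[of n x] by (intro exI[of _ "{y. agree n x y}"]) auto
  qed
  then show ?thesis using C_fin_outside[OF f] by (simp add: C_cont_def)
qed

text \<open>
  Uniform continuity on the compact space \<open>X\<close>, in terms of windows instead of a metric.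
\<close>

lemma C_cont_uniform:
  assumes f: "f \<in> C_cont X" and \<epsilon>: "\<epsilon> > 0"
  shows "\<exists>n. \<forall>x\<in>X. \<forall>y\<in>X. agree n x y \<longrightarrow> cmod (f x - f y) < \<epsilon>"
proof (rule ccontr)
  assume "\<not> ?thesis"
  then have "\<forall>n. \<exists>x y. x \<in> X \<and> y \<in> X \<and> agree n x y \<and> \<epsilon> \<le> cmod (f x - f y)"
    by (metis not_less)
  then obtain xs ys where xy: "\<And>n. xs n \<in> X" "\<And>n. ys n \<in> X" "\<And>n. agree n (xs n) (ys n)"
    "\<And>n. \<epsilon> \<le> cmod (f (xs n) - f (ys n))"
    by metis
  obtain l r where l: "l \<in> X" and r: "strict_mono (r :: nat \<Rightarrow> nat)" "(xs \<circ> r) \<longlonglongrightarrow> l"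
    using compact_imp_seq_compact[OF compact] xy(1) unfolding seq_compact_def by metis
  have yl: "(ys \<circ> r) \<longlonglongrightarrow> l"
  proof (rule tendsto_fun_pointwise)
    fix i
    have "eventually (\<lambda>n. (xs \<circ> r) n i = l i) sequentially"
      by (rule eventually_eq_coordinate[OF r(2)])
    then have "eventually (\<lambda>n. (ys \<circ> r) n i = l i) sequentially"
      using eventually_ge_at_top[of "2 * nat \<bar>i\<bar> + 1"]
    proof eventually_elim
      case (elim n)
      then have "2 * nat \<bar>i\<bar> + 1 \<le> r n" using strict_mono_imp_increasing[OF r(1), of n] by simp
      then have "agree (2 * nat \<bar>i\<bar> + 1) (xs (r n)) (ys (r n))" using agree_mono[OF _ xy(3)] by blast
      then show ?case using in_window_eventually[of i] elim by (simp add: agree_def)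
    qed
    then show "(\<lambda>n. (ys \<circ> r) n i) \<longlonglongrightarrow> l i" by (rule tendsto_eventually)
  qed
  have c: "continuous_on X f" using f by (simp add: C_cont_def)
  have "(\<lambda>n. f ((xs \<circ> r) n)) \<longlonglongrightarrow> f l"
    by (rule continuous_on_tendsto_compose[OF c r(2) l]) (use xy(1) in simp)
  moreover have "(\<lambda>n. f ((ys \<circ> r) n)) \<longlonglongrightarrow> f l"
    by (rule continuous_on_tendsto_compose[OF c yl l]) (use xy(2) in simp)
  ultimately have "(\<lambda>n. cmod (f ((xs \<circ> r) n) - f ((ys \<circ> r) n))) \<longlonglongrightarrow> cmod (f l - f l)"
    by (intro tendsto_intros)
  then
  have "(\<lambda>n. cmod (f (xs (r n)) - f (ys (r n)))) \<longlonglongrightarrow> 0" by simp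
  then have "\<epsilon> \<le> 0" by (rule LIMSEQ_le_const) (use xy(4) in auto)
  then show False using \<epsilon> by simp
qed

lemma C_inf_dense:
  assumes f: "f \<in> C_cont X" and \<epsilon>: "\<epsilon> > 0"
  obtains n g where "g \<in> C_fin X n" "\<And>x. x \<in> X \<Longrightarrow> cmod (f x - g x) \<le> \<epsilon>"
proof -
  obtain n where n: "\<And>x y. x \<in> X \<Longrightarrow> y \<in> X \<Longrightarrow> agree n x y \<Longrightarrow> cmod (f x - f y) < \<epsilon>"
    using C_cont_uniform[OF f \<epsilon>] by blast
  define g where "g x = (if x \<in> X then f (SOME y. y \<in> cell X n x) else 0)" for x
  show ?thesis
  proof (rule that)
    show "g \<in> C_fin X n" unfolding C_fin_iff g_def using cell_eq[of n] by auto
    fix x assume x: "x \<in> X"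
    have "(SOME y. y \<in> cell X n x) \<in> cell X n x" by (rule someI[where P = "\<lambda>y. y \<in> cell X n x", OF in_cell[OF x]])
    then show "cmod (f x - g x) \<le> \<epsilon>"
      using n[OF x, of "SOME y. y \<in> cell X n x"] x by (simp add: g_def cell_def)
  qed
qed

lemma C_cont_add: "f \<in> C_cont X \<Longrightarrow> g \<in> C_cont X \<Longrightarrow> (\<lambda>x. f x + g x) \<in> C_cont X"
  by (auto simp: C_cont_def intro: continuous_intros)

lemma C_cont_scale: "f \<in> C_cont X \<Longrightarrow> (\<lambda>x. c * f x) \<in> C_cont X"
  by (auto simp: C_cont_def intro: continuous_intros)

lemma C_cont_indicator: "indicator X \<in> C_cont X"
  by (rule C_fin_cont[OF C_fin_indicator])

lemma state_add: "\<phi> \<in> states X \<Longrightarrow> f \<in> C_cont X \<Longrightarrow> g \<in> C_cont X \<Longrightarrow> \<phi> (\<lambda>x. f x + g x) = \<phi> f + \<phi> g"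
  by (simp add: states_def)

lemma state_scale: "\<phi> \<in> states X \<Longrightarrow> f \<in> C_cont X \<Longrightarrow> \<phi> (\<lambda>x. c * f x) = c * \<phi> f"
  by (simp add: states_def)

lemma state_pos: "\<phi> \<in> states X \<Longrightarrow> f \<in> C_cont X \<Longrightarrow> (\<And>x. x \<in> X \<Longrightarrow> f x \<in> \<real>\<^sub>\<ge>\<^sub>0) \<Longrightarrow> \<phi> f \<in> \<real>\<^sub>\<ge>\<^sub>0"
  by (simp add: states_def)

lemma state_const: "\<phi> \<in> states X \<Longrightarrow> \<phi> (\<lambda>x. c * indicator X x) = c"
  using state_scale[OF _ C_cont_indicator] by (simp add: states_def)

lemma state_diff:
  assumes "\<phi> \<in> states X" "f \<in> C_cont X" "g \<in> C_cont X"
  shows "\<phi> (\<lambda>x. f x - g x) = \<phi> f - \<phi> g"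
  using state_add[OF assms(1,2) C_cont_scale[OF assms(3), of "-1"]] state_scale[OF assms(1,3), of "-1"] by simp

lemma state_real_bound:
  assumes \<phi>: "\<phi> \<in> states X" and f: "f \<in> C_cont X" and b: "\<And>x. x \<in> X \<Longrightarrow> f x \<in> \<real> \<and> cmod (f x) \<le> B"
  shows "cmod (\<phi> f) \<le> B"
proof -
  let ?B = "\<lambda>x. complex_of_real B * indicator X x"
  have B: "?B \<in> C_cont X" by (rule C_cont_scale[OF C_cont_indicator])
  have m: "(\<lambda>x. - 1 * f x) \<in> C_cont X" by (rule C_cont_scale[OF f])
  have r: "\<bar>Re (f x)\<bar> \<le> B \<and> Im (f x) = 0" if "x \<in> X" for x
    using b[OF that] abs_Re_le_cmod[of "f x"] by (simp add: complex_is_Real_iff)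
  have "\<phi> (\<lambda>x. ?B x + f x) \<in> \<real>\<^sub>\<ge>\<^sub>0"
    by (rule state_pos[OF \<phi> C_cont_add[OF B f]]) (use r in \<open>fastforce simp: complex_nonneg_Reals_iff\<close>)
  then have 1: "0 \<le> B + Re (\<phi> f)" "Im (\<phi> f) = 0"
    unfolding state_add[OF \<phi> B f] state_const[OF \<phi>] by (simp_all add: complex_nonneg_Reals_iff)
  have "\<phi> (\<lambda>x. ?B x + - 1 * f x) \<in> \<real>\<^sub>\<ge>\<^sub>0"
    by (rule state_pos[OF \<phi> C_cont_add[OF B m]]) (use r in \<open>fastforce simp: complex_nonneg_Reals_iff\<close>)
  then have 2: "0 \<le> B - Re (\<phi> f)"
    unfolding state_add[OF \<phi> B m] state_const[OF \<phi>] state_scale[OF \<phi> f] by (simp add: complex_nonneg_Reals_iff)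
  show ?thesis using 1 2 by (simp add: cmod_eq_Re)
qed

text \<open>
  The constant 2 comes from treating real and imaginary part separately.
\<close>

lemma state_bound:
  assumes \<phi>: "\<phi> \<in> states X" and f: "f \<in> C_cont X" and b: "\<And>x. x \<in> X \<Longrightarrow> cmod (f x) \<le> B"
  shows "cmod (\<phi> f) \<le> 2 * B"
proof -
  let ?R = "\<lambda>x. complex_of_real (Re (f x))"
  let ?I = "\<lambda>x. complex_of_real (Im (f x))"
  have R: "?R \<in> C_cont X" and I: "?I \<in> C_cont X"
    using f by (auto simp: C_cont_def intro!: continuous_intros)
  have "f = (\<lambda>x. ?R x + \<i> * ?I x)" by (simp add: complex_eq fun_eq_iff)
  then have "\<phi> f = \<phi> (\<lambda>x. ?R x + \<i> * ?I x)" by (rule arg_cong)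
  also have "\<dots> = \<phi> ?R + \<i> * \<phi> ?I"
    by (simp add: state_add[OF \<phi> R C_cont_scale[OF I]] state_scale[OF \<phi> I])
  finally have "cmod (\<phi> f) \<le> cmod (\<phi> ?R) + cmod (\<phi> ?I)"
    by (simp add: norm_triangle_le norm_mult)
  also have "cmod (\<phi> ?R) \<le> B"
    by (rule state_real_bound[OF \<phi> R]) (use order_trans[OF abs_Re_le_cmod b] in auto)
  also have "cmod (\<phi> ?I) \<le> B"
    by (rule state_real_bound[OF \<phi> I]) (use order_trans[OF abs_Im_le_cmod b] in auto)
  finally show ?thesis by simp
qed

lemma state_sum:
  assumes \<phi>: "\<phi> \<in> states X" and "finite I" and "\<And>i. i \<in> I \<Longrightarrow> f i \<in> C_cont X"
  shows "\<phi> (\<lambda>x. \<Sum>i\<in>I. c i * f i x) = (\<Sum>i\<in>I. c i * \<phi> (f i)) \<and> (\<lambda>x. \<Sum>i\<in>I. c i * f i x) \<in> C_cont X"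
  using assms(2,3)
proof (induction rule: finite_induct)
  case empty
  show ?case using state_const[OF \<phi>, of 0] by (simp add: C_cont_def)
next
  case (insert i I)
  then have i: "(\<lambda>x. c i * f i x) \<in> C_cont X" "f i \<in> C_cont X" by (auto intro: C_cont_scale)
  from insert show ?case
    using state_add[OF \<phi> i(1), of "\<lambda>x. \<Sum>i\<in>I. c i * f i x"] C_cont_add[OF i(1), of "\<lambda>x. \<Sum>i\<in>I. c i * f i x"]
      state_scale[OF \<phi> i(2)] by simp
qed

lemma cyl_cont: "w \<in> words X n \<Longrightarrow> indicator (cyl X w) \<in> C_cont X"
  using C_fin_cont[OF C_fin_indicator_cell] by (auto simp: words_window cyl_window)

section \<open>The Connes metric under a lower bound for cylinder measures\<close>

text \<open>
  Split \<open>f\<close> into its distance from $P_n f$, the deviation of $P_n f$ from the mean of \<open>f\<close>, and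
  that mean. States have norm at most 2 on the first part, the second is a combination of cylinder functions
  with coefficients at most $\varepsilon + \varepsilon_0$, and the third is a constant, on which all states
  agree.
\<close>

lemma state_difference_bound:
  assumes \<phi>: "\<phi> \<in> states X" and \<psi>: "\<psi> \<in> states X" and f: "f \<in> C_inf X"
    and t: "\<And>x. x \<in> X \<Longrightarrow> cmod (f x - cond_exp n f x) \<le> \<epsilon>"
    and t0: "\<And>x. x \<in> X \<Longrightarrow> cmod (f x - cond_exp 0 f x) \<le> \<epsilon>0"
  shows "cmod (\<phi> f - \<psi> f) \<le> 4 * \<epsilon>
    + (\<epsilon> + \<epsilon>0) * (\<Sum>w\<in>words X n. cmod (\<phi> (indicator (cyl X w)) - \<psi> (indicator (cyl X w))))"
proof -
  have fc: "f \<in> C_cont X" using f C_fin_cont by (auto simp: C_inf_def)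
  obtain x0 where x0: "x0 \<in> X" using X_nonempty by blast
  define a where "a = cond_exp 0 f x0"
  have c0: "cond_exp 0 f x = a" if "x \<in> X" for x
    unfolding a_def by (rule C_fin_agree[OF cond_exp_in that x0]) (simp add: agree_def window_def)
  let ?P = "cond_exp n f"
  have Pc: "?P \<in> C_cont X" by (rule C_fin_cont[OF cond_exp_in])
  let ?a = "\<lambda>x. a * indicator X x"
  have ac: "?a \<in> C_cont X" by (rule C_cont_scale[OF C_cont_indicator])
  define u where "u = (\<lambda>x. ?P x - ?a x)"
  have uC: "u \<in> C_fin X n"
    unfolding u_def by (rule C_fin_diff[OF cond_exp_in C_fin_scale[OF C_fin_indicator]])
  then obtain c where u: "u = (\<lambda>x. \<Sum>w\<in>words X n. c w * indicator (cyl X w) x)"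
    by (auto simp: C_fin_def)
  have cw: "cmod (c w) \<le> \<epsilon> + \<epsilon>0" if "w \<in> words X n" for w
  proof -
    from that obtain x where x: "x \<in> X" "w = map x (window n)" by (auto simp: words_window)
    then have "c w = u x" unfolding u by (simp add: word_sum_value)
    also have "\<dots> = (f x - cond_exp 0 f x) - (f x - ?P x)" using x c0[of x] by (simp add: u_def)
    finally have "cmod (c w) \<le> cmod (f x - cond_exp 0 f x) + cmod (f x - ?P x)"
      by (metis norm_triangle_ineq4)
    then show ?thesis using t[OF x(1)] t0[OF x(1)] by simp
  qed
  have su: "\<omega> u = (\<Sum>w\<in>words X n. c w * \<omega> (indicator (cyl X w)))" if "\<omega> \<in> states X" for \<omega>
    unfolding u using state_sum[OF that finite_words[of n], of "\<lambda>w. indicator (cyl X w)" c] cyl_cont by blast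
  have dec: "\<omega> f = \<omega> (\<lambda>x. f x - ?P x) + (\<omega> u + a)" if "\<omega> \<in> states X" for \<omega>
    unfolding u_def state_diff[OF that fc Pc] state_diff[OF that Pc ac] state_const[OF that] by simp
  have b: "cmod (\<omega> (\<lambda>x. f x - ?P x)) \<le> 2 * \<epsilon>" if "\<omega> \<in> states X" for \<omega>
  proof (rule state_bound[OF that])
    show "(\<lambda>x. f x - ?P x) \<in> C_cont X"
      using C_cont_add[OF fc C_cont_scale[OF Pc, of "-1"]] by simp
  qed (rule t)
  have "\<phi> f - \<psi> f = (\<phi> (\<lambda>x. f x - ?P x) - \<psi> (\<lambda>x. f x - ?P x)) + (\<phi> u - \<psi> u)"
    unfolding dec[OF \<phi>] dec[OF \<psi>] by simp
  then have "cmod (\<phi> f - \<psi> f) \<le> (cmod (\<phi> (\<lambda>x. f x - ?P x)) + cmod (\<psi> (\<lambda>x. f x - ?P x))) + cmod (\<phi> u - \<psi> u)"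
    using norm_triangle_ineq4[of "\<phi> (\<lambda>x. f x - ?P x)" "\<psi> (\<lambda>x. f x - ?P x)"]
      norm_triangle_ineq[of "\<phi> (\<lambda>x. f x - ?P x) - \<psi> (\<lambda>x. f x - ?P x)" "\<phi> u - \<psi> u"] by simp
  moreover have "cmod (\<phi> u - \<psi> u)
      \<le> (\<epsilon> + \<epsilon>0) * (\<Sum>w\<in>words X n. cmod (\<phi> (indicator (cyl X w)) - \<psi> (indicator (cyl X w))))"
  proof -
    have "\<phi> u - \<psi> u = (\<Sum>w\<in>words X n. c w * (\<phi> (indicator (cyl X w)) - \<psi> (indicator (cyl X w))))"
      unfolding su[OF \<phi>] su[OF \<psi>] by (simp add: sum_subtractf right_diff_distrib)
    also have "cmod \<dots> \<le> (\<Sum>w\<in>words X n. (\<epsilon> + \<epsilon>0) * cmod (\<phi> (indicator (cyl X w)) - \<psi> (indicator (cyl X w))))"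
      by (rule sum_norm_le) (auto simp: norm_mult intro!: mult_right_mono cw)
    finally show ?thesis by (simp add: sum_distrib_left)
  qed
  ultimately show ?thesis using b[OF \<phi>] b[OF \<psi>] by linarith
qed

lemma connes_dist_triangle:
  "connes_dist X \<mu> \<phi> \<omega> \<le> connes_dist X \<mu> \<phi> \<psi> + connes_dist X \<mu> \<psi> \<omega>"
  unfolding connes_dist_def[of X \<mu> \<phi> \<omega>]
proof (rule SUP_least)
  fix f assume f: "f \<in> {f \<in> C_inf X. commutator_norm X \<mu> f \<le> 1}"
  have "cmod (\<phi> f - \<omega> f) \<le> cmod (\<phi> f - \<psi> f) + cmod (\<psi> f - \<omega> f)"
    using norm_triangle_ineq[of "\<phi> f - \<psi> f" "\<psi> f - \<omega> f"] by simp
  then have "ennreal (cmod (\<phi> f - \<omega> f)) \<le> ennreal (cmod (\<phi> f - \<psi> f)) + ennreal (cmod (\<psi> f - \<omega> f))"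
    by (simp add: ennreal_leI flip: ennreal_plus)
  also have "\<dots> \<le> connes_dist X \<mu> \<phi> \<psi> + connes_dist X \<mu> \<psi> \<omega>"
    unfolding connes_dist_def by (intro add_mono SUP_upper f)
  finally show "ennreal (cmod (\<phi> f - \<omega> f)) \<le> connes_dist X \<mu> \<phi> \<psi> + connes_dist X \<mu> \<psi> \<omega>" .
qed

lemma connes_dist_self: "connes_dist X \<mu> \<phi> \<phi> = 0"
proof -
  have "connes_dist X \<mu> \<phi> \<phi> \<le> 0" unfolding connes_dist_def by (rule SUP_least) simp
  then show ?thesis by simp
qed

definition connes_ball where
  "connes_ball \<phi> r = {\<psi> \<in> states X. connes_dist X \<mu> \<phi> \<psi> < ennreal r}"

lemma openin_connes_ball: "\<phi> \<in> states X \<Longrightarrow> 0 < r \<Longrightarrow> openin (connes_topology X \<mu>) (connes_ball \<phi> r)"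
  unfolding connes_topology_def connes_ball_def by (rule topology_generated_by_Basis) blast

lemma in_connes_ball: "\<phi> \<in> states X \<Longrightarrow> 0 < r \<Longrightarrow> \<phi> \<in> connes_ball \<phi> r"
  by (simp add: connes_ball_def connes_dist_self)

lemma topspace_connes: "topspace (connes_topology X \<mu>) = states X"
proof
  show "topspace (connes_topology X \<mu>) \<subseteq> states X"
    unfolding connes_topology_def topology_generated_by_topspace by auto
  show "states X \<subseteq> topspace (connes_topology X \<mu>)"
    using openin_subset[OF openin_connes_ball] in_connes_ball[of _ 1] by (meson less_numeral_extra(1) subset_iff)
qed

lemma topspace_weak_star: "topspace (weak_star X) = states X"
  unfolding weak_star_def by (auto simp: states_def extensional_def)

lemma weak_star_evaluation: "f \<in> C_cont X \<Longrightarrow> continuous_map (weak_star X) euclidean (\<lambda>\<phi>. \<phi> f)"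
  unfolding weak_star_def by (intro continuous_map_from_subtopology continuous_map_product_projection)

text \<open>
  Approximate \<open>f\<close> uniformly by a locally constant \<open>g\<close>. A suitable multiple of \<open>g\<close> is
  admissible, so states that are close in the Connes metric are close on \<open>g\<close>, hence on \<open>f\<close>.
\<close>

lemma connes_evaluation:
  assumes f: "f \<in> C_cont X"
  shows "continuous_map (connes_topology X \<mu>) euclidean (\<lambda>\<phi>. \<phi> f)"
  unfolding continuous_map_def
proof (intro conjI allI impI)
  fix U :: "complex set" assume U: "openin euclidean U"
  show "openin (connes_topology X \<mu>) {\<phi> \<in> topspace (connes_topology X \<mu>). \<phi> f \<in> U}"
  proof (subst openin_subopen, clarify, unfold topspace_connes)
    fix \<phi> assume \<phi>: "\<phi> \<in> states X" "\<phi> f \<in> U"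
    obtain e where e: "e > 0" "ball (\<phi> f) e \<subseteq> U" using U \<phi>(2) by (auto simp: open_contains_ball)
    obtain n g where g: "g \<in> C_fin X n" "\<And>x. x \<in> X \<Longrightarrow> cmod (f x - g x) \<le> e / 8"
      by (rule C_inf_dense[OF f, of "e / 8"]) (use e(1) in simp, rule that, assumption+)
    obtain G where G: "G \<ge> 0" "\<And>x. cmod (g x) \<le> G" using C_fin_bounded[OF g(1)] by blast
    \<comment> \<open>the commutator of \<open>g\<close> has norm at most $2nG$; the summand 1 makes \<open>K\<close> positive\<close>
    define K where "K = 2 * real n * G + 1"
    have K: "K > 0" using G by (simp add: K_def add_nonneg_pos)
    define g' where "g' = (\<lambda>x. complex_of_real (1 / K) * g x)"
    have g'C: "g' \<in> C_fin X n" unfolding g'_def by (rule C_fin_scale[OF g(1)])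
    have gc: "g \<in> C_cont X" by (rule C_fin_cont[OF g(1)])
    have adm: "g' \<in> {f \<in> C_inf X. commutator_norm X \<mu> f \<le> 1}"
    proof -
      have "commutator_norm X \<mu> g' \<le> ennreal (2 * real n * (G / K))"
        by (rule commutator_norm_le[OF g'C]) (use G K in \<open>auto simp: g'_def norm_mult norm_divide divide_right_mono\<close>)
      also have "\<dots> \<le> 1"
      proof -
        have "2 * real n * (G / K) \<le> 1" using K by (simp add: K_def field_simps)
        then show ?thesis by simp
      qed
      finally show ?thesis using g'C by (auto simp: C_inf_def)
    qed
    have "connes_ball \<phi> (e / (2 * K)) \<subseteq> {\<phi> \<in> states X. \<phi> f \<in> U}"
    proof
      fix \<psi> assume "\<psi> \<in> connes_ball \<phi> (e / (2 * K))"
      then have \<psi>: "\<psi> \<in> states X" "connes_dist X \<mu> \<phi> \<psi> < ennreal (e / (2 * K))" by (auto simp: connes_ball_def)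
      have "ennreal (cmod (\<phi> g' - \<psi> g')) \<le> connes_dist X \<mu> \<phi> \<psi>"
        unfolding connes_dist_def by (rule SUP_upper[OF adm])
      from order_le_less_trans[OF this \<psi>(2)] have "cmod (\<phi> g' - \<psi> g') < e / (2 * K)"
        by (simp add: ennreal_less_iff)
      moreover have "\<phi> g' - \<psi> g' = (\<phi> g - \<psi> g) / complex_of_real K"
        unfolding g'_def state_scale[OF \<phi>(1) gc] state_scale[OF \<psi>(1) gc] by (simp add: diff_divide_distrib)
      ultimately have 1: "cmod (\<phi> g - \<psi> g) < e / 2"
        using K by (simp add: norm_divide field_simps)
      have fg: "(\<lambda>x. f x - g x) \<in> C_cont X" using C_cont_add[OF f C_cont_scale[OF gc, of "-1"]] by simp
      have 2: "cmod (\<phi> f - \<phi> g) \<le> e / 4"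
        using state_bound[OF \<phi>(1) fg g(2)] unfolding state_diff[OF \<phi>(1) f gc] by simp
      have 3: "cmod (\<psi> f - \<psi> g) \<le> e / 4"
        using state_bound[OF \<psi>(1) fg g(2)] unfolding state_diff[OF \<psi>(1) f gc] by simp
      have "\<phi> f - \<psi> f = (\<phi> f - \<phi> g) - (\<psi> f - \<psi> g) + (\<phi> g - \<psi> g)" by simp
      from arg_cong[OF this, of cmod] have "cmod (\<phi> f - \<psi> f) \<le> cmod (\<phi> f - \<phi> g) + cmod (\<psi> f - \<psi> g) + cmod (\<phi> g - \<psi> g)"
        using norm_triangle_ineq[of "(\<phi> f - \<phi> g) - (\<psi> f - \<psi> g)" "\<phi> g - \<psi> g"]
          norm_triangle_ineq4[of "\<phi> f - \<phi> g" "\<psi> f - \<psi> g"] by linarith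
      then have "\<psi> f \<in> ball (\<phi> f) e" using 1 2 3 by (simp add: dist_norm)
      then show "\<psi> \<in> {\<phi> \<in> states X. \<phi> f \<in> U}" using e(2) \<psi>(1) by blast
    qed
    moreover have "0 < e / (2 * K)" using e(1) K by simp
    ultimately show "\<exists>T. openin (connes_topology X \<mu>) T \<and> \<phi> \<in> T \<and> T \<subseteq> {\<phi> \<in> states X. \<phi> f \<in> U}"
      using openin_connes_ball[OF \<phi>(1)] in_connes_ball[OF \<phi>(1)] by blast
  qed
qed auto

lemma weak_star_open_imp_connes_open:
  assumes "openin (weak_star X) U"
  shows "openin (connes_topology X \<mu>) U"
proof -
  have "continuous_map (connes_topology X \<mu>) (weak_star X) (\<lambda>\<phi>. \<phi>)"
    unfolding weak_star_def continuous_map_in_subtopology continuous_map_componentwise topspace_connes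
    using connes_evaluation by (auto simp: states_def)
  from openin_continuous_map_preimage[OF this assms]
  have "openin (connes_topology X \<mu>) {\<phi> \<in> states X. \<phi> \<in> U}" unfolding topspace_connes .
  moreover have "U \<subseteq> states X" using openin_subset[OF assms] by (simp add: topspace_weak_star)
  ultimately show ?thesis by (simp add: Int_absorb1 Collect_conj_eq Int_def[symmetric])
qed

text \<open>
  Balls are weak-$*$ open because the bound of \<open>state_difference_bound\<close> involves only finitely many
  evaluations once $\varepsilon_k$ is small; the other inclusion is the continuity of evaluations.
\<close>

theorem connes_metric_criterion:
  assumes c: "c > 0" "\<tau> < 2" "\<And>n x. x \<in> X \<Longrightarrow> c / real (Suc n) powr \<tau> \<le> measure \<mu> (cell X n x)"
  shows "\<forall>\<phi>\<in>states X. \<forall>\<psi>\<in>states X. connes_dist X \<mu> \<phi> \<psi> < \<infinity>"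
    and "connes_topology X \<mu> = weak_star X"
proof -
  obtain \<epsilon> :: "nat \<Rightarrow> real" where \<epsilon>0: "\<epsilon> \<longlonglongrightarrow> 0" and \<epsilon>pos: "\<And>k. 0 \<le> \<epsilon> k"
    and \<epsilon>: "\<And>f k x. f \<in> C_inf X \<Longrightarrow> commutator_norm X \<mu> f \<le> 1 \<Longrightarrow> x \<in> X \<Longrightarrow>
      cmod (f x - cond_exp (2 ^ k - 1) f x) \<le> \<epsilon> k"
    by (rule admissible_tail[OF c(1,2)], erule c(3), rule that, assumption+)
  have bound: "connes_dist X \<mu> \<phi> \<psi> \<le> ennreal (4 * \<epsilon> k + (\<epsilon> k + \<epsilon> 0)
      * (\<Sum>w\<in>words X (2 ^ k - 1). cmod (\<phi> (indicator (cyl X w)) - \<psi> (indicator (cyl X w)))))"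
    if "\<phi> \<in> states X" "\<psi> \<in> states X" for \<phi> \<psi> k
    unfolding connes_dist_def
  proof (rule SUP_least)
    fix f assume f: "f \<in> {f \<in> C_inf X. commutator_norm X \<mu> f \<le> 1}"
    show "ennreal (cmod (\<phi> f - \<psi> f)) \<le> ennreal (4 * \<epsilon> k + (\<epsilon> k + \<epsilon> 0)
      * (\<Sum>w\<in>words X (2 ^ k - 1). cmod (\<phi> (indicator (cyl X w)) - \<psi> (indicator (cyl X w)))))"
      using f \<epsilon>[of f _ k] \<epsilon>[of f _ 0]
      by (intro ennreal_leI state_difference_bound[OF that]) auto
  qed
  show "\<forall>\<phi>\<in>states X. \<forall>\<psi>\<in>states X. connes_dist X \<mu> \<phi> \<psi> < \<infinity>"
  proof (intro ballI)
    fix \<phi> \<psi> assume "\<phi> \<in> states X" "\<psi> \<in> states X"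
    from order_le_less_trans[OF bound[OF this, of 0] ennreal_less_top]
    show "connes_dist X \<mu> \<phi> \<psi> < \<infinity>" by simp
  qed
  have ball_open: "openin (weak_star X) (connes_ball \<phi> r)" for \<phi> r
  proof (subst openin_subopen, rule ballI)
    fix \<psi> assume "\<psi> \<in> connes_ball \<phi> r"
    then have \<psi>: "\<psi> \<in> states X" "connes_dist X \<mu> \<phi> \<psi> < ennreal r" by (auto simp: connes_ball_def)
    then obtain t where t: "connes_dist X \<mu> \<phi> \<psi> = ennreal t" "0 \<le> t"
      by (cases "connes_dist X \<mu> \<phi> \<psi>") auto
    then have tr: "t < r" using \<psi>(2) by (simp add: ennreal_less_iff)
    define \<delta> where "\<delta> = r - t"
    have \<delta>: "\<delta> > 0" using tr by (simp add: \<delta>_def)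
    have "eventually (\<lambda>k. \<epsilon> k < \<delta> / 8) sequentially"
      using order_tendstoD(2)[OF \<epsilon>0, of "\<delta> / 8"] \<delta> by simp
    then obtain k where k: "\<epsilon> k < \<delta> / 8" using eventually_happens by fastforce
    let ?W = "words X (2 ^ k - 1)"
    let ?A = "(\<epsilon> k + \<epsilon> 0) * real (card ?W)"
    have A: "0 \<le> ?A" using \<epsilon>pos[of k] \<epsilon>pos[of 0] by simp
    \<comment> \<open>half of $\delta$ is spent on the common error $4\varepsilon_k$, half on the cylinder functions\<close>
    define s where "s = \<delta> / (2 * (?A + 1))"
    have s: "s > 0" "?A * s \<le> \<delta> / 2" using A \<delta> by (simp_all add: s_def field_simps)
    define V where "V = (\<Inter>w\<in>?W. {\<omega> \<in> topspace (weak_star X). \<omega> (indicator (cyl X w)) \<in> ball (\<psi> (indicator (cyl X w))) s})"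
    have ne: "?W \<noteq> {}" using X_nonempty by (simp add: words_window)
    have "openin (weak_star X) V"
      unfolding V_def
    proof (rule openin_Inter)
      fix S assume "S \<in> (\<lambda>w. {\<omega> \<in> topspace (weak_star X). \<omega> (indicator (cyl X w)) \<in> ball (\<psi> (indicator (cyl X w))) s}) ` ?W"
      then obtain w where w: "w \<in> ?W" "S = {\<omega> \<in> topspace (weak_star X). \<omega> (indicator (cyl X w)) \<in> ball (\<psi> (indicator (cyl X w))) s}"
        by blast
      show "openin (weak_star X) S"
        unfolding w(2) by (rule openin_continuous_map_preimage[OF weak_star_evaluation[OF cyl_cont[OF w(1)]]]) simp
    qed (use finite_words ne in auto)
    moreover have "\<psi> \<in> V" using \<psi>(1) s(1) by (simp add: V_def topspace_weak_star)
    moreover have "V \<subseteq> connes_ball \<phi> r"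
    proof
      fix \<omega> assume \<omega>V: "\<omega> \<in> V"
      then have \<omega>: "\<omega> \<in> states X" using ne by (auto simp: V_def topspace_weak_star)
      have "(\<Sum>w\<in>?W. cmod (\<psi> (indicator (cyl X w)) - \<omega> (indicator (cyl X w)))) \<le> (\<Sum>w\<in>?W. s)"
        by (rule sum_mono) (use \<omega>V in \<open>auto simp: V_def dist_norm less_imp_le\<close>)
      also have "\<dots> = real (card ?W) * s" by simp
      finally have "(\<epsilon> k + \<epsilon> 0) * (\<Sum>w\<in>?W. cmod (\<psi> (indicator (cyl X w)) - \<omega> (indicator (cyl X w))))
          \<le> (\<epsilon> k + \<epsilon> 0) * (real (card ?W) * s)"
        using \<epsilon>pos[of k] \<epsilon>pos[of 0] by (intro mult_left_mono) auto
      then have "4 * \<epsilon> k + (\<epsilon> k + \<epsilon> 0) * (\<Sum>w\<in>?W. cmod (\<psi> (indicator (cyl X w)) - \<omega> (indicator (cyl X w)))) < \<delta>"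
        using s(2) k by (simp add: mult.assoc)
      then have "connes_dist X \<mu> \<psi> \<omega> < ennreal \<delta>"
        using order_le_less_trans[OF bound[OF \<psi>(1) \<omega>, of k]] \<delta> by (simp add: ennreal_lessI)
      then have "connes_dist X \<mu> \<phi> \<psi> + connes_dist X \<mu> \<psi> \<omega> < ennreal t + ennreal \<delta>"
        unfolding t(1) by (simp add: ennreal_add_left_cancel_less)
      also have "\<dots> = ennreal r" using t(2) \<delta> by (simp add: \<delta>_def flip: ennreal_plus)
      finally show "\<omega> \<in> connes_ball \<phi> r"
        using order_le_less_trans[OF connes_dist_triangle] \<omega> by (auto simp: connes_ball_def)
    qed
    ultimately show "\<exists>T. openin (weak_star X) T \<and> \<psi> \<in> T \<and> T \<subseteq> connes_ball \<phi> r" by blast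
  qed
  have "openin (weak_star X) U" if "openin (connes_topology X \<mu>) U" for U
  proof -
    have "generate_topology_on {{\<psi> \<in> states X. connes_dist X \<mu> \<phi> \<psi> < ennreal r} | \<phi> r. \<phi> \<in> states X \<and> 0 < r} U"
      using that unfolding connes_topology_def openin_topology_generated_by_iff .
    then show ?thesis
      by (rule generate_topology_on_coarsest[OF istopology_openin, rotated])
        (use ball_open in \<open>auto simp: connes_ball_def\<close>)
  qed
  then show "connes_topology X \<mu> = weak_star X"
    using weak_star_open_imp_connes_open by (auto simp: topology_eq)
qed

end

section \<open>Measures of Sturmian cylinders\<close>

lemma shift_funpow: "(shift ^^ i) z = (\<lambda>m. z (m + int i))"
  by (induction i) (auto simp: shift_def fun_eq_iff algebra_simps)

text \<open>
  The preimages of \<open>C\<close> under the first \<open>N + 1\<close> powers of the shift cover \<open>X\<close> and have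
  equal measure.
\<close>

lemma measure_lower_bound_of_recurrence:
  assumes inv: "invariant_prob X \<mu>" and C: "C \<in> sets \<mu>"
    and rec: "\<And>z. z \<in> X \<Longrightarrow> \<exists>i\<le>N. (\<lambda>m. z (m + int i)) \<in> C"
  shows "1 / real (Suc N) \<le> measure \<mu> C"
proof -
  interpret prob_space \<mu> using inv by (simp add: invariant_prob_def)
  have sets: "sets \<mu> = sets (restrict_space borel X)" and sh: "shift \<in> measurable \<mu> \<mu>" "distr \<mu> \<mu> shift = \<mu>"
    using inv by (auto simp: invariant_prob_def)
  have sp: "space \<mu> = X" using sets_eq_imp_space_eq[OF sets] by (simp add: space_restrict_space)
  have pow: "shift ^^ i \<in> measurable \<mu> \<mu> \<and> distr \<mu> \<mu> (shift ^^ i) = \<mu>" for i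
  proof (induction i)
    case 0
    show ?case using distr_id[of \<mu>] by (simp add: id_def)
  next
    case (Suc i)
    then have "distr \<mu> \<mu> (shift \<circ> shift ^^ i) = \<mu>"
      using sh distr_distr[of shift \<mu> \<mu> "shift ^^ i" \<mu>] by simp
    then show ?case using measurable_comp[OF _ sh(1)] Suc unfolding funpow.simps by blast
  qed
  have m: "measure \<mu> ((shift ^^ i) -` C \<inter> space \<mu>) = measure \<mu> C" for i
    using measure_distr[of "shift ^^ i" \<mu> \<mu> C] pow[of i] C by simp
  have "space \<mu> = (\<Union>i\<le>N. (shift ^^ i) -` C \<inter> space \<mu>)"
    using rec unfolding sp by (auto simp: shift_funpow Bex_def)
  then have "1 = measure \<mu> (\<Union>i\<le>N. (shift ^^ i) -` C \<inter> space \<mu>)" using prob_space by simp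
  also have "\<dots> \<le> (\<Sum>i\<le>N. measure \<mu> ((shift ^^ i) -` C \<inter> space \<mu>))"
    by (rule finite_measure_subadditive_finite) (use pow C in \<open>auto intro: measurable_sets\<close>)
  also have "\<dots> = real (Suc N) * measure \<mu> C" by (simp add: m)
  finally show ?thesis by (simp add: field_simps)
qed

lemma sturmian_cell_measure:
  assumes th: "0 < \<theta>" "\<theta> < 1" and c: "c > 0" "\<And>j p :: int. 0 < j \<Longrightarrow> c \<le> \<bar>of_int j * \<theta> - of_int p\<bar> * of_int j powr \<beta>"
    and b: "\<beta> \<ge> 1" and inv: "invariant_prob (sturmian \<theta>) \<mu>"
  shows "\<exists>d>0. \<forall>n. \<forall>x\<in>sturmian \<theta>. d / real (Suc n) powr (\<beta> * \<beta>) \<le> measure \<mu> (cell (sturmian \<theta>) n x)"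
proof -
  obtain K where K: "K > 0" and rec: "\<And>n a y z. y \<in> sturmian \<theta> \<Longrightarrow> z \<in> sturmian \<theta> \<Longrightarrow>
      \<exists>i::nat. real i \<le> K * real (Suc n) powr (\<beta> * \<beta>) \<and> (\<forall>m\<in>{a..a + int n}. z (m + int i) = y m)"
    using sturmian_recurrence[OF th c b] by blast
  have "1 / (K + 1) / real (Suc n) powr (\<beta> * \<beta>) \<le> measure \<mu> (cell (sturmian \<theta>) n x)" if x: "x \<in> sturmian \<theta>" for n x
  proof -
    let ?L = "real (Suc n) powr (\<beta> * \<beta>)"
    define N where "N = nat \<lfloor>K * ?L\<rfloor>"
    obtain a where a: "window n = [a..a + int n - 1]" using window_eq_interval by blast
    have "1 / real (Suc N) \<le> measure \<mu> (cell (sturmian \<theta>) n x)"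
    proof (rule measure_lower_bound_of_recurrence[OF inv cell_in_sets])
      show "sets \<mu> = sets (restrict_space borel (sturmian \<theta>))" using inv by (simp add: invariant_prob_def)
      fix z assume z: "z \<in> sturmian \<theta>"
      obtain i :: nat where i: "real i \<le> K * ?L" "\<forall>m\<in>{a..a + int n}. z (m + int i) = x m"
        using rec[OF x z] by blast
      have "i \<le> N" using i(1) unfolding N_def by linarith
      moreover have "(\<lambda>m. z (m + int i)) \<in> cell (sturmian \<theta>) n x"
        using sturmian_shift[OF z, of "int i"] i(2) by (auto simp: cell_def agree_def a)
      ultimately show "\<exists>i\<le>N. (\<lambda>m. z (m + int i)) \<in> cell (sturmian \<theta>) n x" by blast
    qed
    moreover have "real (Suc N) \<le> (K + 1) * ?L"
    proof -
      have "1 \<le> ?L" using b by (intro ge_one_powr_ge_zero) auto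
      moreover have "real N \<le> K * ?L" using K unfolding N_def by simp
      ultimately show ?thesis by (simp add: distrib_right)
    qed
    then have "1 / ((K + 1) * ?L) \<le> 1 / real (Suc N)" by (intro divide_left_mono) (use K in auto)
    ultimately show ?thesis by simp
  qed
  then show ?thesis using K by (intro exI[of _ "1 / (K + 1)"]) auto
qed

lemma finite_words_of_finite_alphabet:
  assumes "\<And>x n. x \<in> X \<Longrightarrow> x n \<in> A" "finite A"
  shows "finite (words X n)"
proof -
  have "words X n \<subseteq> {xs. set xs \<subseteq> A \<and> length xs = n}"
    using assms(1) by (auto simp: words_def)
  then show ?thesis using finite_lists_length_eq[OF assms(2)] finite_subset by blast
qed

section \<open>The Connes metric of a Sturmian subshift\<close>

theorem theorem5p14:
  fixes \<theta> :: real and a :: "nat \<Rightarrow> nat" and \<mu> :: "(int \<Rightarrow> nat) measure"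
  assumes "0 < \<theta>" and "\<theta> < 1" and "\<theta> \<notin> \<rat>"
    and "has_cfrac \<theta> a"
    and "\<exists>C s :: real. C \<ge> 1 \<and> s \<ge> 1 \<and> (\<forall>j\<ge>1. real (a j) \<le> C * real j powr s)"
    and "invariant_prob (sturmian \<theta>) \<mu>"
  shows "(\<forall>\<phi>\<in>states (sturmian \<theta>). \<forall>\<psi>\<in>states (sturmian \<theta>).
            connes_dist (sturmian \<theta>) \<mu> \<phi> \<psi> < \<infinity>) \<and>
         connes_topology (sturmian \<theta>) \<mu> = weak_star (sturmian \<theta>)"
proof -
  obtain C s where "C \<ge> 1" "s \<ge> 1" "\<forall>j\<ge>1. real (a j) \<le> C * real j powr s" using assms(5) by blast
  then obtain c where c: "c > 0" "\<And>j p :: int. 0 < j \<Longrightarrow> c \<le> \<bar>of_int j * \<theta> - of_int p\<bar> * of_int j powr (5/4)"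
    using diophantine_bound[OF assms(4,3)] by blast
  obtain d where d: "d > 0" "\<And>n x. x \<in> sturmian \<theta> \<Longrightarrow>
      d / real (Suc n) powr (5/4 * (5/4)) \<le> measure \<mu> (cell (sturmian \<theta>) n x)"
    using sturmian_cell_measure[OF assms(1,2) c _ assms(6)] by auto
  interpret prob_space \<mu> using assms(6) by (simp add: invariant_prob_def)
  interpret compact_measured_subshift "sturmian \<theta>" \<mu>
  proof
    show "(\<lambda>n. w (n + k)) \<in> sturmian \<theta>" if "w \<in> sturmian \<theta>" for w k by (rule sturmian_shift[OF that])
    show "finite (words (sturmian \<theta>) n)" for n
      by (rule finite_words_of_finite_alphabet[of _ "{0, 1}"]) (auto simp: sturmian_eq_codings coding_left_def coding_right_def split: if_splits)
    show "sets \<mu> = sets (restrict_space borel (sturmian \<theta>))" using assms(6) by (simp add: invariant_prob_def)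
    show "0 < measure \<mu> (cell (sturmian \<theta>) n x)" if "x \<in> sturmian \<theta>" for n x
      using d(1) d(2)[OF that, of n] by (intro less_le_trans[OF _ d(2)[OF that]]) simp
    show "compact (sturmian \<theta>)" by (rule compact_sturmian[OF assms(1,2)])
  qed
  show ?thesis
    using connes_metric_criterion[OF d(1) _ d(2)] by simp
qed

end
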